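(* Let $\mathcal{A}$ be a Banach space, let $\mathcal{H}$ be a Hilbert space and let $e\in\mathcal{H}$ with $\|e\|=1$. Let a completely bounded affine map $L:\mathcal{A}\otimes\mathcal{B}(E)\to\mathcal{B}(\mathcal{H})^*\otimes\mathcal{B}(E)$ (for Hilbert spaces $E$) be given by $$L(X):=T\otimes I_E+\Lambda(X),$$ where $0\le T\in\mathcal{B}(\mathcal{H})^*$ and $\Lambda:\mathcal{A}\to\mathcal{B}(\mathcal{H})^*$ is a self-adjoint completely bounded linear map that is completely absolutely continuous with respect to $T$. Then the function $$F(X)=(e\otimes I_E)\,\mathcal{S}_{e^*\otimes E}(L(X))\,(e^*\otimes I_E)$$ is well defined and analytic at each $X\in\{Y\in\mathcal{A}\otimes\mathcal{B}(E):L(\Re(Y))>0\}$. Moreover, with $D(E):=\{Y\in\mathcal{A}\otimes\mathcal{B}(E): Y \text{ self-adjoint},\ L(Y)\ge0\}$, the collection $(D(E))$ is closed under direct sums, $F$ on $(D(E))$ preserves direct sums, and $$F\left((I_{\mathcal{A}}\otimes W^* )X(I_{\mathcal{A}}\otimes W)\right)\ge W^*F(X)W$$ for each isometry $W:E\to K$ between Hilbert spaces and $X\in D(K)$ such that $(I_{\mathcal{A}}\otimes W^* )X(I_{\mathcal{A}}\otimes W)\in D(E)$.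
   Context: Tensor products are projective tensor products; $\mathcal{A}\otimes\mathcal{B}(E)$ carries the involution induced from one on $\mathcal{A}$, and $\Re(Y)=(Y+Y^* )/2$. $\overline{\mathcal{B}(\mathcal{H},E)_{T}}$ is the Hilbert space completion of $\mathcal{B}(\mathcal{H},E)/\{V:T(V^*V)=0\}$ for the inner product $\langle W,V\rangle_{T}=T(W^*V)$. The linear map $\Lambda:\mathcal{A}\to\mathcal{B}(\mathcal{H})^*$ is identified with the functional $\lambda\in(\mathcal{A}\otimes\mathcal{B}(\mathcal{H}))^*$, $\lambda(a\otimes B)=\Lambda(a)(B)$; self-adjoint means $\lambda$ is a self-adjoint functional. Complete boundedness and complete absolute continuity with respect to $T$ mean that for each Hilbert space $E$ there is a constant $c_E$ with $|\lambda((I_{\mathcal{A}}\otimes W^* )X(I_{\mathcal{A}}\otimes V))|\le c_E\|X\|T(W^*W)^{1/2}T(V^*V)^{1/2}$ for all $X\in\mathcal{A}\otimes\mathcal{B}(E)$, $V,W\in\mathcal{B}(\mathcal{H},E)$. Then $L(X)$ denotes the bounded operator on $\overline{\mathcal{B}(\mathcal{H},E)_{T}}$ determined by $$\langle W,L(X)V\rangle_{T}=T(W^*V)+\lambda((I_{\mathcal{A}}\otimes W^* )X(I_{\mathcal{A}}\otimes V)).$$ $L(Y)\ge0$ means positive semidefinite and $L(Y)>0$ means positive and invertible, as operators on this space. $e^*\otimes E$ is the subspace of $\overline{\mathcal{B}(\mathcal{H},E)_{T}}$ of classes of the rank one operators $we^*:h\mapsto\langle e,h\rangle w$, $w\in E$.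 For a closed subspace $S$ of a Hilbert space $H$ and a bounded operator $Z$ on $H$ with block form $(Z_{ij})$ relative to $S\oplus S^\perp$: if $Z_{22}$ is invertible the Schur complement is $\mathcal{S}_S(Z)=Z_{11}-Z_{12}Z_{22}^{-1}Z_{21}$; if $Z\ge0$, then $\mathcal{S}_S(Z)$ is the largest self-adjoint operator $A$ on $S$ with $A\oplus0_{S^\perp}\le Z$ (the two agree when both apply). For an operator $A$ on $S=e^*\otimes E$, $(e\otimes I_E)A(e^*\otimes I_E)$ is the operator $G$ on $E$ with $\langle w,Gv\rangle=\langle we^*,A(ve^* )\rangle_{T}$ for $v,w\in E$. Direct sums: $D(E)\oplus D(K)\subseteq D(E\oplus K)$ and $F(A\oplus B)=F(A)\oplus F(B)$. *)

theory Defs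
  imports "HOL-Analysis.Analysis"
begin

section \<open>Complex Banach and Hilbert spaces\<close>

class complex_normed_vector = real_normed_vector +
  fixes scaleC :: "complex \<Rightarrow> 'a \<Rightarrow> 'a"  (infixr \<open>*\<^sub>C\<close> 75)
  assumes scaleC_add_right: "c *\<^sub>C (x + y) = c *\<^sub>C x + c *\<^sub>C y"
    and scaleC_add_left: "(c + d) *\<^sub>C x = c *\<^sub>C x + d *\<^sub>C x"
    and scaleC_scaleC: "c *\<^sub>C (d *\<^sub>C x) = (c * d) *\<^sub>C x"
    and scaleR_scaleC: "r *\<^sub>R x = complex_of_real r *\<^sub>C x"
    and norm_scaleC: "norm (c *\<^sub>C x) = cmod c * norm x"

class cbanach = complex_normed_vector + banach

text \<open>Inner products are conjugate linear in the first argument.\<close>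

class chilbert = cbanach +
  fixes cinner :: "'a \<Rightarrow> 'a \<Rightarrow> complex"
  assumes cinner_commute: "cinner x y = cnj (cinner y x)"
    and cinner_add_right: "cinner x (y + z) = cinner x y + cinner x z"
    and cinner_scaleC_right: "cinner x (c *\<^sub>C y) = c * cinner x y"
    and cinner_self: "cinner x x = complex_of_real ((norm x)\<^sup>2)"

lemma scaleC_one [simp]: "1 *\<^sub>C (x::'a::complex_normed_vector) = x"
  using scaleR_scaleC[of 1 x] by simp

lemma scaleC_zero_left [simp]: "0 *\<^sub>C (x::'a::complex_normed_vector) = 0"
  using scaleR_scaleC[of 0 x] by simp

lemma scaleC_zero_right [simp]: "c *\<^sub>C (0::'a::complex_normed_vector) = 0"
  using norm_scaleC[of c 0] by simp

lemma scaleC_minus_right: "c *\<^sub>C (- x) = - (c *\<^sub>C (x::'a::complex_normed_vector))"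
  using scaleC_add_right[of c x "-x"] by (simp add: eq_neg_iff_add_eq_0 add.commute)

lemma scaleC_diff_right: "c *\<^sub>C (x - y) = c *\<^sub>C x - c *\<^sub>C (y::'a::complex_normed_vector)"
  using scaleC_add_right[of c x "-y"] by (simp add: scaleC_minus_right)

lemma scaleC_scaleR_commute:
  "c *\<^sub>C (r *\<^sub>R x) = r *\<^sub>R (c *\<^sub>C (x::'a::complex_normed_vector))"
  by (simp add: scaleR_scaleC scaleC_scaleC mult.commute)

lemma bounded_linear_scaleC_right: "bounded_linear (\<lambda>x::'a::complex_normed_vector. c *\<^sub>C x)"
  by (rule bounded_linear_intro[where K = "cmod c"])
    (auto simp: scaleC_add_right scaleC_scaleR_commute norm_scaleC mult.commute)

lemma cinner_add_left: "cinner (x + y) z = cinner x z + cinner y (z::'a::chilbert)"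
  by (metis cinner_add_right cinner_commute complex_cnj_add)

lemma cinner_scaleC_left: "cinner (c *\<^sub>C x) (y::'a::chilbert) = cnj c * cinner x y"
  by (metis cinner_scaleC_right cinner_commute complex_cnj_mult)

lemma cinner_zero_right [simp]: "cinner (x::'a::chilbert) 0 = 0"
  using cinner_add_right[of x 0 0] by simp

lemma cinner_Cauchy_Schwarz: "cmod (cinner x y) \<le> norm x * norm (y::'a::chilbert)"
proof (cases "x = 0")
  case True
  then show ?thesis using cinner_commute[of x y] by simp
next
  case False
  define n where "n = complex_of_real ((norm x)\<^sup>2)"
  define c where "c = cinner x y"
  have n: "n \<noteq> 0" "cinner x x = n" "cnj n = n"
    using False by (simp_all add: n_def cinner_self)
  define z where "z = n *\<^sub>C y + (- c) *\<^sub>C x"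
  have yx: "cinner y x = cnj c" unfolding c_def by (rule cinner_commute)
  have "complex_of_real ((norm z)\<^sup>2) = cinner z z" by (simp add: cinner_self)
  also have "\<dots> = n * (n * cinner y y - c * cnj c)"
    unfolding z_def
    by (simp add: cinner_add_left cinner_add_right cinner_scaleC_left cinner_scaleC_right
        n yx c_def[symmetric] algebra_simps)
  also have "\<dots> = complex_of_real ((norm x)\<^sup>2 * ((norm x)\<^sup>2 * (norm y)\<^sup>2 - (cmod c)\<^sup>2))"
    by (simp add: n_def cinner_self complex_norm_square[symmetric])
  finally have "0 \<le> (norm x)\<^sup>2 * ((norm x)\<^sup>2 * (norm y)\<^sup>2 - (cmod c)\<^sup>2)"
    by (metis of_real_eq_iff zero_le_power2)
  then have "(cmod c)\<^sup>2 \<le> (norm x * norm y)\<^sup>2"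
    unfolding power_mult_distrib using False by (auto simp: zero_le_mult_iff)
  then show ?thesis unfolding c_def by (rule power2_le_imp_le) simp
qed

instantiation complex :: chilbert
begin

definition "scaleC_complex (c::complex) (x::complex) = c * x"
definition "cinner_complex (x::complex) (y::complex) = cnj x * y"

instance
proof
  fix x y :: complex
  show "cinner x x = complex_of_real ((norm x)\<^sup>2)"
    unfolding cinner_complex_def complex_norm_square by (rule mult.commute)
qed (simp_all add: scaleC_complex_def cinner_complex_def distrib_left distrib_right
    scaleR_conv_of_real norm_mult)

end

instantiation prod :: (complex_normed_vector, complex_normed_vector) complex_normed_vector
begin

definition "scaleC_prod c (p::'a \<times> 'b) = (c *\<^sub>C fst p, c *\<^sub>C snd p)"

instance
proof
  fix p :: "'a \<times> 'b" and c :: complex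
  have "norm (c *\<^sub>C p) = sqrt ((cmod c)\<^sup>2 * ((norm (fst p))\<^sup>2 + (norm (snd p))\<^sup>2))"
    by (simp add: scaleC_prod_def norm_prod_def norm_scaleC power_mult_distrib distrib_left)
  then show "norm (c *\<^sub>C p) = cmod c * norm p"
    by (simp add: norm_prod_def real_sqrt_mult)
qed (simp_all add: scaleC_prod_def prod_eq_iff scaleC_add_right scaleC_add_left scaleC_scaleC
    scaleR_scaleC)

end

instance prod :: (cbanach, cbanach) cbanach ..

instantiation prod :: (chilbert, chilbert) chilbert
begin

definition "cinner_prod (p::'a \<times> 'b) q = cinner (fst p) (fst q) + cinner (snd p) (snd q)"

instance
proof
  fix p q r :: "'a \<times> 'b" and c :: complex
  show "cinner p q = cnj (cinner q p)"
    by (simp add: cinner_prod_def cinner_commute[of "fst q"] cinner_commute[of "snd q"])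
  show "cinner p (q + r) = cinner p q + cinner p r"
    by (simp add: cinner_prod_def cinner_add_right)
  show "cinner p (c *\<^sub>C q) = c * cinner p q"
    by (simp add: cinner_prod_def scaleC_prod_def cinner_scaleC_right algebra_simps)
  show "cinner p p = complex_of_real ((norm p)\<^sup>2)"
    by (simp add: cinner_prod_def norm_prod_def cinner_self)
qed

end


section \<open>Bounded complex linear operators\<close>

definition bounded_clinear :: "('a::complex_normed_vector \<Rightarrow> 'b::complex_normed_vector) \<Rightarrow> bool"
  where "bounded_clinear f \<longleftrightarrow> bounded_linear f \<and> (\<forall>c x. f (c *\<^sub>C x) = c *\<^sub>C f x)"

typedef (overloaded) ('a, 'b) cblinfun  (\<open>(_ \<Rightarrow>\<^sub>C\<^sub>L /_)\<close> [22, 21] 21) =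
  "{f :: 'a::complex_normed_vector \<Rightarrow> 'b::complex_normed_vector. bounded_clinear f}"
  morphisms cblinfun_apply CBlinfun
  by (rule exI[where x = "\<lambda>_. 0"]) (simp add: bounded_clinear_def)

setup_lifting type_definition_cblinfun

declare [[coercion "cblinfun_apply ::
  ('a::complex_normed_vector \<Rightarrow>\<^sub>C\<^sub>L 'b::complex_normed_vector) \<Rightarrow> 'a \<Rightarrow> 'b"]]

lemma cblinfun_eqI: "(\<And>x. cblinfun_apply f x = cblinfun_apply g x) \<Longrightarrow> f = g"
  by transfer auto

lemma bounded_linear_cblinfun: "bounded_linear (cblinfun_apply f)"
  by transfer (simp add: bounded_clinear_def)

lemma cblinfun_scaleC_right: "cblinfun_apply f (c *\<^sub>C x) = c *\<^sub>C cblinfun_apply f x"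
  by transfer (simp add: bounded_clinear_def)

lemma cblinfun_add_right: "cblinfun_apply f (x + y) = cblinfun_apply f x + cblinfun_apply f y"
  by (rule linear_add[OF bounded_linear.linear[OF bounded_linear_cblinfun]])

lemma cblinfun_zero_right [simp]: "cblinfun_apply f 0 = 0"
  by (rule linear_0[OF bounded_linear.linear[OF bounded_linear_cblinfun]])

instantiation cblinfun :: (complex_normed_vector, complex_normed_vector) complex_normed_vector
begin

lift_definition norm_cblinfun :: "('a \<Rightarrow>\<^sub>C\<^sub>L 'b) \<Rightarrow> real" is onorm .

lift_definition zero_cblinfun :: "'a \<Rightarrow>\<^sub>C\<^sub>L 'b" is "\<lambda>x. 0"
  by (simp add: bounded_clinear_def)

lift_definition plus_cblinfun :: "('a \<Rightarrow>\<^sub>C\<^sub>L 'b) \<Rightarrow> ('a \<Rightarrow>\<^sub>C\<^sub>L 'b) \<Rightarrow> ('a \<Rightarrow>\<^sub>C\<^sub>L 'b)"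
  is "\<lambda>f g x. f x + g x"
  by (simp add: bounded_clinear_def bounded_linear_add scaleC_add_right)

lift_definition minus_cblinfun :: "('a \<Rightarrow>\<^sub>C\<^sub>L 'b) \<Rightarrow> ('a \<Rightarrow>\<^sub>C\<^sub>L 'b) \<Rightarrow> ('a \<Rightarrow>\<^sub>C\<^sub>L 'b)"
  is "\<lambda>f g x. f x - g x"
  by (simp add: bounded_clinear_def bounded_linear_sub scaleC_diff_right)

lift_definition uminus_cblinfun :: "('a \<Rightarrow>\<^sub>C\<^sub>L 'b) \<Rightarrow> ('a \<Rightarrow>\<^sub>C\<^sub>L 'b)" is "\<lambda>f x. - f x"
  by (simp add: bounded_clinear_def bounded_linear_minus scaleC_minus_right)

lift_definition scaleR_cblinfun :: "real \<Rightarrow> ('a \<Rightarrow>\<^sub>C\<^sub>L 'b) \<Rightarrow> ('a \<Rightarrow>\<^sub>C\<^sub>L 'b)"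
  is "\<lambda>r f x. r *\<^sub>R f x"
  by (auto simp: bounded_clinear_def scaleC_scaleR_commute
      intro: bounded_linear_compose bounded_linear_scaleR_right)

lift_definition scaleC_cblinfun :: "complex \<Rightarrow> ('a \<Rightarrow>\<^sub>C\<^sub>L 'b) \<Rightarrow> ('a \<Rightarrow>\<^sub>C\<^sub>L 'b)"
  is "\<lambda>c f x. c *\<^sub>C f x"
  by (auto simp: bounded_clinear_def scaleC_scaleC mult.commute
      intro: bounded_linear_compose bounded_linear_scaleC_right)

definition "sgn_cblinfun (f :: 'a \<Rightarrow>\<^sub>C\<^sub>L 'b) = inverse (norm f) *\<^sub>R f"
definition "dist_cblinfun (f :: 'a \<Rightarrow>\<^sub>C\<^sub>L 'b) g = norm (f - g)"
definition [code del]: "(uniformity :: (('a \<Rightarrow>\<^sub>C\<^sub>L 'b) \<times> ('a \<Rightarrow>\<^sub>C\<^sub>L 'b)) filter)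
  = (INF e\<in>{0 <..}. principal {(x, y). dist x y < e})"
definition [code del]: "open_cblinfun (S :: ('a \<Rightarrow>\<^sub>C\<^sub>L 'b) set)
  \<longleftrightarrow> (\<forall>x\<in>S. \<forall>\<^sub>F (x', y) in uniformity. x' = x \<longrightarrow> y \<in> S)"

instance
proof
  fix f g h :: "'a \<Rightarrow>\<^sub>C\<^sub>L 'b" and c d :: complex and r s :: real
  show "norm (f + g) \<le> norm f + norm g"
    by transfer (simp add: onorm_triangle bounded_clinear_def)
  show "norm (r *\<^sub>R f) = \<bar>r\<bar> * norm f"
    by transfer (simp add: onorm_scaleR bounded_clinear_def)
  show "norm f = 0 \<longleftrightarrow> f = 0"
    by transfer (auto simp: onorm_eq_0 bounded_clinear_def)
  show "norm (c *\<^sub>C f) = cmod c * norm f"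
  proof (cases "c = 0")
    case True
    then show ?thesis by transfer (simp add: onorm_zero)
  next
    case False
    have le: "norm (c *\<^sub>C f) \<le> cmod c * norm f" for c and f :: "'a \<Rightarrow>\<^sub>C\<^sub>L 'b"
    proof (transfer)
      fix c and f :: "'a \<Rightarrow> 'b"
      assume "bounded_clinear f"
      then have f: "bounded_linear f" by (simp add: bounded_clinear_def)
      show "onorm (\<lambda>x. c *\<^sub>C f x) \<le> cmod c * onorm f"
        by (rule onorm_bound)
          (auto simp: norm_scaleC mult.assoc
            intro!: mult_left_mono mult_nonneg_nonneg onorm[OF f] onorm_pos_le[OF f])
    qed
    have "inverse c *\<^sub>C c *\<^sub>C f = f"
      using False by transfer (simp add: scaleC_scaleC)
    then have "norm f \<le> inverse (cmod c) * norm (c *\<^sub>C f)"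
      using le[of "inverse c" "c *\<^sub>C f"] by (simp add: norm_inverse)
    then have "cmod c * norm f \<le> norm (c *\<^sub>C f)"
      using False by (simp add: field_simps)
    then show ?thesis using le[of c f] by simp
  qed
  show "f + g + h = f + (g + h)" "f + g = g + f" "0 + f = f" "- f + f = 0" "f - g = f + - g"
    by (transfer, simp add: ac_simps)+
  show "r *\<^sub>R (f + g) = r *\<^sub>R f + r *\<^sub>R g" "(r + s) *\<^sub>R f = r *\<^sub>R f + s *\<^sub>R f"
    "r *\<^sub>R s *\<^sub>R f = (r * s) *\<^sub>R f" "1 *\<^sub>R f = f"
    by (transfer, simp add: scaleR_add_right scaleR_add_left)+
  show "c *\<^sub>C (f + g) = c *\<^sub>C f + c *\<^sub>C g" "(c + d) *\<^sub>C f = c *\<^sub>C f + d *\<^sub>C f"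
    "c *\<^sub>C d *\<^sub>C f = (c * d) *\<^sub>C f"
    by (transfer, simp add: scaleC_add_right scaleC_add_left scaleC_scaleC)+
  show "r *\<^sub>R f = complex_of_real r *\<^sub>C f"
    by (transfer, rule ext, rule scaleR_scaleC)
qed (simp_all add: sgn_cblinfun_def dist_cblinfun_def uniformity_cblinfun_def open_cblinfun_def)

end

lemma cblinfun_simps:
  fixes f g :: "'a::complex_normed_vector \<Rightarrow>\<^sub>C\<^sub>L 'b::complex_normed_vector"
  shows "cblinfun_apply (f + g) x = f x + g x" "cblinfun_apply (f - g) x = f x - g x"
    "cblinfun_apply (- f) x = - f x" "cblinfun_apply 0 x = (0::'b)"
    "cblinfun_apply (r *\<^sub>R f) x = r *\<^sub>R f x" "cblinfun_apply (c *\<^sub>C f) x = c *\<^sub>C f x"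
  by (transfer, simp)+

lemma norm_cblinfun:
  "norm (cblinfun_apply f x) \<le> norm f * norm x"
  by transfer (simp add: onorm bounded_clinear_def)

instance cblinfun :: (complex_normed_vector, cbanach) cbanach
proof
  fix X :: "nat \<Rightarrow> 'a \<Rightarrow>\<^sub>C\<^sub>L 'b"
  assume X: "Cauchy X"
  define Y where "Y n = Blinfun (cblinfun_apply (X n))" for n
  have Yapp: "blinfun_apply (Y n) x = X n x" for n x
    unfolding Y_def by (simp add: bounded_linear_Blinfun_apply bounded_linear_cblinfun)
  have nrm: "norm (Blinfun (cblinfun_apply f)) = norm f" for f :: "'a \<Rightarrow>\<^sub>C\<^sub>L 'b"
    by (simp add: norm_blinfun.rep_eq norm_cblinfun.rep_eq bounded_linear_Blinfun_apply
        bounded_linear_cblinfun)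
  have nrm_diff: "norm (f - Blinfun (cblinfun_apply g)) = norm (h - g)"
    if "\<And>x. blinfun_apply f x = cblinfun_apply h x" for f and g h :: "'a \<Rightarrow>\<^sub>C\<^sub>L 'b"
  proof -
    have "f - Blinfun (cblinfun_apply g) = Blinfun (cblinfun_apply (h - g))"
      by (rule blinfun_eqI) (simp add: blinfun.diff_left bounded_linear_Blinfun_apply
          bounded_linear_cblinfun that cblinfun_simps)
    then show ?thesis by (simp add: nrm)
  qed
  have "dist (Y m) (Y n) = dist (X m) (X n)" for m n
    using nrm_diff[of "Y m" "X m" "X n"] by (simp add: Yapp dist_norm Y_def[of n])
  then have "Cauchy Y" using X by (simp add: Cauchy_def)
  then obtain y where y: "Y \<longlonglongrightarrow> y"
    by (auto simp: Cauchy_convergent_iff convergent_def)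
  have lim: "(\<lambda>n. X n x) \<longlonglongrightarrow> y x" for x
    using blinfun.tendsto[OF y tendsto_const[of x]] by (simp add: Yapp)
  have "y (c *\<^sub>C x) = c *\<^sub>C y x" for c x
  proof (rule LIMSEQ_unique[OF lim])
    show "(\<lambda>n. X n (c *\<^sub>C x)) \<longlonglongrightarrow> c *\<^sub>C y x"
      unfolding cblinfun_scaleC_right
      by (rule bounded_linear.tendsto[OF bounded_linear_scaleC_right lim])
  qed
  then have z: "cblinfun_apply (CBlinfun y) = blinfun_apply y"
    by (simp add: CBlinfun_inverse bounded_clinear_def blinfun.bounded_linear_right)
  have "dist (X n) (CBlinfun y) = dist (Y n) y" for n
    using nrm_diff[of y "CBlinfun y" "X n"]
    by (simp add: z dist_norm Y_def norm_minus_commute)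
  then have "X \<longlonglongrightarrow> CBlinfun y"
    using y by (simp add: tendsto_iff)
  then show "convergent X" by (auto simp: convergent_def)
qed

lift_definition cblinfun_compose ::
  "('b::complex_normed_vector \<Rightarrow>\<^sub>C\<^sub>L 'c::complex_normed_vector) \<Rightarrow>
   ('a::complex_normed_vector \<Rightarrow>\<^sub>C\<^sub>L 'b) \<Rightarrow> ('a \<Rightarrow>\<^sub>C\<^sub>L 'c)"  (infixl \<open>o\<^sub>C\<close> 70)
  is "\<lambda>f g x. f (g x)"
  by (auto simp: bounded_clinear_def intro: bounded_linear_compose)

text \<open>The Hilbert space adjoint.\<close>

definition adj :: "('a::chilbert \<Rightarrow>\<^sub>C\<^sub>L 'b::chilbert) \<Rightarrow> ('b \<Rightarrow>\<^sub>C\<^sub>L 'a)"  (\<open>_\<^sup>\<dagger>\<close> [99] 99)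
  where "adj A = (THE B :: 'b \<Rightarrow>\<^sub>C\<^sub>L 'a. \<forall>x y. cinner (B y) x = cinner y (A x))"

text \<open>The rank one operator \<open>w e\<^sup>*\<close>.\<close>

lift_definition rank1 :: "'e::chilbert \<Rightarrow> 'h::chilbert \<Rightarrow> ('h \<Rightarrow>\<^sub>C\<^sub>L 'e)"
  is "\<lambda>w e h. cinner e h *\<^sub>C w"
proof -
  fix w :: 'e and e :: 'h
  have "bounded_linear (\<lambda>h. cinner e h *\<^sub>C w)"
  proof (rule bounded_linear_intro[where K = "norm e * norm w"])
    show "norm (cinner e x *\<^sub>C w) \<le> norm x * (norm e * norm w)" for x
      using mult_right_mono[OF cinner_Cauchy_Schwarz[of e x] norm_ge_zero[of w]]
      by (simp add: norm_scaleC mult_ac)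
  qed (simp_all add: cinner_add_right scaleC_add_left scaleR_scaleC cinner_scaleC_right
      scaleC_scaleC)
  then show "bounded_clinear (\<lambda>h. cinner e h *\<^sub>C w)"
    by (simp add: bounded_clinear_def cinner_scaleC_right scaleC_scaleC)
qed

definition op_dsum :: "('e::chilbert \<Rightarrow>\<^sub>C\<^sub>L 'e) \<Rightarrow> ('k::chilbert \<Rightarrow>\<^sub>C\<^sub>L 'k) \<Rightarrow> (('e \<times> 'k) \<Rightarrow>\<^sub>C\<^sub>L ('e \<times> 'k))"
    (infixr \<open>\<oplus>\<^sub>o\<^sub>p\<close> 65)
  where "A \<oplus>\<^sub>o\<^sub>p B = CBlinfun (\<lambda>p. (A (fst p), B (snd p)))"

lemma op_dsum_apply: "cblinfun_apply (A \<oplus>\<^sub>o\<^sub>p B) p = (A (fst p), B (snd p))"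
proof -
  have "bounded_linear (\<lambda>p. (A (fst p), B (snd p)))"
    by (intro bounded_linear_Pair bounded_linear_compose[OF bounded_linear_cblinfun]
        bounded_linear_fst bounded_linear_snd)
  then show ?thesis
    unfolding op_dsum_def
    by (subst CBlinfun_inverse) (simp_all add: bounded_clinear_def scaleC_prod_def cblinfun_scaleC_right)
qed

definition positive_op :: "('x::chilbert \<Rightarrow>\<^sub>C\<^sub>L 'x) \<Rightarrow> bool"
  where "positive_op A \<longleftrightarrow> (\<forall>x. cinner x (A x) \<in> \<real>\<^sub>\<ge>\<^sub>0)"

definition loewner_le :: "('x::chilbert \<Rightarrow>\<^sub>C\<^sub>L 'x) \<Rightarrow> ('x \<Rightarrow>\<^sub>C\<^sub>L 'x) \<Rightarrow> bool"  (infix \<open>\<le>\<^sub>L\<close> 50)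
  where "A \<le>\<^sub>L B \<longleftrightarrow> positive_op (B - A)"

definition positive_functional :: "(('h::chilbert \<Rightarrow>\<^sub>C\<^sub>L 'h) \<Rightarrow>\<^sub>C\<^sub>L complex) \<Rightarrow> bool"
  where "positive_functional T \<longleftrightarrow> (\<forall>B. positive_op B \<longrightarrow> T B \<in> \<real>\<^sub>\<ge>\<^sub>0)"

section \<open>The projective tensor product of Banach spaces\<close>

text \<open>
  The elements of the projective tensor product are the sums \<open>\<Sum>n. a n \<otimes> b n\<close> with
  \<open>\<Sum>n. \<parallel>a n\<parallel> * \<parallel>b n\<parallel> < \<infinity>\<close>, the norm being the infimum of the latter sums over all such
  representations of the element. Two series represent the same element iff every bounded
  bilinear form \<open>\<phi>\<close> takes the same value \<open>\<Sum>n. \<phi> (a n) (b n)\<close> on both. A bounded bilinear form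
  is an element of \<open>'a \<Rightarrow>\<^sub>C\<^sub>L 'b \<Rightarrow>\<^sub>C\<^sub>L complex\<close>, and an element of the tensor product is
  encoded by its values on these forms.
\<close>

definition pt_summable :: "(nat \<Rightarrow> 'a::real_normed_vector) \<Rightarrow> (nat \<Rightarrow> 'b::real_normed_vector) \<Rightarrow> bool"
  where "pt_summable a b \<longleftrightarrow> summable (\<lambda>n. norm (a n) * norm (b n))"

typedef (overloaded) ('a, 'b) ptensor =
  "{u :: ('a::cbanach \<Rightarrow>\<^sub>C\<^sub>L 'b::cbanach \<Rightarrow>\<^sub>C\<^sub>L complex) \<Rightarrow> complex.
     \<exists>a b. pt_summable a b \<and> u = (\<lambda>\<phi>. \<Sum>n. cblinfun_apply (cblinfun_apply \<phi> (a n)) (b n))}"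
  morphisms pt_eval PTensor
  by (rule exI, rule CollectI, rule exI[where x = "\<lambda>_. 0"], rule exI[where x = "\<lambda>_. 0"])
    (simp add: pt_summable_def)

text \<open>The element \<open>\<Sum>n. a n \<otimes> b n\<close>.\<close>

definition tsum :: "(nat \<Rightarrow> 'a::cbanach) \<Rightarrow> (nat \<Rightarrow> 'b::cbanach) \<Rightarrow> ('a, 'b) ptensor"
  where "tsum a b = PTensor (\<lambda>\<phi>. \<Sum>n. cblinfun_apply (cblinfun_apply \<phi> (a n)) (b n))"

definition tensor :: "'a::cbanach \<Rightarrow> 'b::cbanach \<Rightarrow> ('a, 'b) ptensor"  (infixr \<open>\<otimes>\<^sub>\<pi>\<close> 75)
  where "tensor x y = tsum (\<lambda>n. if n = 0 then x else 0) (\<lambda>n. if n = 0 then y else 0)"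

lemma pt_eqI: "(\<And>\<phi>. pt_eval u \<phi> = pt_eval v \<phi>) \<Longrightarrow> u = v"
  by (metis pt_eval_inject ext)

lemma pt_eval_tsum: "pt_summable a b \<Longrightarrow> pt_eval (tsum a b) \<phi> = (\<Sum>n. \<phi> (a n) (b n))"
  unfolding tsum_def by (subst PTensor_inverse) auto

lemma pt_cases:
  obtains a b where "pt_summable a b" "u = tsum a b"
proof -
  obtain a b where "pt_summable a b" "pt_eval u = (\<lambda>\<phi>. \<Sum>n. cblinfun_apply (cblinfun_apply \<phi> (a n)) (b n))"
    using pt_eval[of u] by auto
  then show ?thesis using that by (metis pt_eqI pt_eval_tsum)
qed

lemma norm_cblinfun2: "norm (cblinfun_apply (cblinfun_apply \<phi> x) y) \<le> norm \<phi> * (norm x * norm y)"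
  by (rule order_trans[OF norm_cblinfun])
    (simp add: mult.assoc[symmetric] mult_right_mono norm_cblinfun)

lemma pt_summable_norm:
  assumes "pt_summable a b"
  shows "summable (\<lambda>n. norm (cblinfun_apply (cblinfun_apply \<phi> (a n)) (b n)))"
    and "(\<Sum>n. norm (cblinfun_apply (cblinfun_apply \<phi> (a n)) (b n)))
      \<le> norm \<phi> * (\<Sum>n. norm (a n) * norm (b n))"
proof -
  have s: "summable (\<lambda>n. norm \<phi> * (norm (a n) * norm (b n)))"
    using assms unfolding pt_summable_def by (rule summable_mult)
  show *: "summable (\<lambda>n. norm (cblinfun_apply (cblinfun_apply \<phi> (a n)) (b n)))"
    by (rule summable_comparison_test'[OF s, of 0]) (simp add: norm_cblinfun2)
  show "(\<Sum>n. norm (cblinfun_apply (cblinfun_apply \<phi> (a n)) (b n)))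
      \<le> norm \<phi> * (\<Sum>n. norm (a n) * norm (b n))"
    using suminf_le[OF norm_cblinfun2 * s] suminf_mult[of _ "norm \<phi>"] assms
    by (simp add: pt_summable_def)
qed

lemma pt_eval_tensor: "pt_eval (x \<otimes>\<^sub>\<pi> y) \<phi> = \<phi> x y"
proof -
  let ?a = "\<lambda>n::nat. if n = 0 then x else 0" and ?b = "\<lambda>n::nat. if n = 0 then y else 0"
  have "summable (\<lambda>n. norm (?a n) * norm (?b n))"
    by (rule summable_finite[of "{0}"]) auto
  then have "pt_eval (x \<otimes>\<^sub>\<pi> y) \<phi> = (\<Sum>n. \<phi> (?a n) (?b n))"
    unfolding tensor_def by (simp add: pt_eval_tsum pt_summable_def)
  also have "\<dots> = \<phi> x y"
    by (subst suminf_finite[of "{0}"]) auto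
  finally show ?thesis .
qed

lemma flat_sums:
  fixes f :: "nat \<Rightarrow> nat \<Rightarrow> 'c::banach"
  assumes 1: "\<And>k. summable (\<lambda>n. norm (f k n))" and 2: "summable (\<lambda>k. \<Sum>n. norm (f k n))"
  shows "summable (\<lambda>m. norm (case prod_decode m of (k, n) \<Rightarrow> f k n))"
    and "(\<lambda>m. case prod_decode m of (k, n) \<Rightarrow> f k n) sums (\<Sum>k. \<Sum>n. f k n)"
    and "summable (\<lambda>k. \<Sum>n. f k n)"
proof -
  have inf_eq: "infsum g UNIV = suminf g" if "summable (\<lambda>n. norm (g n))" for g :: "nat \<Rightarrow> 'd::banach"
    by (rule infsumI, rule norm_summable_imp_has_sum[OF that])
      (use that summable_norm_cancel in blast)
  have s1: "(\<lambda>n. norm (f k n)) summable_on UNIV" for k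
    using 1[of k] by (subst summable_on_UNIV_nonneg_real_iff) auto
  have "(\<lambda>k. infsum (\<lambda>n. norm (f k n)) UNIV) summable_on UNIV"
    using 1 2 by (subst summable_on_UNIV_nonneg_real_iff) (auto simp: inf_eq intro!: suminf_nonneg)
  then have abs: "(\<lambda>p. norm (case p of (k, n) \<Rightarrow> f k n)) summable_on UNIV \<times> UNIV"
    unfolding Infinite_Sum.abs_summable_on_Sigma_iff using s1 by (simp add: infsum_nonneg)
  have bij: "bij_betw prod_decode UNIV (UNIV \<times> UNIV)"
    by (simp add: bij_prod_decode)
  have "(\<lambda>m. norm (case prod_decode m of (k, n) \<Rightarrow> f k n)) summable_on UNIV"
    using abs summable_on_reindex_bij_betw[OF bij, of "\<lambda>p. norm (case p of (k, n) \<Rightarrow> f k n)"]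
    by simp
  then show "summable (\<lambda>m. norm (case prod_decode m of (k, n) \<Rightarrow> f k n))"
    by (rule summable_on_imp_summable)
  have so: "(\<lambda>(k, n). f k n) summable_on UNIV \<times> UNIV"
    using abs by (rule abs_summable_summable)
  have sn: "norm (\<Sum>n. f k n) \<le> (\<Sum>n. norm (f k n))" for k
    by (rule summable_norm[OF 1])
  have sk: "summable (\<lambda>k. norm (\<Sum>n. f k n))"
    by (rule summable_comparison_test'[OF 2, of 0]) (simp add: sn)
  then show "summable (\<lambda>k. \<Sum>n. f k n)"
    by (rule summable_norm_cancel)
  have "infsum (\<lambda>(k, n). f k n) (UNIV \<times> UNIV) = (\<Sum>k. \<Sum>n. f k n)"
    using infsum_Sigma_banach[OF so] by (simp add: inf_eq[OF 1] inf_eq[OF sk])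
  then have "((\<lambda>(k, n). f k n) has_sum (\<Sum>k. \<Sum>n. f k n)) (UNIV \<times> UNIV)"
    using so by (metis has_sum_infsum)
  then have "((\<lambda>m. case prod_decode m of (k, n) \<Rightarrow> f k n) has_sum (\<Sum>k. \<Sum>n. f k n)) UNIV"
    using has_sum_reindex_bij_betw[OF bij, of "\<lambda>p. case p of (k, n) \<Rightarrow> f k n"] by simp
  then show "(\<lambda>m. case prod_decode m of (k, n) \<Rightarrow> f k n) sums (\<Sum>k. \<Sum>n. f k n)"
    by (rule has_sum_imp_sums)
qed

definition flat :: "(nat \<Rightarrow> nat \<Rightarrow> 'c) \<Rightarrow> nat \<Rightarrow> 'c"
  where "flat f m = (case prod_decode m of (k, n) \<Rightarrow> f k n)"

lemma tsum_flat:
  assumes ab: "\<And>k. pt_summable (a k) (b k)"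
    and s: "summable (\<lambda>k. \<Sum>n. norm (a k n) * norm (b k n))"
  shows "pt_summable (flat a) (flat b)"
    and "(\<Sum>m. norm (flat a m) * norm (flat b m)) = (\<Sum>k. \<Sum>n. norm (a k n) * norm (b k n))"
    and "summable (\<lambda>k. pt_eval (tsum (a k) (b k)) \<phi>)"
    and "pt_eval (tsum (flat a) (flat b)) \<phi> = (\<Sum>k. pt_eval (tsum (a k) (b k)) \<phi>)"
proof -
  have eq: "norm (flat a m) * norm (flat b m)
      = (case prod_decode m of (k, n) \<Rightarrow> norm (a k n) * norm (b k n))" for m
    by (simp add: flat_def split: prod.split)
  note f1 = flat_sums[of "\<lambda>k n. norm (a k n) * norm (b k n)"]
  show p: "pt_summable (flat a) (flat b)"
    unfolding pt_summable_def eq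
    using f1(2) ab s by (auto simp: pt_summable_def intro: sums_summable)
  show "(\<Sum>m. norm (flat a m) * norm (flat b m)) = (\<Sum>k. \<Sum>n. norm (a k n) * norm (b k n))"
    unfolding eq using f1(2) ab s by (auto simp: pt_summable_def sums_iff)
  have s2: "summable (\<lambda>k. \<Sum>n. norm (\<phi> (a k n) (b k n)))"
  proof (rule summable_comparison_test'[OF summable_mult[OF s, of "norm \<phi>"], of 0])
    fix k
    show "norm (\<Sum>n. norm (\<phi> (a k n) (b k n))) \<le> norm \<phi> * (\<Sum>n. norm (a k n) * norm (b k n))"
      using pt_summable_norm[OF ab[of k], of \<phi>] by (simp add: suminf_nonneg)
  qed
  note f2 = flat_sums[of "\<lambda>k n. \<phi> (a k n) (b k n)", OF pt_summable_norm(1)[OF ab] s2]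
  show "summable (\<lambda>k. pt_eval (tsum (a k) (b k)) \<phi>)"
    using f2(3) by (simp add: pt_eval_tsum ab)
  have "(\<lambda>m. \<phi> (flat a m) (flat b m)) = (\<lambda>m. case prod_decode m of (k, n) \<Rightarrow> \<phi> (a k n) (b k n))"
    by (auto simp: flat_def split: prod.split)
  then show "pt_eval (tsum (flat a) (flat b)) \<phi> = (\<Sum>k. pt_eval (tsum (a k) (b k)) \<phi>)"
    using f2(2) by (simp add: pt_eval_tsum ab p sums_iff)
qed

lemma pt_eval_add_ex:
  assumes ab: "pt_summable a b" "pt_summable a' b'"
  shows "\<exists>c d. pt_summable c d
    \<and> (\<forall>\<phi>. pt_eval (tsum c d) \<phi> = pt_eval (tsum a b) \<phi> + pt_eval (tsum a' b') \<phi>)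
    \<and> (\<Sum>n. norm (c n) * norm (d n))
        = (\<Sum>n. norm (a n) * norm (b n)) + (\<Sum>n. norm (a' n) * norm (b' n))"
proof -
  define A where "A k = (if k = 0 then a else if k = 1 then a' else (\<lambda>_. 0))" for k :: nat
  define B where "B k = (if k = 0 then b else if k = 1 then b' else (\<lambda>_. 0))" for k :: nat
  have z: "pt_summable (\<lambda>_. 0::'a) (\<lambda>_. 0::'b)" by (simp add: pt_summable_def)
  have AB: "pt_summable (A k) (B k)" for k
    using ab z by (simp add: A_def B_def)
  have AB0: "A k = (\<lambda>_. 0)" "B k = (\<lambda>_. 0)" if "k \<notin> {0, 1}" for k
    using that by (auto simp: A_def B_def)
  have s: "summable (\<lambda>k. \<Sum>n. norm (A k n) * norm (B k n))"
    by (rule summable_finite[of "{0, 1}"]) (auto simp: AB0)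
  note t = tsum_flat[of A B, OF AB s]
  have "pt_eval (tsum (flat A) (flat B)) \<phi> = pt_eval (tsum a b) \<phi> + pt_eval (tsum a' b') \<phi>" for \<phi>
    unfolding t(4)
    by (subst suminf_finite[of "{0, 1}"]) (auto simp: AB0 pt_eval_tsum z, simp add: A_def B_def pt_eval_tsum ab)
  moreover have "(\<Sum>n. norm (flat A n) * norm (flat B n))
      = (\<Sum>n. norm (a n) * norm (b n)) + (\<Sum>n. norm (a' n) * norm (b' n))"
    unfolding t(2)
    by (subst suminf_finite[of "{0, 1}"]) (auto simp: AB0, simp add: A_def B_def)
  ultimately show ?thesis using t(1) by blast
qed

lemma pt_eval_scale_ex:
  assumes ab: "pt_summable a b"
  shows "pt_summable (\<lambda>n. c *\<^sub>C a n) b"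
    and "pt_eval (tsum (\<lambda>n. c *\<^sub>C a n) b) \<phi> = c * pt_eval (tsum a b) \<phi>"
    and "(\<Sum>n. norm (c *\<^sub>C a n) * norm (b n)) = cmod c * (\<Sum>n. norm (a n) * norm (b n))"
proof -
  have eq: "norm (c *\<^sub>C a n) * norm (b n) = cmod c * (norm (a n) * norm (b n))" for n
    by (simp add: norm_scaleC)
  show p: "pt_summable (\<lambda>n. c *\<^sub>C a n) b"
    using ab unfolding pt_summable_def eq by (rule summable_mult)
  show "(\<Sum>n. norm (c *\<^sub>C a n) * norm (b n)) = cmod c * (\<Sum>n. norm (a n) * norm (b n))"
    using ab unfolding pt_summable_def eq by (rule suminf_mult)
  show "pt_eval (tsum (\<lambda>n. c *\<^sub>C a n) b) \<phi> = c * pt_eval (tsum a b) \<phi>"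
    using summable_norm_cancel[OF pt_summable_norm(1)[OF ab, of \<phi>]]
    by (simp add: pt_eval_tsum ab p cblinfun_scaleC_right cblinfun_simps scaleC_complex_def suminf_mult)
qed

lemma PTensor_eval_eqI:
  assumes "\<And>\<phi>. pt_eval v \<phi> = g \<phi>"
  shows "pt_eval (PTensor g) = g"
proof -
  have "PTensor g = v" using assms by (metis pt_eval_inverse ext)
  then show ?thesis using assms by auto
qed

instantiation ptensor :: (cbanach, cbanach) complex_normed_vector
begin

definition "norm_ptensor (u :: ('a, 'b) ptensor) =
  Inf {\<Sum>n. norm (a n) * norm (b n) | a b. pt_summable a b \<and> u = tsum a b}"

definition "(0 :: ('a, 'b) ptensor) = PTensor (\<lambda>\<phi>. 0)"
definition "(u :: ('a, 'b) ptensor) + v = PTensor (\<lambda>\<phi>. pt_eval u \<phi> + pt_eval v \<phi>)"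
definition "(u :: ('a, 'b) ptensor) - v = PTensor (\<lambda>\<phi>. pt_eval u \<phi> - pt_eval v \<phi>)"
definition "- (u :: ('a, 'b) ptensor) = PTensor (\<lambda>\<phi>. - pt_eval u \<phi>)"
definition "r *\<^sub>R (u :: ('a, 'b) ptensor) = PTensor (\<lambda>\<phi>. complex_of_real r * pt_eval u \<phi>)"
definition "c *\<^sub>C (u :: ('a, 'b) ptensor) = PTensor (\<lambda>\<phi>. c * pt_eval u \<phi>)"

definition "sgn_ptensor (u :: ('a, 'b) ptensor) = inverse (norm u) *\<^sub>R u"
definition "dist_ptensor (u :: ('a, 'b) ptensor) v = norm (u - v)"
definition [code del]: "(uniformity :: (('a, 'b) ptensor \<times> ('a, 'b) ptensor) filter)
  = (INF e\<in>{0 <..}. principal {(x, y). dist x y < e})"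
definition [code del]: "open_ptensor (S :: ('a, 'b) ptensor set)
  \<longleftrightarrow> (\<forall>x\<in>S. \<forall>\<^sub>F (x', y) in uniformity. x' = x \<longrightarrow> y \<in> S)"

lemma pt_eval_zero: "pt_eval (0 :: ('a, 'b) ptensor) \<phi> = 0"
proof -
  have z: "pt_summable (\<lambda>_. 0::'a) (\<lambda>_. 0::'b)" by (simp add: pt_summable_def)
  show ?thesis
    unfolding zero_ptensor_def
    by (subst PTensor_eval_eqI[of "tsum (\<lambda>_. 0::'a) (\<lambda>_. 0::'b)"]) (simp_all add: pt_eval_tsum z)
qed

lemma pt_eval_plus: "pt_eval (u + v :: ('a, 'b) ptensor) \<phi> = pt_eval u \<phi> + pt_eval v \<phi>"
proof -
  obtain a b a' b' where u: "pt_summable a b" "u = tsum a b" and v: "pt_summable a' b'" "v = tsum a' b'"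
    by (metis pt_cases)
  obtain w where "\<forall>\<phi>. pt_eval w \<phi> = pt_eval u \<phi> + pt_eval v \<phi>"
    using pt_eval_add_ex[OF u(1) v(1)] u v by auto
  then show ?thesis unfolding plus_ptensor_def by (subst PTensor_eval_eqI[of w]) auto
qed

lemma pt_eval_scaleC: "pt_eval (c *\<^sub>C u :: ('a, 'b) ptensor) \<phi> = c * pt_eval u \<phi>"
proof -
  obtain a b where u: "pt_summable a b" "u = tsum a b" by (metis pt_cases)
  show ?thesis unfolding scaleC_ptensor_def
    by (subst PTensor_eval_eqI[of "tsum (\<lambda>n. c *\<^sub>C a n) b"])
      (simp_all add: pt_eval_scale_ex(2)[OF u(1)] u(2))
qed

lemma uminus_ptensor: "- u = (- 1) *\<^sub>C (u :: ('a, 'b) ptensor)"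
  by (simp add: uminus_ptensor_def scaleC_ptensor_def)

lemma minus_ptensor: "u - v = u + - (v :: ('a, 'b) ptensor)"
proof -
  have "pt_eval (- v) \<phi> = - pt_eval v \<phi>" for \<phi>
    unfolding uminus_ptensor by (simp add: pt_eval_scaleC)
  then show ?thesis
    by (simp add: minus_ptensor_def plus_ptensor_def)
qed

lemma norm_tsum_le:
  assumes "pt_summable a b"
  shows "norm (tsum a b :: ('a, 'b) ptensor) \<le> (\<Sum>n. norm (a n) * norm (b n))"
  unfolding norm_ptensor_def
  by (rule cInf_lower) (use assms in \<open>auto intro!: bdd_belowI[of _ 0] suminf_nonneg simp: pt_summable_def\<close>)

lemma norm_ptensor_less:
  assumes "norm (u :: ('a, 'b) ptensor) < c"
  obtains a b where "pt_summable a b" "u = tsum a b" "(\<Sum>n. norm (a n) * norm (b n)) < c"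
proof -
  have "{\<Sum>n. norm (a n) * norm (b n) | a b. pt_summable a b \<and> u = tsum a b} \<noteq> {}"
    by (rule pt_cases[of u]) auto
  from cInf_lessD[OF this assms[unfolded norm_ptensor_def]] show ?thesis
    by (auto intro: that)
qed

lemma norm_ptensor_nonneg: "0 \<le> norm (u :: ('a, 'b) ptensor)"
proof -
  have "{\<Sum>n. norm (a n) * norm (b n) | a b. pt_summable a b \<and> u = tsum a b} \<noteq> {}"
    by (rule pt_cases[of u]) auto
  then show ?thesis unfolding norm_ptensor_def
    by (rule cInf_greatest) (auto intro!: suminf_nonneg simp: pt_summable_def)
qed

lemma norm_pt_eval: "cmod (pt_eval u \<phi>) \<le> norm \<phi> * norm (u :: ('a, 'b) ptensor)"
proof (rule field_le_epsilon)
  fix e :: real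
  assume e: "0 < e"
  define d where "d = e / (norm \<phi> + 1)"
  have p: "0 < norm \<phi> + 1" by (simp add: add_nonneg_pos)
  then have d: "0 < d" "norm \<phi> * d \<le> e"
    using e by (auto simp: d_def field_simps)
  obtain a b where ab: "pt_summable a b" "u = tsum a b"
    "(\<Sum>n. norm (a n) * norm (b n)) < norm u + d"
    using norm_ptensor_less[of u "norm u + d"] d by auto
  have "cmod (pt_eval u \<phi>) \<le> (\<Sum>n. cmod (\<phi> (a n) (b n)))"
    unfolding ab(2) pt_eval_tsum[OF ab(1)] by (rule summable_norm[OF pt_summable_norm(1)[OF ab(1)]])
  also have "\<dots> \<le> norm \<phi> * (\<Sum>n. norm (a n) * norm (b n))"
    by (rule pt_summable_norm(2)[OF ab(1)])
  also have "\<dots> \<le> norm \<phi> * (norm u + d)"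
    using ab(3) by (intro mult_left_mono) auto
  also have "\<dots> \<le> norm \<phi> * norm u + e"
    using d by (simp add: algebra_simps)
  finally show "cmod (pt_eval u \<phi>) \<le> norm \<phi> * norm u + e" .
qed

instance
proof
  fix u v w :: "('a, 'b) ptensor" and c d :: complex and r s :: real
  have sR: "r *\<^sub>R u = complex_of_real r *\<^sub>C u" for r and u :: "('a, 'b) ptensor"
    by (simp add: scaleR_ptensor_def scaleC_ptensor_def)
  have um: "pt_eval (- u) \<phi> = - pt_eval u \<phi>" for \<phi> and u :: "('a, 'b) ptensor"
    unfolding uminus_ptensor by (simp add: pt_eval_scaleC)
  note ev = pt_eval_zero pt_eval_plus pt_eval_scaleC um sR
  show "u - v = u + - v" by (rule minus_ptensor)
  show "u + v + w = u + (v + w)" "u + v = v + u" "0 + u = u" "- u + u = 0"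
    "r *\<^sub>R (u + v) = r *\<^sub>R u + r *\<^sub>R v" "(r + s) *\<^sub>R u = r *\<^sub>R u + s *\<^sub>R u"
    "r *\<^sub>R s *\<^sub>R u = (r * s) *\<^sub>R u" "1 *\<^sub>R u = u"
    "c *\<^sub>C (u + v) = c *\<^sub>C u + c *\<^sub>C v" "(c + d) *\<^sub>C u = c *\<^sub>C u + d *\<^sub>C u"
    "c *\<^sub>C d *\<^sub>C u = (c * d) *\<^sub>C u" "r *\<^sub>R u = complex_of_real r *\<^sub>C u"
    by (rule pt_eqI, simp add: ev ring_distribs ac_simps)+
  show "norm (u + v) \<le> norm u + norm v"
  proof (rule field_le_epsilon)
    fix e :: real
    assume "0 < e"
    then have lt: "norm u < norm u + e / 2" "norm v < norm v + e / 2" by auto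
    obtain a b where u: "pt_summable a b" "u = tsum a b"
        "(\<Sum>n. norm (a n) * norm (b n)) < norm u + e / 2"
      using lt(1) by (rule norm_ptensor_less)
    obtain a' b' where v: "pt_summable a' b'" "v = tsum a' b'"
        "(\<Sum>n. norm (a' n) * norm (b' n)) < norm v + e / 2"
      using lt(2) by (rule norm_ptensor_less)
    obtain x y where xy: "pt_summable x y"
      "\<And>\<phi>. pt_eval (tsum x y) \<phi> = pt_eval u \<phi> + pt_eval v \<phi>"
      "(\<Sum>n. norm (x n) * norm (y n))
        = (\<Sum>n. norm (a n) * norm (b n)) + (\<Sum>n. norm (a' n) * norm (b' n))"
      using pt_eval_add_ex[OF u(1) v(1)] u(2) v(2) by auto
    have "u + v = tsum x y" by (rule pt_eqI) (simp add: xy(2) pt_eval_plus)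
    then show "norm (u + v) \<le> norm u + norm v + e"
      using norm_tsum_le[OF xy(1)] xy(3) u(3) v(3) by simp
  qed
  have le: "norm (c *\<^sub>C u) \<le> cmod c * norm u" if "c \<noteq> 0" for c and u :: "('a, 'b) ptensor"
  proof (rule field_le_epsilon)
    fix e :: real
    assume "0 < e"
    then have "norm u < norm u + e / cmod c" using that by simp
    then obtain a b where u: "pt_summable a b" "u = tsum a b"
        "(\<Sum>n. norm (a n) * norm (b n)) < norm u + e / cmod c"
      by (rule norm_ptensor_less)
    note sc = pt_eval_scale_ex[OF u(1), of c]
    have "c *\<^sub>C u = tsum (\<lambda>n. c *\<^sub>C a n) b"
      by (rule pt_eqI) (simp add: pt_eval_scaleC sc(2) u(2))
    then have "norm (c *\<^sub>C u) \<le> cmod c * (\<Sum>n. norm (a n) * norm (b n))"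
      using norm_tsum_le[OF sc(1)] sc(3) by simp
    also have "\<dots> \<le> cmod c * (norm u + e / cmod c)"
      using u(3) by (intro mult_left_mono) auto
    also have "\<dots> = cmod c * norm u + e" using that by (simp add: field_simps)
    finally show "norm (c *\<^sub>C u) \<le> cmod c * norm u + e" .
  qed
  have n0: "norm (0 :: ('a, 'b) ptensor) = 0"
  proof -
    have z: "pt_summable (\<lambda>_. 0::'a) (\<lambda>_. 0::'b)" by (simp add: pt_summable_def)
    have "(0 :: ('a, 'b) ptensor) = tsum (\<lambda>_. 0) (\<lambda>_. 0)"
      by (rule pt_eqI) (simp add: pt_eval_zero pt_eval_tsum z)
    then show ?thesis using norm_tsum_le[OF z] norm_ptensor_nonneg[of 0] by simp
  qed
  show sc: "norm (c *\<^sub>C u) = cmod c * norm u" for c and u :: "('a, 'b) ptensor"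
  proof (cases "c = 0")
    case True
    then have "c *\<^sub>C u = 0" by (intro pt_eqI) (simp add: ev)
    then show ?thesis using True n0 by simp
  next
    case False
    have "inverse c *\<^sub>C c *\<^sub>C u = u" using False by (intro pt_eqI) (simp add: ev)
    then have "norm u \<le> inverse (cmod c) * norm (c *\<^sub>C u)"
      using le[of "inverse c" "c *\<^sub>C u"] False by (simp add: norm_inverse)
    then have "cmod c * norm u \<le> norm (c *\<^sub>C u)" using False by (simp add: field_simps)
    then show ?thesis using le[OF False, of u] by simp
  qed
  show "norm (r *\<^sub>R u) = \<bar>r\<bar> * norm u" by (simp add: sR sc)
  show "norm u = 0 \<longleftrightarrow> u = 0"
  proof
    assume "norm u = 0"
    then have "pt_eval u \<phi> = 0" for \<phi> using norm_pt_eval[of u \<phi>] by simp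
    then show "u = 0" by (intro pt_eqI) (simp add: pt_eval_zero)
  qed (simp add: n0)
qed (simp_all add: sgn_ptensor_def dist_ptensor_def uniformity_ptensor_def open_ptensor_def)

end

lemma pt_eval_minus: "pt_eval (u - v) \<phi> = pt_eval u \<phi> - pt_eval v \<phi>"
  using pt_eval_plus[of "u - v" v \<phi>] by simp

instance ptensor :: (cbanach, cbanach) cbanach
proof
  fix X :: "nat \<Rightarrow> ('a, 'b) ptensor"
  assume X: "Cauchy X"
  have ex: "\<exists>N>M. \<forall>m\<ge>N. norm (X m - X N) < (1/2)^k" for M k :: nat
  proof -
    obtain N where "\<forall>m\<ge>N. \<forall>n\<ge>N. norm (X m - X n) < (1/2)^k"
      using X[unfolded Cauchy_iff] by (metis half_gt_zero_iff zero_less_one zero_less_power)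
    then show ?thesis by (intro exI[of _ "max N (Suc M)"]) auto
  qed
  have "\<exists>r. \<forall>k. (\<forall>m\<ge>r k. norm (X m - X (r k)) < (1/2)^k) \<and> r k < r (Suc k)"
    by (rule dependent_nat_choice) (use ex in blast)+
  then obtain r where r: "\<And>k m. m \<ge> r k \<Longrightarrow> norm (X m - X (r k)) < (1/2)^k" "\<And>k. r k < r (Suc k)"
    by blast
  have sm: "strict_mono r" using r(2) by (simp add: strict_mono_Suc_iff)
  define d where "d k = X (r (Suc k)) - X (r k)" for k
  have "norm (d k) < (1/2)^k" for k
    unfolding d_def by (rule r(1)) (simp add: r(2) less_imp_le)
  then have "\<exists>a b. pt_summable a b \<and> d k = tsum a b \<and> (\<Sum>n. norm (a n) * norm (b n)) < (1/2)^k" for k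
    using norm_ptensor_less by metis
  then obtain a b where ab: "\<And>k. pt_summable (a k) (b k)" "\<And>k. d k = tsum (a k) (b k)"
    "\<And>k. (\<Sum>n. norm (a k n) * norm (b k n)) < (1/2)^k"
    by metis
  define U where "U j = tsum (flat (\<lambda>k. a (k + j))) (flat (\<lambda>k. b (k + j)))" for j
  have geo: "(\<lambda>k. (1/2)^(k + j)) sums (2 * (1/2)^j :: real)" for j
    using sums_mult2[OF geometric_sums[of "1/2::real"], of "(1/2)^j"] by (simp add: power_add)
  have sj: "summable (\<lambda>k. \<Sum>n. norm (a (k + j) n) * norm (b (k + j) n))" for j
    by (rule summable_comparison_test'[OF sums_summable[OF geo[of j]], of 0])
      (use ab in \<open>auto simp: pt_summable_def suminf_nonneg intro: less_imp_le\<close>)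
  note t = tsum_flat[of "\<lambda>k. a (k + _)" "\<lambda>k. b (k + _)", OF ab(1) sj]
  have nU: "norm (U j) \<le> 2 * (1/2)^j" for j
  proof -
    have "norm (U j) \<le> (\<Sum>k. \<Sum>n. norm (a (k + j) n) * norm (b (k + j) n))"
      unfolding U_def using norm_tsum_le[OF t(1)] t(2) by metis
    also have "\<dots> \<le> (\<Sum>k. (1/2)^(k + j))"
      by (rule suminf_le[OF _ sj sums_summable[OF geo]]) (use ab(3) in \<open>auto intro: less_imp_le\<close>)
    also have "\<dots> = 2 * (1/2)^j" using geo by (simp add: sums_iff)
    finally show ?thesis .
  qed
  have "X (r j) + U j = X (r 0) + U 0" for j
  proof (rule pt_eqI)
    fix \<phi>
    have su: "summable (\<lambda>k. pt_eval (d k) \<phi>)"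
      using t(3)[of 0 \<phi>] by (simp add: ab(2))
    have "pt_eval (U 0) \<phi> = (\<Sum>k. pt_eval (d k) \<phi>)"
      using t(4)[of 0 \<phi>] by (simp add: U_def ab(2))
    also have "\<dots> = (\<Sum>k. pt_eval (d (k + j)) \<phi>) + (\<Sum>k<j. pt_eval (d k) \<phi>)"
      by (rule suminf_split_initial_segment[OF su])
    also have "(\<Sum>k. pt_eval (d (k + j)) \<phi>) = pt_eval (U j) \<phi>"
      using t(4)[of j \<phi>] by (simp add: U_def ab(2))
    also have "(\<Sum>k<j. pt_eval (d k) \<phi>) = pt_eval (X (r j)) \<phi> - pt_eval (X (r 0)) \<phi>"
      unfolding d_def pt_eval_minus by (rule sum_lessThan_telescope)
    finally show "pt_eval (X (r j) + U j) \<phi> = pt_eval (X (r 0) + U 0) \<phi>"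
      by (simp add: pt_eval_plus)
  qed
  then have "(X \<circ> r) = (\<lambda>j. (X (r 0) + U 0) - U j)"
    by (auto simp: fun_eq_iff algebra_simps)
  moreover have "U \<longlonglongrightarrow> 0"
  proof (rule Lim_null_comparison)
    show "\<forall>\<^sub>F j in sequentially. norm (U j) \<le> 2 * (1/2)^j" using nU by simp
    show "(\<lambda>j. 2 * (1/2)^j :: real) \<longlonglongrightarrow> 0"
      using tendsto_mult_right_zero[OF LIMSEQ_power_zero[of "1/2::real"], of 2] by simp
  qed
  ultimately have "(X \<circ> r) \<longlonglongrightarrow> X (r 0) + U 0"
    using tendsto_diff[OF tendsto_const[of "X (r 0) + U 0"], of U 0 sequentially] by simp
  then have "X \<longlonglongrightarrow> X (r 0) + U 0"
    by (rule Cauchy_converges_subseq[OF X sm])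
  then show "convergent X" by (auto simp: convergent_def)
qed


section \<open>Maps between tensor products\<close>

text \<open>
  \<open>f \<otimes> g\<close> for bounded maps \<open>f\<close> and \<open>g\<close> that are both complex linear or both conjugate
  linear; in either case the right-hand side does not depend on the representation of \<open>u\<close>.
\<close>

definition tensor_map ::
  "('a::cbanach \<Rightarrow> 'c::cbanach) \<Rightarrow> ('b::cbanach \<Rightarrow> 'd::cbanach) \<Rightarrow> ('a, 'b) ptensor \<Rightarrow> ('c, 'd) ptensor"
  where "tensor_map f g u =
    (THE v. \<forall>a b. pt_summable a b \<and> u = tsum a b \<longrightarrow> v = tsum (\<lambda>n. f (a n)) (\<lambda>n. g (b n)))"

text \<open>\<open>(I \<otimes> W\<^sup>*) X (I \<otimes> V)\<close>, i.e. \<open>a \<otimes> B \<mapsto> a \<otimes> W\<^sup>* B V\<close>.\<close>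

definition sandwich ::
  "('p::chilbert \<Rightarrow>\<^sub>C\<^sub>L 'r::chilbert) \<Rightarrow> ('p \<Rightarrow>\<^sub>C\<^sub>L 'r) \<Rightarrow> ('a::cbanach, 'r \<Rightarrow>\<^sub>C\<^sub>L 'r) ptensor
    \<Rightarrow> ('a, 'p \<Rightarrow>\<^sub>C\<^sub>L 'p) ptensor"
  where "sandwich W V = tensor_map (\<lambda>a. a) (\<lambda>B. W\<^sup>\<dagger> o\<^sub>C B o\<^sub>C V)"

definition tensor_dsum ::
  "('a::cbanach, 'e::chilbert \<Rightarrow>\<^sub>C\<^sub>L 'e) ptensor \<Rightarrow> ('a, 'k::chilbert \<Rightarrow>\<^sub>C\<^sub>L 'k) ptensor
    \<Rightarrow> ('a, ('e \<times> 'k) \<Rightarrow>\<^sub>C\<^sub>L ('e \<times> 'k)) ptensor"  (infixr \<open>\<oplus>\<^sub>t\<close> 65)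
  where "X \<oplus>\<^sub>t Y = tensor_map (\<lambda>a. a) (\<lambda>B. B \<oplus>\<^sub>o\<^sub>p 0) X + tensor_map (\<lambda>a. a) (\<lambda>C. 0 \<oplus>\<^sub>o\<^sub>p C) Y"

text \<open>A Banach space involution is only required to be bounded, not isometric.\<close>

definition banach_involution :: "('a::cbanach \<Rightarrow> 'a) \<Rightarrow> bool"
  where "banach_involution star \<longleftrightarrow>
    (\<forall>a b. star (a + b) = star a + star b) \<and> (\<forall>c a. star (c *\<^sub>C a) = cnj c *\<^sub>C star a) \<and>
    (\<forall>a. star (star a) = a) \<and> (\<exists>K. \<forall>a. norm (star a) \<le> K * norm a)"

definition tensor_star ::
  "('a::cbanach \<Rightarrow> 'a) \<Rightarrow> ('a, 'e::chilbert \<Rightarrow>\<^sub>C\<^sub>L 'e) ptensor \<Rightarrow> ('a, 'e \<Rightarrow>\<^sub>C\<^sub>L 'e) ptensor"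
  where "tensor_star star = tensor_map star adj"

definition re_part ::
  "('a::cbanach \<Rightarrow> 'a) \<Rightarrow> ('a, 'e::chilbert \<Rightarrow>\<^sub>C\<^sub>L 'e) ptensor \<Rightarrow> ('a, 'e \<Rightarrow>\<^sub>C\<^sub>L 'e) ptensor"
  where "re_part star Y = (1 / 2) *\<^sub>R (Y + tensor_star star Y)"


section \<open>The functional of a linear map into the dual\<close>

text \<open>
  The functional \<open>\<lambda>\<close> on the tensor product with \<open>\<lambda> (a \<otimes> B) = \<Lambda> a B\<close>: by the encoding of
  tensors it is the evaluation at the bilinear form \<open>\<Lambda>\<close>.
\<close>

definition functional_of ::
  "('a::cbanach \<Rightarrow>\<^sub>C\<^sub>L 'b::cbanach \<Rightarrow>\<^sub>C\<^sub>L complex) \<Rightarrow> ('a, 'b) ptensor \<Rightarrow> complex"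
  where "functional_of \<Lambda> X = pt_eval X \<Lambda>"

lemma functional_of_tensor: "functional_of \<Lambda> (a \<otimes>\<^sub>\<pi> B) = \<Lambda> a B"
  unfolding functional_of_def by (rule pt_eval_tensor)

lemma bounded_clinear_functional_of: "bounded_clinear (functional_of \<Lambda>)"
proof -
  have "bounded_linear (functional_of \<Lambda>)"
    by (rule bounded_linear_intro[where K = "norm \<Lambda>"])
      (simp_all add: functional_of_def pt_eval_plus scaleR_scaleC pt_eval_scaleC scaleC_complex_def
        norm_pt_eval mult.commute[of "norm _" "norm \<Lambda>"])
  then show ?thesis
    by (simp add: bounded_clinear_def functional_of_def pt_eval_scaleC scaleC_complex_def)
qed

definition selfadjoint_functional ::
  "('a::cbanach \<Rightarrow> 'a) \<Rightarrow> ('a \<Rightarrow>\<^sub>C\<^sub>L ('h::chilbert \<Rightarrow>\<^sub>C\<^sub>L 'h) \<Rightarrow>\<^sub>C\<^sub>L complex) \<Rightarrow> bool"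
  where "selfadjoint_functional star \<Lambda> \<longleftrightarrow>
    (\<forall>X. functional_of \<Lambda> (tensor_star star X) = cnj (functional_of \<Lambda> X))"

text \<open>
  Complete boundedness and complete absolute continuity of \<open>\<Lambda>\<close> with respect to \<open>T\<close>, at the
  Hilbert space given by the type argument (formulas cannot quantify over types).
\<close>

definition cb_abs_cont ::
  "(('h::chilbert \<Rightarrow>\<^sub>C\<^sub>L 'h) \<Rightarrow>\<^sub>C\<^sub>L complex) \<Rightarrow> ('a::cbanach \<Rightarrow>\<^sub>C\<^sub>L ('h \<Rightarrow>\<^sub>C\<^sub>L 'h) \<Rightarrow>\<^sub>C\<^sub>L complex)
    \<Rightarrow> 'e::chilbert itself \<Rightarrow> bool"
  where "cb_abs_cont T \<Lambda> _ \<longleftrightarrow>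
    (\<exists>c. \<forall>(X :: ('a, 'e \<Rightarrow>\<^sub>C\<^sub>L 'e) ptensor) (V :: 'h \<Rightarrow>\<^sub>C\<^sub>L 'e) (W :: 'h \<Rightarrow>\<^sub>C\<^sub>L 'e).
      cmod (functional_of \<Lambda> (sandwich W V X))
        \<le> c * norm X * sqrt (Re (T (W\<^sup>\<dagger> o\<^sub>C W))) * sqrt (Re (T (V\<^sup>\<dagger> o\<^sub>C V))))"


section \<open>Operators on closed subspaces\<close>

definition orth :: "'x::chilbert set \<Rightarrow> 'x set"
  where "orth S = {x. \<forall>y\<in>S. cinner y x = 0}"

text \<open>
  A bounded operator on a closed subspace \<open>S\<close> is encoded by its extension by \<open>0\<close> on
  \<open>S\<^sup>\<bottom>\<close>. In particular the operator \<open>A \<oplus> 0\<close> is encoded by the same operator as \<open>A\<close>, and the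
  identity of \<open>S\<close> is encoded by the orthogonal projection onto \<open>S\<close>.
\<close>

definition ops_on :: "'x::chilbert set \<Rightarrow> ('x \<Rightarrow>\<^sub>C\<^sub>L 'x) set"
  where "ops_on S = {Z. (\<forall>x. cblinfun_apply Z x \<in> S) \<and> (\<forall>x\<in>orth S. cblinfun_apply Z x = 0)}"

definition proj_on :: "'x::chilbert set \<Rightarrow> ('x \<Rightarrow>\<^sub>C\<^sub>L 'x)"
  where "proj_on S = (THE P. P \<in> ops_on S \<and> (\<forall>x\<in>S. cblinfun_apply P x = x))"

definition is_inverse_on :: "'x::chilbert set \<Rightarrow> ('x \<Rightarrow>\<^sub>C\<^sub>L 'x) \<Rightarrow> ('x \<Rightarrow>\<^sub>C\<^sub>L 'x) \<Rightarrow> bool"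
  where "is_inverse_on S Z R \<longleftrightarrow> R \<in> ops_on S \<and> Z o\<^sub>C R = proj_on S \<and> R o\<^sub>C Z = proj_on S"

definition invertible_on :: "'x::chilbert set \<Rightarrow> ('x \<Rightarrow>\<^sub>C\<^sub>L 'x) \<Rightarrow> bool"
  where "invertible_on S Z \<longleftrightarrow> (\<exists>R. is_inverse_on S Z R)"

definition inverse_on :: "'x::chilbert set \<Rightarrow> ('x \<Rightarrow>\<^sub>C\<^sub>L 'x) \<Rightarrow> ('x \<Rightarrow>\<^sub>C\<^sub>L 'x)"
  where "inverse_on S Z = (THE R. is_inverse_on S Z R)"

text \<open>
  \<open>A\<close> is the Schur complement with respect to \<open>S\<close> of the operator \<open>Z\<close> on \<open>M\<close>, where
  \<open>S \<subseteq> M\<close> are closed subspaces. The two clauses are the two definitions of the Schur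
  complement; when both apply, uniqueness of \<open>A\<close> expresses that they agree.
\<close>

definition is_schur ::
  "'x::chilbert set \<Rightarrow> 'x set \<Rightarrow> ('x \<Rightarrow>\<^sub>C\<^sub>L 'x) \<Rightarrow> ('x \<Rightarrow>\<^sub>C\<^sub>L 'x) \<Rightarrow> bool"
  where "is_schur M S Z A \<longleftrightarrow>
    (let P1 = proj_on S; S' = M \<inter> orth S; P2 = proj_on S';
         Z11 = P1 o\<^sub>C Z o\<^sub>C P1; Z12 = P1 o\<^sub>C Z o\<^sub>C P2;
         Z21 = P2 o\<^sub>C Z o\<^sub>C P1; Z22 = P2 o\<^sub>C Z o\<^sub>C P2
     in invertible_on S' Z22 \<and> A = Z11 - Z12 o\<^sub>C inverse_on S' Z22 o\<^sub>C Z21 \<or>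
        positive_op Z \<and> A \<in> ops_on S \<and> A\<^sup>\<dagger> = A \<and> A \<le>\<^sub>L Z \<and>
        (\<forall>B. B \<in> ops_on S \<and> B\<^sup>\<dagger> = B \<and> B \<le>\<^sub>L Z \<longrightarrow> B \<le>\<^sub>L A))"


section \<open>The operators L(X) and the function F\<close>

text \<open>
  A type cannot depend on \<open>T\<close>, so the completion of \<open>\<B>(H, E) / {V. T (V\<^sup>* V) = 0}\<close> for the inner
  product \<open>T (W\<^sup>* V)\<close> is realised as a closed subspace of a Hilbert space type: \<open>q\<close> is the
  map taking \<open>V\<close> to its class, and the completion is the closure of the range of \<open>q\<close>.
  All that follows is stated for an arbitrary such realisation.
\<close>

definition realises_completion ::
  "(('h::chilbert \<Rightarrow>\<^sub>C\<^sub>L 'h) \<Rightarrow>\<^sub>C\<^sub>L complex) \<Rightarrow> (('h \<Rightarrow>\<^sub>C\<^sub>L 'e::chilbert) \<Rightarrow> 'x::chilbert) \<Rightarrow> bool"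
  where "realises_completion T q \<longleftrightarrow>
    (\<forall>V W. q (V + W) = q V + q W) \<and> (\<forall>c V. q (c *\<^sub>C V) = c *\<^sub>C q V) \<and>
    (\<forall>V W. cinner (q W) (q V) = T (W\<^sup>\<dagger> o\<^sub>C V))"

definition T_completion :: "(('h::chilbert \<Rightarrow>\<^sub>C\<^sub>L 'e::chilbert) \<Rightarrow> 'x::chilbert) \<Rightarrow> 'x set"
  where "T_completion q = closure (range q)"

text \<open>The subspace \<open>e\<^sup>* \<otimes> E\<close>.\<close>

definition rank1_space ::
  "(('h::chilbert \<Rightarrow>\<^sub>C\<^sub>L 'e::chilbert) \<Rightarrow> 'x::chilbert) \<Rightarrow> 'h \<Rightarrow> 'x set"
  where "rank1_space q e = range (\<lambda>w. q (rank1 w e))"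

definition L_op ::
  "(('h::chilbert \<Rightarrow>\<^sub>C\<^sub>L 'h) \<Rightarrow>\<^sub>C\<^sub>L complex) \<Rightarrow> ('a::cbanach \<Rightarrow>\<^sub>C\<^sub>L ('h \<Rightarrow>\<^sub>C\<^sub>L 'h) \<Rightarrow>\<^sub>C\<^sub>L complex)
    \<Rightarrow> (('h \<Rightarrow>\<^sub>C\<^sub>L 'e::chilbert) \<Rightarrow> 'x::chilbert) \<Rightarrow> ('a, 'e \<Rightarrow>\<^sub>C\<^sub>L 'e) ptensor \<Rightarrow> ('x \<Rightarrow>\<^sub>C\<^sub>L 'x)"
  where "L_op T \<Lambda> q X = (THE Z. Z \<in> ops_on (T_completion q) \<and>
    (\<forall>V W. cinner (q W) (cblinfun_apply Z (q V))
      = T (W\<^sup>\<dagger> o\<^sub>C V) + functional_of \<Lambda> (sandwich W V X)))"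

definition L_pos_domain ::
  "('a::cbanach \<Rightarrow> 'a) \<Rightarrow> (('h::chilbert \<Rightarrow>\<^sub>C\<^sub>L 'h) \<Rightarrow>\<^sub>C\<^sub>L complex)
    \<Rightarrow> ('a \<Rightarrow>\<^sub>C\<^sub>L ('h \<Rightarrow>\<^sub>C\<^sub>L 'h) \<Rightarrow>\<^sub>C\<^sub>L complex) \<Rightarrow> (('h \<Rightarrow>\<^sub>C\<^sub>L 'e::chilbert) \<Rightarrow> 'x::chilbert)
    \<Rightarrow> ('a, 'e \<Rightarrow>\<^sub>C\<^sub>L 'e) ptensor set"
  where "L_pos_domain star T \<Lambda> q = {Y. positive_op (L_op T \<Lambda> q (re_part star Y)) \<and>
    invertible_on (T_completion q) (L_op T \<Lambda> q (re_part star Y))}"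

definition D_set ::
  "('a::cbanach \<Rightarrow> 'a) \<Rightarrow> (('h::chilbert \<Rightarrow>\<^sub>C\<^sub>L 'h) \<Rightarrow>\<^sub>C\<^sub>L complex)
    \<Rightarrow> ('a \<Rightarrow>\<^sub>C\<^sub>L ('h \<Rightarrow>\<^sub>C\<^sub>L 'h) \<Rightarrow>\<^sub>C\<^sub>L complex) \<Rightarrow> (('h \<Rightarrow>\<^sub>C\<^sub>L 'e::chilbert) \<Rightarrow> 'x::chilbert)
    \<Rightarrow> ('a, 'e \<Rightarrow>\<^sub>C\<^sub>L 'e) ptensor set"
  where "D_set star T \<Lambda> q = {Y. tensor_star star Y = Y \<and> positive_op (L_op T \<Lambda> q Y)}"

definition is_F ::
  "(('h::chilbert \<Rightarrow>\<^sub>C\<^sub>L 'h) \<Rightarrow>\<^sub>C\<^sub>L complex) \<Rightarrow> ('a::cbanach \<Rightarrow>\<^sub>C\<^sub>L ('h \<Rightarrow>\<^sub>C\<^sub>L 'h) \<Rightarrow>\<^sub>C\<^sub>L complex)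
    \<Rightarrow> (('h \<Rightarrow>\<^sub>C\<^sub>L 'e::chilbert) \<Rightarrow> 'x::chilbert) \<Rightarrow> 'h \<Rightarrow> ('a, 'e \<Rightarrow>\<^sub>C\<^sub>L 'e) ptensor
    \<Rightarrow> ('e \<Rightarrow>\<^sub>C\<^sub>L 'e) \<Rightarrow> bool"
  where "is_F T \<Lambda> q e X G \<longleftrightarrow>
    (\<exists>A. is_schur (T_completion q) (rank1_space q e) (L_op T \<Lambda> q X) A \<and>
      (\<forall>v w. cinner w (cblinfun_apply G v)
        = cinner (q (rank1 w e)) (cblinfun_apply A (q (rank1 v e)))))"

definition F_fun ::
  "(('h::chilbert \<Rightarrow>\<^sub>C\<^sub>L 'h) \<Rightarrow>\<^sub>C\<^sub>L complex) \<Rightarrow> ('a::cbanach \<Rightarrow>\<^sub>C\<^sub>L ('h \<Rightarrow>\<^sub>C\<^sub>L 'h) \<Rightarrow>\<^sub>C\<^sub>L complex)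
    \<Rightarrow> (('h \<Rightarrow>\<^sub>C\<^sub>L 'e::chilbert) \<Rightarrow> 'x::chilbert) \<Rightarrow> 'h \<Rightarrow> ('a, 'e \<Rightarrow>\<^sub>C\<^sub>L 'e) ptensor \<Rightarrow> ('e \<Rightarrow>\<^sub>C\<^sub>L 'e)"
  where "F_fun T \<Lambda> q e X = (THE G. is_F T \<Lambda> q e X G)"


section \<open>Analytic maps between complex Banach spaces\<close>

text \<open>
  Continuous \<open>n\<close>-homogeneous polynomials: restrictions to the diagonal of bounded complex
  \<open>n\<close>-linear maps \<open>m\<close>, whose arguments are the first \<open>n\<close> terms of a sequence.
\<close>

definition homogeneous_poly ::
  "nat \<Rightarrow> ('a::complex_normed_vector \<Rightarrow> 'b::complex_normed_vector) \<Rightarrow> bool"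
  where "homogeneous_poly n p \<longleftrightarrow> (\<exists>m :: (nat \<Rightarrow> 'a) \<Rightarrow> 'b.
    (\<forall>h h'. (\<forall>i<n. h i = h' i) \<longrightarrow> m h = m h') \<and>
    (\<forall>i<n. \<forall>h x y. m (h(i := x + y)) = m (h(i := x)) + m (h(i := y))) \<and>
    (\<forall>i<n. \<forall>h c x. m (h(i := c *\<^sub>C x)) = c *\<^sub>C m (h(i := x))) \<and>
    (\<exists>C. \<forall>h. norm (m h) \<le> C * (\<Prod>i<n. norm (h i))) \<and>
    (\<forall>x. p x = m (\<lambda>_. x)))"

definition analytic_at ::
  "('a::complex_normed_vector \<Rightarrow> 'b::complex_normed_vector) \<Rightarrow> 'a \<Rightarrow> bool"
  where "analytic_at f x \<longleftrightarrow> (\<exists>r>0. \<exists>p. (\<forall>n. homogeneous_poly n (p n)) \<and>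
    uniform_limit (ball 0 r) (\<lambda>N h. \<Sum>n<N. p n h) (\<lambda>h. f (x + h)) sequentially)"

end

theory Submission
  imports Defs
begin

text \<open>
  If \<open>L(Re X) > 0\<close>, the form of \<open>L(X)\<close> has a strictly positive real part on the completion, so the
  \<open>(2,2)\<close> block of \<open>L(X)\<close> is invertible by a Lax-Milgram argument. The Schur complement of \<open>L(X)\<close> is
  a corner of the inverse of an operator pencil that is affine in \<open>X\<close>, so the Neumann series of the
  pencil is the power series of \<open>F\<close>.

  If \<open>L(X) \<ge> 0\<close>, the Schur complement is the weak limit of those of \<open>L(X) + \<delta>\<close> as \<open>\<delta>\<close> decreases
  to \<open>0\<close>, and \<open>\<langle>w, F(X) w\<rangle>\<close> is the infimum of \<open>T (V\<^sup>* V) + \<lambda> (V\<^sup>* X V)\<close> over the operators \<open>V\<close> that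
  differ from \<open>w e\<^sup>*\<close> by one orthogonal to \<open>e\<^sup>* \<otimes> E\<close>. These infima split over direct sums, and
  \<open>V \<mapsto> W V\<close> maps the admissible operators of \<open>(I \<otimes> W\<^sup>*) X (I \<otimes> W)\<close> at \<open>w\<close> to admissible operators
  of \<open>X\<close> at \<open>W w\<close> with the same value, which gives the two remaining claims.
\<close>

section \<open>Hilbert space preliminaries\<close>

text \<open>The Hilbert spaces belonging to \<open>E\<close>, \<open>K\<close> and
  \<open>E \<times> K\<close> are three different completions, so their Schur complements cannot be
  compared as operators. The common ground is the operators \<open>V\<close> themselves: on them the
  form of \<open>L(X)\<close> is an explicit expression in \<open>T\<close> and
  \<open>\<lambda>\<close>, and orthogonality to the rank one classes is a condition on
  \<open>T\<close>. Passing from the completion to such \<open>V\<close> requires that removing the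
  rank one component of a class gives a class again.

  The formula for the Schur complement contains the inverse of a compressed block, which is not
  affine in \<open>X\<close>. The pencil moves this inversion to a doubled space where
  \<open>X\<close> enters affinely. On the analyticity domain \<open>L(X)\<close> need not be
  self-adjoint, so the estimates there use a lower bound for the real part of its form. On
  \<open>D(E)\<close> the block may fail to be invertible and the infimum may not be attained, so
  near minimisers up to an arbitrary \<epsilon> take the place of minimisers.\<close>

definition clinear :: "('a::complex_normed_vector \<Rightarrow> 'b::complex_normed_vector) \<Rightarrow> bool"
  where "clinear f \<longleftrightarrow> (\<forall>x y. f (x + y) = f x + f y) \<and> (\<forall>c x. f (c *\<^sub>C x) = c *\<^sub>C f x)"

definition csubspace :: "'a::complex_normed_vector set \<Rightarrow> bool"
  where "csubspace D \<longleftrightarrow> 0 \<in> D \<and> (\<forall>x\<in>D. \<forall>y\<in>D. x + y \<in> D) \<and> (\<forall>c. \<forall>x\<in>D. c *\<^sub>C x \<in> D)"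

lemma clinear_add: "clinear f \<Longrightarrow> f (x + y) = f x + f y"
  by (simp add: clinear_def)

lemma clinear_scaleC: "clinear f \<Longrightarrow> f (c *\<^sub>C x) = c *\<^sub>C f x"
  by (simp add: clinear_def)

lemma clinear_scaleR: "clinear f \<Longrightarrow> f (r *\<^sub>R x) = r *\<^sub>R f x"
  by (simp add: clinear_def scaleR_scaleC)

lemma clinear_zero: "clinear f \<Longrightarrow> f 0 = 0"
  using clinear_scaleC[of f 0 0] by simp

lemma clinear_minus: "clinear f \<Longrightarrow> f (- x) = - f x"
  using clinear_scaleR[of f "-1" x] by simp

lemma clinear_diff: "clinear f \<Longrightarrow> f (x - y) = f x - f y"
  using clinear_add[of f x "-y"] by (simp add: clinear_minus)

lemma clinear_cblinfun: "clinear (cblinfun_apply f)"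
  by (simp add: clinear_def cblinfun_add_right cblinfun_scaleC_right)

lemmas cblinfun_right_simps = cblinfun_add_right cblinfun_scaleC_right
  clinear_minus[OF clinear_cblinfun] clinear_diff[OF clinear_cblinfun]
  clinear_scaleR[OF clinear_cblinfun]

lemma cblinfun_of_clinear:
  assumes "clinear f" "\<And>x. norm (f x) \<le> K * norm x"
  obtains F where "\<And>x. cblinfun_apply F x = f x"
proof -
  have "bounded_linear f"
    by (rule bounded_linear_intro[where K = K])
      (use assms in \<open>auto simp: clinear_add clinear_scaleR mult.commute\<close>)
  then have "bounded_clinear f"
    using assms(1) by (simp add: bounded_clinear_def clinear_scaleC)
  then show ?thesis using that[of "CBlinfun f"] by (simp add: CBlinfun_inverse)
qed

lemma norm_cblinfun_le:
  assumes "\<And>x. norm (cblinfun_apply F x) \<le> K * norm x" "0 \<le> K"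
  shows "norm F \<le> K"
  using assms by transfer (rule onorm_bound)

lemma cblinfun_compose_apply [simp]: "cblinfun_apply (f o\<^sub>C g) x = f (g x)"
  by transfer simp

lemma norm_cblinfun_compose: "norm (f o\<^sub>C g) \<le> norm f * norm g"
proof (rule norm_cblinfun_le)
  show "norm (cblinfun_apply (f o\<^sub>C g) x) \<le> norm f * norm g * norm x" for x
    using order_trans[OF norm_cblinfun[of f "g x"] mult_left_mono[OF norm_cblinfun[of g x] norm_ge_zero[of f]]]
    by (simp add: mult.assoc)
qed simp

lift_definition id_cblinfun :: "'a::complex_normed_vector \<Rightarrow>\<^sub>C\<^sub>L 'a" is "\<lambda>x. x"
  by (simp add: bounded_clinear_def)

lemma id_cblinfun_apply [simp]: "cblinfun_apply id_cblinfun x = x"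
  by transfer simp

lemma csubspace_add: "csubspace D \<Longrightarrow> x \<in> D \<Longrightarrow> y \<in> D \<Longrightarrow> x + y \<in> D"
  by (simp add: csubspace_def)

lemma csubspace_scaleC: "csubspace D \<Longrightarrow> x \<in> D \<Longrightarrow> c *\<^sub>C x \<in> D"
  by (simp add: csubspace_def)

lemma csubspace_zero: "csubspace D \<Longrightarrow> 0 \<in> D"
  by (simp add: csubspace_def)

lemma csubspace_minus: "csubspace D \<Longrightarrow> x \<in> D \<Longrightarrow> - x \<in> D"
  using csubspace_scaleC[of D x "-1"] scaleR_scaleC[of "-1" x] by simp

lemma csubspace_diff: "csubspace D \<Longrightarrow> x \<in> D \<Longrightarrow> y \<in> D \<Longrightarrow> x - y \<in> D"
  using csubspace_add[of D x "-y"] csubspace_minus[of D y] by simp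

lemma csubspace_UNIV: "csubspace UNIV"
  by (simp add: csubspace_def)

lemma csubspace_range: "clinear f \<Longrightarrow> csubspace (range f)"
  unfolding csubspace_def
  by (auto simp: clinear_add[symmetric] clinear_scaleC[symmetric]) (metis clinear_zero rangeI)

lemma csubspace_closure:
  fixes D :: "'a::complex_normed_vector set"
  assumes D: "csubspace D"
  shows "csubspace (closure D)"
  unfolding csubspace_def
proof (intro conjI ballI allI)
  show "0 \<in> closure D" using D closure_subset by (auto simp: csubspace_def)
  fix x assume x: "x \<in> closure D"
  then obtain f where f: "\<forall>n. f n \<in> D" "f \<longlonglongrightarrow> x" by (auto simp: closure_sequential)
  show "c *\<^sub>C x \<in> closure D" for c
    unfolding closure_sequential
    by (rule exI[of _ "\<lambda>n. c *\<^sub>C f n"])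
      (use f D csubspace_scaleC bounded_linear.tendsto[OF bounded_linear_scaleC_right] in blast)
  fix y assume "y \<in> closure D"
  then obtain g where g: "\<forall>n. g n \<in> D" "g \<longlonglongrightarrow> y" by (auto simp: closure_sequential)
  show "x + y \<in> closure D"
    unfolding closure_sequential
    by (rule exI[of _ "\<lambda>n. f n + g n"]) (use f g D csubspace_add tendsto_add in blast)
qed

section \<open>Inner products and representing vectors\<close>

lemma bounded_bilinear_cinner: "bounded_bilinear (cinner :: 'a::chilbert \<Rightarrow> 'a \<Rightarrow> complex)"
proof
  fix a a' b b' :: 'a and r :: real
  show "cinner (a + a') b = cinner a b + cinner a' b" by (rule cinner_add_left)
  show "cinner a (b + b') = cinner a b + cinner a b'" by (rule cinner_add_right)
  show "cinner (r *\<^sub>R a) b = r *\<^sub>R cinner a b"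
    by (simp add: scaleR_scaleC cinner_scaleC_left scaleC_complex_def)
  show "cinner a (r *\<^sub>R b) = r *\<^sub>R cinner a b"
    by (simp add: scaleR_scaleC cinner_scaleC_right scaleC_complex_def)
  show "\<exists>K. \<forall>a b::'a. norm (cinner a b) \<le> norm a * norm b * K"
    by (intro exI[of _ 1] allI) (simp add: cinner_Cauchy_Schwarz)
qed

lemmas tendsto_cinner = bounded_bilinear.tendsto[OF bounded_bilinear_cinner]
lemmas cinner_simps = cinner_add_left cinner_add_right cinner_scaleC_left cinner_scaleC_right
  bounded_bilinear.diff_left[OF bounded_bilinear_cinner]
  bounded_bilinear.diff_right[OF bounded_bilinear_cinner]
  bounded_bilinear.minus_left[OF bounded_bilinear_cinner]
  bounded_bilinear.minus_right[OF bounded_bilinear_cinner]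
  bounded_bilinear.scaleR_left[OF bounded_bilinear_cinner]
  bounded_bilinear.scaleR_right[OF bounded_bilinear_cinner]

lemma cinner_zero_left [simp]: "cinner 0 (x::'a::chilbert) = 0"
  by (rule bounded_bilinear.zero_left[OF bounded_bilinear_cinner])

lemma cinner_eq_zero [simp]: "cinner x x = 0 \<longleftrightarrow> x = (0::'a::chilbert)"
  by (simp add: cinner_self)

lemma cinner_commute_Re: "Re (cinner x y) = Re (cinner y (x::'a::chilbert))"
  by (subst cinner_commute) simp

lemma cinner_eqI_right:
  assumes "\<And>y. cinner y x = cinner y (z::'a::chilbert)"
  shows "x = z"
proof -
  have "cinner (x - z) (x - z) = 0" by (subst cinner_simps(6)) (simp add: assms)
  then show ?thesis by simp
qed

lemma norm_add_sq: "(norm (x + y))\<^sup>2 = (norm x)\<^sup>2 + 2 * Re (cinner x y) + (norm (y::'a::chilbert))\<^sup>2"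
proof -
  have "cinner (x + y) (x + y) = cinner x x + cinner x y + cinner y x + cinner y y"
    by (simp add: cinner_simps)
  then have "Re (cinner (x + y) (x + y)) = Re (cinner x x + cinner x y + cinner y x + cinner y y)"
    by simp
  then show ?thesis by (simp add: cinner_self cinner_commute_Re[of y x] del: of_real_power)
qed

lemma norm_diff_sq: "(norm (x - y))\<^sup>2 = (norm x)\<^sup>2 - 2 * Re (cinner x y) + (norm (y::'a::chilbert))\<^sup>2"
  using norm_add_sq[of x "-y"] by (simp add: cinner_simps)

text \<open>If \<open>a\<close> were nonzero, a short step \<open>c = - t * cnj a\<close> would make
  the linear term negative and larger than the quadratic one. In this form the vanishing of a first
  variation is extracted from minimality.\<close>

lemma Re_scale_zero:
  fixes a b :: complex
  assumes "\<And>c. 0 \<le> 2 * Re (c * a) + (cmod c)\<^sup>2 * s"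
  shows "a = 0"
proof (rule ccontr)
  assume a: "a \<noteq> 0"
  define t where "t = 1 / (1 + \<bar>s\<bar>)"
  have t: "t > 0" "t * \<bar>s\<bar> < 1" by (auto simp: t_def field_simps)
  have "0 \<le> 2 * Re (complex_of_real (- t) * cnj a * a) + (cmod (complex_of_real (- t) * cnj a))\<^sup>2 * s"
    by (rule assms)
  also have "complex_of_real (- t) * cnj a * a = complex_of_real (- t * (cmod a)\<^sup>2)"
    by (metis complex_norm_square mult.assoc mult.commute of_real_mult)
  also have "(cmod (complex_of_real (- t) * cnj a))\<^sup>2 = t\<^sup>2 * (cmod a)\<^sup>2"
    by (simp add: norm_mult power_mult_distrib)
  finally have "0 \<le> (t * (cmod a)\<^sup>2) * (t * s - 2)"
    by (simp add: algebra_simps power2_eq_square)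
  moreover have "0 < t * (cmod a)\<^sup>2" using a t by simp
  moreover have "t * s \<le> t * \<bar>s\<bar>" using t(1) by (simp add: mult_left_mono)
  ultimately show False using t(2) by (auto simp: zero_le_mult_iff)
qed

text \<open>
  The representing vector is the limit of a minimising sequence of
  \<open>\<parallel>q V\<parallel>\<^sup>2 - 2 Re (f V)\<close>, so neither \<open>D\<close> nor the range of \<open>q\<close> need be closed.
\<close>

lemma riesz:
  fixes q :: "'v::complex_normed_vector \<Rightarrow> 'x::chilbert" and f :: "'v \<Rightarrow> complex"
  assumes D: "csubspace D" and q: "clinear q"
    and add: "\<And>x y. x \<in> D \<Longrightarrow> y \<in> D \<Longrightarrow> f (x + y) = f x + f y"
    and sc: "\<And>c x. x \<in> D \<Longrightarrow> f (c *\<^sub>C x) = c * f x"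
    and bd: "\<And>x. x \<in> D \<Longrightarrow> cmod (f x) \<le> C * norm (q x)"
  obtains z where "z \<in> closure (q ` D)" "\<And>x. x \<in> D \<Longrightarrow> cinner z (q x) = f x"
proof -
  define I where "I x = (norm (q x))\<^sup>2 - 2 * Re (f x)" for x
  have I_lb: "- C\<^sup>2 \<le> I x" if "x \<in> D" for x
  proof -
    have "Re (f x) \<le> C * norm (q x)"
      using bd[OF that] complex_Re_le_cmod[of "f x"] by linarith
    moreover have "0 \<le> (norm (q x) - C)\<^sup>2" by simp
    ultimately show ?thesis unfolding I_def by (simp add: power2_eq_square algebra_simps)
  qed
  define m where "m = Inf (I ` D)"
  have bdd: "bdd_below (I ` D)" using I_lb by (auto intro!: bdd_belowI[of _ "- C\<^sup>2"])
  have ne: "I ` D \<noteq> {}" using D by (auto simp: csubspace_def)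
  have m_le: "m \<le> I x" if "x \<in> D" for x
    unfolding m_def using that by (intro cInf_lower bdd) auto
  have "\<exists>x\<in>D. I x < m + 1 / (Suc n)" for n
    using cInf_lessD[OF ne, of "m + 1 / (Suc n)"] by (auto simp: m_def)
  then obtain V where V: "\<And>n. V n \<in> D" "\<And>n. I (V n) < m + 1 / (Suc n)" by metis
  \<comment> \<open>Parallelogram law written for \<open>I\<close>. The midpoint lies in
    \<open>D\<close>, so its value is at least \<open>m\<close>, and near minimisers have nearby
    images under \<open>q\<close>.\<close>
  have par: "(norm (q x - q y))\<^sup>2 = 2 * I x + 2 * I y - 4 * I ((1/2) *\<^sub>C (x + y))"
    if "x \<in> D" "y \<in> D" for x y
  proof -
    have "q ((1/2) *\<^sub>C (x + y)) = (1/2) *\<^sub>R (q x + q y)"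
      by (simp add: clinear_scaleC[OF q] clinear_add[OF q] scaleR_scaleC)
    then have "(norm (q ((1/2) *\<^sub>C (x + y))))\<^sup>2 = (norm (q x + q y))\<^sup>2 / 4"
      by (simp add: power2_eq_square)
    moreover have "Re (f ((1/2) *\<^sub>C (x + y))) = (Re (f x) + Re (f y)) / 2"
      by (subst sc) (simp_all add: csubspace_add[OF D] that add)
    ultimately show ?thesis
      unfolding I_def by (simp add: norm_diff_sq norm_add_sq field_simps)
  qed
  have cs: "(norm (q (V n) - q (V k)))\<^sup>2 \<le> 2 / (Suc n) + 2 / (Suc k)" for n k
    using par[OF V(1) V(1), of n k] V(2)[of n] V(2)[of k]
      m_le[OF csubspace_scaleC[OF D csubspace_add[OF D V(1) V(1)]], of "1/2" n k]
    by simp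
  have "Cauchy (\<lambda>n. q (V n))"
  proof (rule CauchyI)
    fix e :: real assume e: "0 < e"
    obtain N where N: "4 / e\<^sup>2 < real N" using reals_Archimedean2 by blast
    show "\<exists>M. \<forall>m\<ge>M. \<forall>n\<ge>M. norm (q (V m) - q (V n)) < e"
    proof (intro exI allI impI)
      fix n k assume nk: "N \<le> n" "N \<le> k"
      have "4 < real N * e\<^sup>2" using N e by (simp add: field_simps)
      moreover have "0 < e\<^sup>2" using e by simp
      ultimately have "4 < real N * e\<^sup>2 + e\<^sup>2" by linarith
      then have "4 < e\<^sup>2 * real (Suc N)" by (simp add: algebra_simps)
      then have "4 / real (Suc N) < e\<^sup>2" by (simp add: field_simps)
      moreover have "2 / real (Suc n) \<le> 2 / real (Suc N)" "2 / real (Suc k) \<le> 2 / real (Suc N)"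
        using nk by (auto intro!: divide_left_mono)
      ultimately have "(norm (q (V n) - q (V k)))\<^sup>2 < e\<^sup>2" using cs[of n k] by linarith
      then show "norm (q (V n) - q (V k)) < e" using e by (simp add: power2_less_imp_less)
    qed
  qed
  then obtain z where z: "(\<lambda>n. q (V n)) \<longlonglongrightarrow> z" by (auto simp: Cauchy_convergent_iff convergent_def)
  have lim: "(\<lambda>n. m + 1 / (Suc n)) \<longlonglongrightarrow> m"
    using LIMSEQ_inverse_real_of_nat_add[of m] by (simp add: inverse_eq_divide)
  show thesis
  proof (rule that)
    show "z \<in> closure (q ` D)"
      unfolding closure_sequential by (rule exI[of _ "\<lambda>n. q (V n)"]) (simp add: z V(1))
    fix x assume x: "x \<in> D"
    have "cinner z (q x) - f x = 0"
    proof (rule Re_scale_zero)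
      fix c
      \<comment> \<open>First variation in the direction \<open>x\<close>. The slack
        \<open>1 / (Suc n)\<close> accounts for \<open>V n\<close> being only a near minimiser and
        disappears in the limit, where \<open>q (V n)\<close> becomes \<open>z\<close>.\<close>
      have "m \<le> m + 1 / (Suc n) + 2 * Re (c * (cinner (q (V n)) (q x) - f x)) + (cmod c)\<^sup>2 * (norm (q x))\<^sup>2" for n
      proof -
        have "m \<le> I (V n + c *\<^sub>C x)"
          using x V(1) D by (intro m_le) (simp add: csubspace_def)
        also have "\<dots> = I (V n) + 2 * Re (c * (cinner (q (V n)) (q x) - f x)) + (cmod c)\<^sup>2 * (norm (q x))\<^sup>2"
          unfolding I_def using x V(1) D
          by (simp add: add sc csubspace_scaleC clinear_add[OF q] clinear_scaleC[OF q] norm_add_sq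
              norm_scaleC cinner_scaleC_right power_mult_distrib algebra_simps)
        finally show ?thesis using V(2)[of n] by linarith
      qed
      moreover have "(\<lambda>n. m + 1 / (Suc n) + 2 * Re (c * (cinner (q (V n)) (q x) - f x)) + (cmod c)\<^sup>2 * (norm (q x))\<^sup>2)
         \<longlonglongrightarrow> m + 2 * Re (c * (cinner z (q x) - f x)) + (cmod c)\<^sup>2 * (norm (q x))\<^sup>2"
        by (intro tendsto_intros lim tendsto_cinner z)
      ultimately have "m \<le> m + 2 * Re (c * (cinner z (q x) - f x)) + (cmod c)\<^sup>2 * (norm (q x))\<^sup>2"
        by (intro LIMSEQ_le_const) auto
      then show "0 \<le> 2 * Re (c * (cinner z (q x) - f x)) + (cmod c)\<^sup>2 * (norm (q x))\<^sup>2" by simp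
    qed
    then show "cinner z (q x) = f x" by simp
  qed
qed

section \<open>Orthogonality and bounded sesquilinear forms\<close>

lemma clinear_ident: "clinear (\<lambda>x. x)"
  by (simp add: clinear_def)

lemma orth_closure: "orth (closure D) = orth (D::'a::chilbert set)"
proof
  show "orth (closure D) \<subseteq> orth D"
    using closure_subset by (auto simp: orth_def)
  show "orth D \<subseteq> orth (closure D)"
  proof
    fix x assume x: "x \<in> orth D"
    have "cinner y x = 0" if y: "y \<in> closure D" for y
    proof -
      obtain f where f: "\<forall>n. f n \<in> D" "f \<longlonglongrightarrow> y" using y by (auto simp: closure_sequential)
      have "(\<lambda>n. cinner (f n) x) \<longlonglongrightarrow> cinner y x" by (intro tendsto_cinner f tendsto_const)
      moreover have "cinner (f n) x = 0" for n using f x by (auto simp: orth_def)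
      ultimately show ?thesis by (simp add: LIMSEQ_const_iff)
    qed
    then show "x \<in> orth (closure D)" by (simp add: orth_def)
  qed
qed

lemma orth_self: "x \<in> D \<Longrightarrow> x \<in> orth D \<Longrightarrow> x = 0"
  unfolding orth_def using cinner_eq_zero by blast

lemma csubspace_orth: "csubspace (orth D)"
  by (auto simp: csubspace_def orth_def cinner_simps)

lemma orth_left: "x \<in> orth D \<Longrightarrow> y \<in> D \<Longrightarrow> cinner x y = 0"
  by (subst cinner_commute) (simp add: orth_def)

lemma orth_right: "x \<in> orth D \<Longrightarrow> y \<in> D \<Longrightarrow> cinner y x = 0"
  by (simp add: orth_def)

text \<open>\<open>u - v\<close> is orthogonal to \<open>D\<close>, hence to
  \<open>closure D\<close>, where it lies, hence to itself. Equality in a completion can thus be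
  tested against classes.\<close>

lemma closure_eqI:
  fixes u v :: "'a::chilbert"
  assumes D: "csubspace D" and u: "u \<in> closure D" and v: "v \<in> closure D"
    and eq: "\<And>x. x \<in> D \<Longrightarrow> cinner x u = cinner x v"
  shows "u = v"
proof -
  have "u - v \<in> orth D" by (simp add: orth_def cinner_simps eq)
  then have "u - v \<in> orth (closure D)" by (simp add: orth_closure)
  moreover have "u - v \<in> closure D" using csubspace_diff[OF csubspace_closure[OF D] u v] .
  ultimately show ?thesis using orth_self by force
qed

text \<open>Test with a sequence from \<open>D\<close> that converges to \<open>u\<close> itself:
  the bound becomes \<open>(norm u)\<^sup>2 \<le> K * norm u\<close>.\<close>

lemma norm_le_closure:
  fixes u :: "'a::chilbert"
  assumes u: "u \<in> closure D" and bd: "\<And>x. x \<in> D \<Longrightarrow> cmod (cinner x u) \<le> K * norm x" and K: "0 \<le> K"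
  shows "norm u \<le> K"
proof -
  obtain f where f: "\<forall>n. f n \<in> D" "f \<longlonglongrightarrow> u" using u by (auto simp: closure_sequential)
  have "(\<lambda>n. cmod (cinner (f n) u)) \<longlonglongrightarrow> cmod (cinner u u)"
    by (intro tendsto_norm tendsto_cinner f tendsto_const)
  moreover have "(\<lambda>n. K * norm (f n)) \<longlonglongrightarrow> K * norm u" by (intro tendsto_intros f)
  ultimately have "cmod (cinner u u) \<le> K * norm u"
    by (rule LIMSEQ_le) (use bd f in auto)
  then have "norm u * norm u \<le> K * norm u" by (simp add: cinner_self power2_eq_square norm_mult)
  then show ?thesis using K by (cases "norm u = 0") auto
qed

text \<open>The bound by \<open>norm (p W)\<close> and \<open>norm (q V)\<close> makes
  \<open>b\<close> descend to the quotients, and Riesz is applied twice: in \<open>V\<close>, to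
  represent \<open>b W\<close> by a vector \<open>y W\<close>, and in \<open>W\<close>, to represent
  the functional \<open>cinner x (y W)\<close> by the value at \<open>x\<close>. Adjoints, weak
  limits of Schur complements and the operator of \<open>\<lambda>\<close> are all obtained in this
  way.\<close>

lemma sesquilinear_operator:
  fixes q :: "'v::complex_normed_vector \<Rightarrow> 'x::chilbert"
    and p :: "'w::complex_normed_vector \<Rightarrow> 'y::chilbert" and b :: "'w \<Rightarrow> 'v \<Rightarrow> complex"
  assumes q: "clinear q" and p: "clinear p"
    and addl: "\<And>W W' V. b (W + W') V = b W V + b W' V"
    and addr: "\<And>W V V'. b W (V + V') = b W V + b W V'"
    and scl: "\<And>c W V. b (c *\<^sub>C W) V = cnj c * b W V"
    and scr: "\<And>c W V. b W (c *\<^sub>C V) = c * b W V"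
    and bd: "\<And>W V. cmod (b W V) \<le> C * norm (p W) * norm (q V)" and C: "0 \<le> C"
  obtains Z :: "'x \<Rightarrow>\<^sub>C\<^sub>L 'y" where "\<And>x. cblinfun_apply Z x \<in> closure (range p)"
    and "\<And>x. x \<in> orth (range q) \<Longrightarrow> cblinfun_apply Z x = 0"
    and "\<And>V W. cinner (p W) (cblinfun_apply Z (q V)) = b W V"
    and "norm Z \<le> C"
proof -
  have "\<exists>z. z \<in> closure (range q) \<and> (\<forall>V. cinner z (q V) = b W V)" for W
    by (rule riesz[OF csubspace_UNIV q, of "b W" "C * norm (p W)"]) (use addr scr bd in auto)
  then obtain y where y: "\<And>W. y W \<in> closure (range q)" "\<And>W V. cinner (y W) (q V) = b W V" by metis
  have y': "cinner (q V) (y W) = cnj (b W V)" for V W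
    using y(2)[of W V] by (subst cinner_commute) simp
  have yeqI: "y W = u" if "u \<in> closure (range q)" "\<And>V. cinner (q V) u = cnj (b W V)" for W u
    by (rule closure_eqI[OF csubspace_range[OF q] y(1) that(1)]) (auto simp: y' that)
  have yadd: "y (W + W') = y W + y W'" for W W'
    by (rule yeqI) (auto simp: cinner_simps y' addl csubspace_add[OF csubspace_closure[OF csubspace_range[OF q]]] y(1))
  have ysc: "y (c *\<^sub>C W) = c *\<^sub>C y W" for c W
    by (rule yeqI) (auto simp: cinner_simps y' scl csubspace_scaleC[OF csubspace_closure[OF csubspace_range[OF q]]] y(1))
  have yn: "norm (y W) \<le> C * norm (p W)" for W
    by (rule norm_le_closure[OF y(1)]) (use bd C in \<open>auto simp: y'\<close>)
  have cxy: "cmod (cinner x (y W)) \<le> (C * norm x) * norm (p W)" for x W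
    using cinner_Cauchy_Schwarz[of x "y W"] mult_left_mono[OF yn[of W] norm_ge_zero[of x]]
    by (simp add: mult_ac)
  have "\<exists>z. z \<in> closure (range p) \<and> (\<forall>W. cinner z (p W) = cinner x (y W))" for x
    by (rule riesz[OF csubspace_UNIV p, of "\<lambda>W. cinner x (y W)" "C * norm x"])
      (use cxy in \<open>auto simp: yadd ysc cinner_simps\<close>)
  then obtain z where z: "\<And>x. z x \<in> closure (range p)" "\<And>x W. cinner (z x) (p W) = cinner x (y W)" by metis
  have z': "cinner (p W) (z x) = cinner (y W) x" for x W
    using z(2)[of x W] by (metis cinner_commute)
  have zeqI: "z x = u" if "u \<in> closure (range p)" "\<And>W. cinner (p W) u = cinner (y W) x" for x u
    by (rule closure_eqI[OF csubspace_range[OF p] z(1) that(1)]) (auto simp: z' that)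
  have zlin: "clinear z"
    unfolding clinear_def
    by (auto intro!: zeqI simp: cinner_simps z' z(1)
        csubspace_scaleC[OF csubspace_closure[OF csubspace_range[OF p]]]
        csubspace_add[OF csubspace_closure[OF csubspace_range[OF p]]])
  have zn: "norm (z x) \<le> C * norm x" for x
  proof (rule norm_le_closure[OF z(1)])
    fix u assume "u \<in> range p"
    then show "cmod (cinner u (z x)) \<le> C * norm x * norm u"
      using cxy[of x] by (auto simp: z(2)[symmetric]) (metis cinner_commute complex_mod_cnj)
  qed (use C in simp)
  obtain Z where Z: "\<And>x. cblinfun_apply Z x = z x"
    using cblinfun_of_clinear[OF zlin zn] by blast
  show thesis
  proof (rule that[of Z])
    show "cblinfun_apply Z x \<in> closure (range p)" for x by (simp add: Z z)
    show "cinner (p W) (cblinfun_apply Z (q V)) = b W V" for W V by (simp add: Z z' y(2))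
    show "norm Z \<le> C" by (rule norm_cblinfun_le) (use zn C in \<open>auto simp: Z\<close>)
    fix x assume "x \<in> orth (range q)"
    then have "x \<in> orth (closure (range q))" by (simp add: orth_closure)
    then have "cinner (y W) x = 0" for W using y(1) by (simp add: orth_def)
    then show "cblinfun_apply Z x = 0"
      unfolding Z by (intro zeqI) (simp_all add: csubspace_zero[OF csubspace_closure[OF csubspace_range[OF p]]])
  qed
qed

section \<open>Adjoints, quadratic forms and the Loewner order\<close>

lemma cinner_adj_left: "cinner (cblinfun_apply (A\<^sup>\<dagger>) y) x = cinner y (cblinfun_apply A x)"
proof -
  have bd: "cmod (cinner (A W) V) \<le> norm A * norm W * norm V" for W V
    by (rule order_trans[OF cinner_Cauchy_Schwarz mult_right_mono[OF norm_cblinfun norm_ge_zero]])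
  \<comment> \<open>\<open>adj\<close> is a definite description, so an adjoint has to be produced:
    it is the operator of the form \<open>cinner (A W) V\<close>.\<close>
  obtain Z where Z: "\<And>V W. cinner W (cblinfun_apply Z V) = cinner (A W) V"
    by (rule sesquilinear_operator[OF clinear_ident clinear_ident,
          of "\<lambda>W V. cinner (A W) V" "norm A"])
      (use bd in \<open>auto simp: cblinfun_right_simps cinner_simps\<close>)
  have "\<forall>x y. cinner (cblinfun_apply (A\<^sup>\<dagger>) y) x = cinner y (A x)"
    unfolding adj_def
  proof (rule theI)
    show *: "\<forall>x y. cinner (cblinfun_apply Z y) x = cinner y (A x)"
      using Z by (metis cinner_commute)
    fix B assume B: "\<forall>x y. cinner (cblinfun_apply B y) x = cinner y (A x)"
    show "B = Z"
      by (rule cblinfun_eqI, rule cinner_eqI_right) (metis B * cinner_commute)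
  qed
  then show ?thesis by blast
qed

lemma cinner_adj_right: "cinner x (cblinfun_apply (A\<^sup>\<dagger>) y) = cinner (cblinfun_apply A x) y"
  by (metis cinner_adj_left cinner_commute)

lemma adj_eqI:
  assumes "\<And>x y. cinner x (cblinfun_apply B y) = cinner (cblinfun_apply A x) y"
  shows "A\<^sup>\<dagger> = B"
  by (rule cblinfun_eqI, rule cinner_eqI_right) (simp add: cinner_adj_right assms)

lemma adj_adj [simp]: "(A\<^sup>\<dagger>)\<^sup>\<dagger> = A"
  by (rule adj_eqI) (simp add: cinner_adj_left)

lemma adj_compose: "(A o\<^sub>C B)\<^sup>\<dagger> = B\<^sup>\<dagger> o\<^sub>C A\<^sup>\<dagger>"
  by (rule adj_eqI) (simp add: cinner_adj_right)

lemma adj_add: "(A + B)\<^sup>\<dagger> = A\<^sup>\<dagger> + B\<^sup>\<dagger>"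
  by (rule adj_eqI) (simp add: cinner_adj_right cblinfun_simps cinner_simps)

lemma adj_scaleC: "(c *\<^sub>C A)\<^sup>\<dagger> = cnj c *\<^sub>C A\<^sup>\<dagger>"
  by (rule adj_eqI) (simp add: cinner_adj_right cblinfun_simps cinner_simps)

lemma norm_adj: "norm (A\<^sup>\<dagger>) \<le> norm A"
proof (rule norm_cblinfun_le)
  fix x
  show "norm (cblinfun_apply (A\<^sup>\<dagger>) x) \<le> norm A * norm x"
  proof (rule norm_le_closure[of _ UNIV])
    show "cmod (cinner y (cblinfun_apply (A\<^sup>\<dagger>) x)) \<le> norm A * norm x * norm y" for y
      using order_trans[OF cinner_Cauchy_Schwarz[of "A y" x] mult_right_mono[OF norm_cblinfun[of A y] norm_ge_zero[of x]]]
      by (simp add: cinner_adj_right mult_ac)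
  qed auto
qed simp

lemma polarization:
  fixes A :: "'x::chilbert \<Rightarrow>\<^sub>C\<^sub>L 'x"
  shows "4 * cinner x (A y) = cinner (x + y) (A (x + y)) - cinner (x - y) (A (x - y))
    - \<i> * cinner (x + \<i> *\<^sub>C y) (A (x + \<i> *\<^sub>C y)) + \<i> * cinner (x - \<i> *\<^sub>C y) (A (x - \<i> *\<^sub>C y))"
  by (simp add: cinner_simps cblinfun_right_simps algebra_simps)

lemma cblinfun_eq_of_form:
  assumes "\<And>x. cinner x (cblinfun_apply A x) = cinner x (cblinfun_apply B x)"
  shows "A = B"
proof (rule cblinfun_eqI, rule cinner_eqI_right)
  fix x y
  have "4 * cinner y (cblinfun_apply A x) = 4 * cinner y (cblinfun_apply B x)"
    by (simp only: polarization assms)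
  then show "cinner y (cblinfun_apply A x) = cinner y (cblinfun_apply B x)" by simp
qed

lemma selfadjoint_iff_real_form: "A\<^sup>\<dagger> = A \<longleftrightarrow> (\<forall>x. Im (cinner x (cblinfun_apply A x)) = 0)"
proof
  assume A: "A\<^sup>\<dagger> = A"
  show "\<forall>x. Im (cinner x (cblinfun_apply A x)) = 0"
  proof
    fix x
    have "cinner x (cblinfun_apply A x) = cnj (cinner x (cblinfun_apply A x))"
      by (metis A cinner_adj_left cinner_commute)
    then show "Im (cinner x (cblinfun_apply A x)) = 0" by (metis Reals_cnj_iff complex_is_Real_iff)
  qed
next
  assume *: "\<forall>x. Im (cinner x (cblinfun_apply A x)) = 0"
  show "A\<^sup>\<dagger> = A"
  proof (rule cblinfun_eq_of_form)
    fix x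
    have "cinner x (cblinfun_apply (A\<^sup>\<dagger>) x) = cnj (cinner x (cblinfun_apply A x))"
      by (metis cinner_adj_right cinner_commute)
    also have "\<dots> = cinner x (cblinfun_apply A x)" using * by (simp add: complex_eq_iff)
    finally show "cinner x (cblinfun_apply (A\<^sup>\<dagger>) x) = cinner x (cblinfun_apply A x)" .
  qed
qed

lemma positive_op_iff: "positive_op A \<longleftrightarrow> A\<^sup>\<dagger> = A \<and> (\<forall>x. 0 \<le> Re (cinner x (cblinfun_apply A x)))"
  unfolding positive_op_def selfadjoint_iff_real_form by (auto simp: complex_nonneg_Reals_iff)

lemma loewner_le_iff:
  assumes "A\<^sup>\<dagger> = A" "B\<^sup>\<dagger> = B"
  shows "A \<le>\<^sub>L B \<longleftrightarrow> (\<forall>x. Re (cinner x (cblinfun_apply A x)) \<le> Re (cinner x (cblinfun_apply B x)))"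
  using assms unfolding loewner_le_def positive_op_def selfadjoint_iff_real_form
  by (auto simp: complex_nonneg_Reals_iff cblinfun_simps cinner_simps)

lemma loewner_antisym:
  assumes "A \<le>\<^sub>L B" "B \<le>\<^sub>L A"
  shows "A = B"
proof (rule cblinfun_eq_of_form)
  show "cinner x (cblinfun_apply A x) = cinner x (cblinfun_apply B x)" for x
    using assms unfolding loewner_le_def positive_op_def
    by (auto simp: complex_nonneg_Reals_iff cblinfun_simps cinner_simps complex_eq_iff
        intro: antisym)
qed

text \<open>The form of \<open>A\<close> at \<open>x + c *\<^sub>C y\<close> with
  \<open>c = - t * s\<close> is a nonnegative real quadratic in \<open>t\<close>, with leading
  coefficient \<open>(cmod s)\<^sup>2 * a\<close>. As \<open>A\<close> is only semidefinite,
  \<open>a = 0\<close> is treated separately.\<close>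

lemma positive_op_Cauchy_Schwarz:
  assumes "positive_op A"
  shows "(cmod (cinner y (cblinfun_apply A x)))\<^sup>2
    \<le> Re (cinner y (cblinfun_apply A y)) * Re (cinner x (cblinfun_apply A x))"
proof -
  define s where "s = cinner y (cblinfun_apply A x)"
  have sym: "cinner x (cblinfun_apply A y) = cnj s"
    using assms unfolding s_def positive_op_iff by (metis cinner_adj_left cinner_commute)
  define a where "a = Re (cinner y (cblinfun_apply A y))"
  define b where "b = Re (cinner x (cblinfun_apply A x))"
  have a: "a \<ge> 0" and b: "b \<ge> 0" using assms by (auto simp: positive_op_iff a_def b_def)
  have q: "0 \<le> b + 2 * Re (c * cnj s) + (cmod c)\<^sup>2 * a" for c
  proof -
    have "0 \<le> Re (cinner (x + c *\<^sub>C y) (A (x + c *\<^sub>C y)))" using assms by (simp add: positive_op_iff)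
    also have "\<dots> = b + Re (c * cnj s) + Re (cnj c * s) + Re ((c * cnj c) * cinner y (A y))"
      by (simp add: cinner_simps cblinfun_right_simps b_def s_def[symmetric] sym algebra_simps)
    also have "c * cnj c = complex_of_real ((cmod c)\<^sup>2)" by (rule complex_norm_square[symmetric])
    also have "Re (cnj c * s) = Re (c * cnj s)" by simp
    finally show ?thesis by (simp add: a_def del: of_real_power)
  qed
  have q2: "0 \<le> b - 2 * t * (cmod s)\<^sup>2 + t\<^sup>2 * (cmod s)\<^sup>2 * a" for t
  proof -
    have "Re (complex_of_real (- t) * s * cnj s) = - t * (cmod s)\<^sup>2"
      by (simp add: cmod_power2) (simp add: power2_eq_square algebra_simps)
    then show ?thesis using q[of "complex_of_real (- t) * s"]
      by (simp only:) (simp add: norm_mult power_mult_distrib)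
  qed
  have "(cmod s)\<^sup>2 \<le> a * b"
  proof (cases "a = 0")
    case True
    have "(cmod s)\<^sup>2 = 0"
    proof (rule ccontr)
      assume ne: "(cmod s)\<^sup>2 \<noteq> 0"
      \<comment> \<open>With \<open>a = 0\<close> the quadratic is affine in \<open>t\<close>, and
        this \<open>t\<close> makes its value \<open>b - 2 * (b + 1) < 0\<close>.\<close>
      show False using q2[of "(b + 1) / (cmod s)\<^sup>2"] ne True b by simp
    qed
    then show ?thesis using a b by simp
  next
    case False
    then have "0 < a" using a by simp
    \<comment> \<open>\<open>t = 1 / a\<close> minimises the quadratic.\<close>
    have "0 \<le> b - 2 * (1 / a) * (cmod s)\<^sup>2 + (1 / a)\<^sup>2 * (cmod s)\<^sup>2 * a" by (rule q2)
    also have "\<dots> = b - (cmod s)\<^sup>2 / a" using \<open>0 < a\<close> by (simp add: power2_eq_square field_simps)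
    finally show ?thesis using \<open>0 < a\<close> by (simp add: field_simps)
  qed
  then show ?thesis by (simp add: s_def a_def b_def)
qed

section \<open>Operators on closed subspaces and Schur complements\<close>

lemma closed_orth: "closed (orth D)"
proof -
  have "orth D = (\<Inter>y\<in>D. {x. cinner y x = 0})" by (auto simp: orth_def)
  moreover have "closed {x. cinner y x = 0}" for y
    by (rule closed_Collect_eq[OF linear_continuous_on[OF
          bounded_bilinear.bounded_linear_right[OF bounded_bilinear_cinner]] continuous_on_const])
  ultimately show ?thesis by auto
qed

lemma csubspace_Int: "csubspace A \<Longrightarrow> csubspace B \<Longrightarrow> csubspace (A \<inter> B)"
  by (simp add: csubspace_def)

text \<open>Representing the functional \<open>cinner x\<close> on \<open>S\<close> gives the
  orthogonal projection of \<open>x\<close>; closedness of \<open>S\<close> keeps it in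
  \<open>S\<close>.\<close>

lemma ex_decomp:
  fixes S :: "'x::chilbert set"
  assumes S: "closed S" "csubspace S"
  shows "\<exists>y\<in>S. x - y \<in> orth S"
proof -
  obtain z where z: "z \<in> closure ((\<lambda>x. x) ` S)" "\<And>y. y \<in> S \<Longrightarrow> cinner z y = cinner x y"
    by (rule riesz[OF S(2) clinear_ident, of "cinner x" "norm x"])
      (auto simp: cinner_simps cinner_Cauchy_Schwarz)
  have "cinner y (x - z) = 0" if "y \<in> S" for y
    using z(2)[OF that] by (metis cinner_commute cinner_simps(6) eq_iff_diff_eq_0)
  then show ?thesis using z(1) S(1) by (intro bexI[of _ z]) (simp_all add: orth_def)
qed

lemma proj_ex:
  fixes S :: "'x::chilbert set"
  assumes S: "closed S" "csubspace S"
  shows "\<exists>P. P \<in> ops_on S \<and> (\<forall>x\<in>S. cblinfun_apply P x = x)"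
proof -
  have "\<exists>z\<in>S. x - z \<in> orth S" for x by (rule ex_decomp[OF S])
  then obtain p where p: "\<And>x. p x \<in> S" "\<And>x. x - p x \<in> orth S" by metis
  have eqI: "p x = z" if "z \<in> S" "x - z \<in> orth S" for x z
  proof -
    have "(x - z) - (x - p x) \<in> orth S" using csubspace_diff[OF csubspace_orth] that p by blast
    then have "p x - z \<in> orth S" by simp
    moreover have "p x - z \<in> S" using csubspace_diff[OF S(2)] that p by blast
    ultimately show ?thesis using orth_self by force
  qed
  have lin: "clinear p"
    unfolding clinear_def
  proof (intro conjI allI eqI)
    fix x y c
    show "p x + p y \<in> S" "c *\<^sub>C p x \<in> S" using p S(2) by (auto simp: csubspace_def)
    have "x + y - (p x + p y) = (x - p x) + (y - p y)" by simp
    then show "x + y - (p x + p y) \<in> orth S" using csubspace_add[OF csubspace_orth] p by metis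
    show "c *\<^sub>C x - c *\<^sub>C p x \<in> orth S"
      unfolding scaleC_diff_right[symmetric] by (intro csubspace_scaleC[OF csubspace_orth] p)
  qed
  have "norm (p x) \<le> 1 * norm x" for x
  proof -
    have "(norm (p x + (x - p x)))\<^sup>2 = (norm (p x))\<^sup>2 + (norm (x - p x))\<^sup>2"
      unfolding norm_add_sq using orth_right[OF p(2) p(1)] by simp
    then have "(norm (p x))\<^sup>2 \<le> (norm x)\<^sup>2" by simp
    then show ?thesis using power2_le_imp_le[of _ "norm x"] by simp
  qed
  then obtain P where P: "\<And>x. cblinfun_apply P x = p x" using cblinfun_of_clinear[OF lin] by blast
  have "p x = x" if "x \<in> S" for x
    using that by (intro eqI) (simp_all add: csubspace_zero[OF csubspace_orth])
  moreover have "p x = 0" if "x \<in> orth S" for x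
    using that by (intro eqI) (simp_all add: csubspace_zero[OF S(2)])
  ultimately show ?thesis by (intro exI[of _ P]) (auto simp: P ops_on_def p)
qed

context
  fixes S :: "'x::chilbert set"
  assumes S: "closed S" "csubspace S"
begin

lemma ops_on_eqI:
  assumes "A \<in> ops_on S" "B \<in> ops_on S" "\<And>x. x \<in> S \<Longrightarrow> cblinfun_apply A x = cblinfun_apply B x"
  shows "A = B"
proof (rule cblinfun_eqI)
  fix x
  obtain y where y: "y \<in> S" "x - y \<in> orth S" using ex_decomp[OF S] by blast
  have "cblinfun_apply Z x = Z y" if Z: "Z \<in> ops_on S" for Z
  proof -
    have "cblinfun_apply Z (x - y) = 0" using Z y(2) by (simp add: ops_on_def)
    then show ?thesis by (simp add: cblinfun_right_simps)
  qed
  then show "cblinfun_apply A x = cblinfun_apply B x" using assms(1,2) assms(3)[OF y(1)] by metis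
qed

lemma proj_on_props: "proj_on S \<in> ops_on S \<and> (\<forall>x\<in>S. cblinfun_apply (proj_on S) x = x)"
  unfolding proj_on_def
proof (rule theI')
  show "\<exists>!P. P \<in> ops_on S \<and> (\<forall>x\<in>S. cblinfun_apply P x = x)"
    using proj_ex[OF S] ops_on_eqI by (metis (full_types))
qed

lemma proj_on_mem: "cblinfun_apply (proj_on S) x \<in> S"
  using proj_on_props by (simp add: ops_on_def)

lemma proj_on_fixes: "x \<in> S \<Longrightarrow> cblinfun_apply (proj_on S) x = x"
  using proj_on_props by simp

lemma proj_on_orth: "x \<in> orth S \<Longrightarrow> cblinfun_apply (proj_on S) x = 0"
  using proj_on_props by (simp add: ops_on_def)

lemma proj_on_eqI: "y \<in> S \<Longrightarrow> x - y \<in> orth S \<Longrightarrow> cblinfun_apply (proj_on S) x = y"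
  using proj_on_orth[of "x - y"] by (simp add: cblinfun_right_simps proj_on_fixes)

lemma diff_proj_on: "x - cblinfun_apply (proj_on S) x \<in> orth S"
  using ex_decomp[OF S, of x] proj_on_eqI by metis

lemma orth_orth: "orth (orth S) = S"
proof
  show "S \<subseteq> orth (orth S)" by (auto simp: orth_def[of "orth S"] intro: orth_left)
  show "orth (orth S) \<subseteq> S"
  proof
    fix x assume x: "x \<in> orth (orth S)"
    obtain y where y: "y \<in> S" "x - y \<in> orth S" using ex_decomp[OF S] by blast
    have "y \<in> orth (orth S)" using y(1) by (auto simp: orth_def[of "orth S"] intro: orth_left)
    then have "x - y \<in> orth (orth S)" using x csubspace_diff[OF csubspace_orth] by blast
    then have "x - y = 0" using y orth_self by blast
    then show "x \<in> S" using y by simp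
  qed
qed

lemma ops_on_proj: "Z \<in> ops_on S \<Longrightarrow> cblinfun_apply Z (cblinfun_apply (proj_on S) x) = cblinfun_apply Z x"
proof -
  assume "Z \<in> ops_on S"
  then have "cblinfun_apply Z (x - proj_on S x) = 0" using diff_proj_on[of x] by (simp add: ops_on_def)
  then show ?thesis by (simp add: cblinfun_right_simps)
qed

lemma ops_on_cinner_proj:
  "Z \<in> ops_on S \<Longrightarrow> cinner (cblinfun_apply (proj_on S) x) (cblinfun_apply Z y) = cinner x (cblinfun_apply Z y)"
  using orth_left[OF diff_proj_on[of x], of "Z y"] by (auto simp: ops_on_def cinner_simps)

lemma norm_proj_on_le: "norm (cblinfun_apply (proj_on S) x) \<le> norm x"
proof -
  have "(norm (proj_on S x + (x - proj_on S x)))\<^sup>2 = (norm (proj_on S x))\<^sup>2 + (norm (x - proj_on S x))\<^sup>2"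
    unfolding norm_add_sq using orth_right[OF diff_proj_on proj_on_mem] by simp
  then have "(norm (proj_on S x))\<^sup>2 \<le> (norm x)\<^sup>2" by simp
  then show ?thesis using power2_le_imp_le[of _ "norm x"] by simp
qed

lemma cinner_proj_on: "cinner (cblinfun_apply (proj_on S) x) y = cinner x (cblinfun_apply (proj_on S) y)"
  using orth_left[OF diff_proj_on proj_on_mem, of x y] orth_right[OF diff_proj_on proj_on_mem, of x y]
  by (simp add: cinner_simps)

text \<open>\<open>S\<close> is the orthogonal complement of \<open>orth S\<close>, so taking
  adjoints exchanges the two defining properties of \<open>ops_on\<close>: values in
  \<open>S\<close>, and vanishing on \<open>orth S\<close>.\<close>

lemma adj_ops_on:
  assumes "A \<in> ops_on S"
  shows "A\<^sup>\<dagger> \<in> ops_on S"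
  unfolding ops_on_def
proof (intro CollectI conjI allI ballI)
  fix x
  have "cblinfun_apply (A\<^sup>\<dagger>) x \<in> orth (orth S)"
    using assms by (auto simp: orth_def[of "orth S"] cinner_adj_right ops_on_def)
  then show "cblinfun_apply (A\<^sup>\<dagger>) x \<in> S" by (simp add: orth_orth)
  assume x: "x \<in> orth S"
  show "cblinfun_apply (A\<^sup>\<dagger>) x = 0"
    by (rule cinner_eqI_right) (use assms orth_right[OF x] in \<open>simp add: cinner_adj_right ops_on_def\<close>)
qed

lemma inverse_on_eqI:
  assumes "is_inverse_on S Z R" "Z \<in> ops_on S"
  shows "inverse_on S Z = R"
  unfolding inverse_on_def
proof (rule the_equality)
  show "is_inverse_on S Z R" by (rule assms)
  fix R' assume R': "is_inverse_on S Z R'"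
  show "R' = R"
  proof (rule cblinfun_eqI)
    fix x
    have "cblinfun_apply R' x = R' (Z (R x))"
      using assms R' ops_on_proj[of R' x] by (metis cblinfun_compose_apply is_inverse_on_def)
    also have "\<dots> = proj_on S (R x)" using R' by (metis cblinfun_compose_apply is_inverse_on_def)
    also have "\<dots> = R x" using assms(1) by (intro proj_on_fixes) (simp add: is_inverse_on_def ops_on_def)
    finally show "cblinfun_apply R' x = cblinfun_apply R x" .
  qed
qed

lemma inverse_on_props:
  assumes "invertible_on S Z" "Z \<in> ops_on S"
  shows "inverse_on S Z \<in> ops_on S"
    and "cblinfun_apply Z (inverse_on S Z x) = proj_on S x"
    and "cblinfun_apply (inverse_on S Z) (Z x) = proj_on S x"
proof -
  have "is_inverse_on S Z (inverse_on S Z)"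
    using assms inverse_on_eqI unfolding invertible_on_def by metis
  then show "inverse_on S Z \<in> ops_on S"
    "cblinfun_apply Z (inverse_on S Z x) = proj_on S x"
    "cblinfun_apply (inverse_on S Z) (Z x) = proj_on S x"
    unfolding is_inverse_on_def by (metis cblinfun_compose_apply)+
qed

end

text \<open>Stated for the real part, since the operators need not be self-adjoint. A lower bound of
  this kind passes to the adjoint, to compressions and, with a smaller constant, to small
  perturbations.\<close>

definition coercive_on :: "'x::chilbert set \<Rightarrow> real \<Rightarrow> ('x \<Rightarrow>\<^sub>C\<^sub>L 'x) \<Rightarrow> bool"
  where "coercive_on S c Z \<longleftrightarrow> 0 < c \<and> (\<forall>x\<in>S. c * (norm x)\<^sup>2 \<le> Re (cinner x (cblinfun_apply Z x)))"

lemma coercive_norm: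
  assumes "coercive_on S c Z" "x \<in> S"
  shows "c * norm x \<le> norm (cblinfun_apply Z x)"
proof (cases "x = 0")
  case False
  have "c * (norm x)\<^sup>2 \<le> norm x * norm (Z x)"
    using assms order_trans[OF complex_Re_le_cmod cinner_Cauchy_Schwarz[of x "Z x"]]
    unfolding coercive_on_def by fastforce
  then show ?thesis using False by (simp add: power2_eq_square)
qed simp

text \<open>
  Solvability of \<open>Z x = y\<close> comes from representing the functional \<open>\<langle>y, V\<rangle>\<close> through the
  vectors \<open>Z\<^sup>* V\<close>, which is possible since \<open>Z\<^sup>*\<close> is coercive too.
\<close>

lemma coercive_invertible_on:
  fixes S :: "'x::chilbert set"
  assumes S: "closed S" "csubspace S" and Z: "Z \<in> ops_on S" and co: "coercive_on S c Z"
  shows "invertible_on S Z"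
proof -
  have c: "0 < c" using co by (simp add: coercive_on_def)
  have co': "coercive_on S c (Z\<^sup>\<dagger>)"
    using co by (simp add: coercive_on_def cinner_adj_right cinner_commute_Re[of "cblinfun_apply Z _"])
  have "\<exists>x\<in>S. cblinfun_apply Z x = proj_on S y" for y
  proof -
    have bd: "cmod (cinner y V) \<le> norm y / c * norm (cblinfun_apply (Z\<^sup>\<dagger>) V)" if "V \<in> S" for V
    proof -
      have "norm V \<le> norm (cblinfun_apply (Z\<^sup>\<dagger>) V) / c"
        using coercive_norm[OF co' that] c by (simp add: field_simps)
      then have "norm y * norm V \<le> norm y * (norm (cblinfun_apply (Z\<^sup>\<dagger>) V) / c)"
        by (intro mult_left_mono) auto
      then show ?thesis using cinner_Cauchy_Schwarz[of y V] by simp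
    qed
    obtain x where x: "x \<in> closure (cblinfun_apply (Z\<^sup>\<dagger>) ` S)"
      "\<And>V. V \<in> S \<Longrightarrow> cinner x (cblinfun_apply (Z\<^sup>\<dagger>) V) = cinner y V"
      by (rule riesz[OF S(2) clinear_cblinfun, of "cinner y" "norm y / c" "Z\<^sup>\<dagger>"])
        (use bd in \<open>auto simp: cinner_simps\<close>)
    \<comment> \<open>\<open>Z\<^sup>\<dagger>\<close> also maps into \<open>S\<close>, and
      \<open>S\<close> is closed, so the representing vector does not leave
      \<open>S\<close>.\<close>
    have "cblinfun_apply (Z\<^sup>\<dagger>) ` S \<subseteq> S" using adj_ops_on[OF S Z] by (auto simp: ops_on_def)
    then have xS: "x \<in> S" using x(1) S(1) closure_minimal by blast
    have "cblinfun_apply Z x = proj_on S y"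
    proof (rule closure_eqI[OF S(2)])
      show "Z x \<in> closure S" "proj_on S y \<in> closure S"
        using Z proj_on_mem[OF S] closure_subset by (auto simp: ops_on_def)
      fix V assume V: "V \<in> S"
      have "cinner (Z x) V = cinner y V" using x(2)[OF V] by (simp add: cinner_adj_right)
      then have "cinner V (Z x) = cinner V y" by (metis cinner_commute)
      then show "cinner V (Z x) = cinner V (proj_on S y)"
        using cinner_proj_on[OF S, of V y] proj_on_fixes[OF S V] by simp
    qed
    then show ?thesis using xS by blast
  qed
  then obtain r where r: "\<And>y. r y \<in> S" "\<And>y. cblinfun_apply Z (r y) = proj_on S y" by metis
  have inj: "x = x'" if "x \<in> S" "x' \<in> S" "cblinfun_apply Z x = Z x'" for x x'
  proof -
    have "c * norm (x - x') \<le> norm (Z (x - x'))"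
      by (intro coercive_norm[OF co] csubspace_diff[OF S(2)] that)
    then have "norm (x - x') \<le> 0" using that c by (simp add: cblinfun_right_simps mult_le_0_iff)
    then show ?thesis by simp
  qed
  have lin: "clinear r"
    unfolding clinear_def
    by (intro conjI allI; rule inj)
      (simp_all add: r cblinfun_right_simps csubspace_add[OF S(2)] csubspace_scaleC[OF S(2)])
  have "norm (r y) \<le> (1/c) * norm y" for y
    using coercive_norm[OF co r(1)[of y]] norm_proj_on_le[OF S, of y] c r(2)[of y]
    by (simp add: field_simps)
  then obtain R where R: "\<And>x. cblinfun_apply R x = r x" using cblinfun_of_clinear[OF lin] by blast
  have "is_inverse_on S Z R"
    unfolding is_inverse_on_def ops_on_def
  proof (intro conjI CollectI allI ballI cblinfun_eqI)
    show "cblinfun_apply R x \<in> S" for x by (simp add: R r)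
    show "cblinfun_apply R x = 0" if "x \<in> orth S" for x
      unfolding R by (rule inj) (simp_all add: that r csubspace_zero[OF S(2)] proj_on_orth[OF S])
    show "cblinfun_apply (Z o\<^sub>C R) x = proj_on S x" for x by (simp add: R r)
    show "cblinfun_apply (R o\<^sub>C Z) x = proj_on S x" for x
    proof -
      have Zx: "Z x \<in> S" using Z by (simp add: ops_on_def)
      have "r (Z x) = proj_on S x"
        by (rule inj) (simp_all add: Zx r proj_on_mem[OF S] proj_on_fixes[OF S] ops_on_proj[OF S Z])
      then show ?thesis by (simp add: R)
    qed
  qed
  then show ?thesis by (auto simp: invertible_on_def)
qed

section \<open>Schur complements for a pair of closed subspaces\<close>

locale subspace_pair =
  fixes M S :: "'x::chilbert set"
  assumes M: "closed M" "csubspace M" and S: "closed S" "csubspace S" and S_subset: "S \<subseteq> M"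
begin

abbreviation "S' \<equiv> M \<inter> orth S"
abbreviation "P1 \<equiv> proj_on S"
abbreviation "P2 \<equiv> proj_on S'"

lemma S': "closed S'" "csubspace S'"
  using M by (simp_all add: closed_orth closed_Int csubspace_Int csubspace_orth)

lemma cinner_S_S': "s \<in> S \<Longrightarrow> t \<in> S' \<Longrightarrow> cinner s t = 0" "s \<in> S \<Longrightarrow> t \<in> S' \<Longrightarrow> cinner t s = 0"
  by (auto intro: orth_left orth_right)

lemma proj_split: "cblinfun_apply (proj_on M) x = P1 x + P2 x"
proof -
  define y where "y = cblinfun_apply (proj_on M) x"
  have y: "y \<in> M" "x - y \<in> orth M" by (simp_all add: y_def proj_on_mem[OF M] diff_proj_on[OF M])
  have oM: "orth M \<subseteq> orth S" "orth M \<subseteq> orth S'" using S_subset by (auto simp: orth_def)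
  have s: "P1 y \<in> S" "y - P1 y \<in> orth S" by (simp_all add: proj_on_mem[OF S] diff_proj_on[OF S])
  have "P1 x = P1 y"
  proof (rule proj_on_eqI[OF S s(1)])
    have "x - P1 y = (x - y) + (y - P1 y)" by simp
    then show "x - P1 y \<in> orth S" using csubspace_add[OF csubspace_orth, of "x - y" S "y - P1 y"] y s oM by auto
  qed
  moreover have "P2 x = y - P1 y"
  proof (rule proj_on_eqI[OF S'])
    show "y - P1 y \<in> S'" using s y csubspace_diff[OF M(2)] S_subset by blast
    have "P1 y \<in> orth S'" using s(1) by (auto simp: orth_def[of S'] orth_left)
    then have "(x - y) + P1 y \<in> orth S'" using csubspace_add[OF csubspace_orth] y oM by blast
    then show "x - (y - P1 y) \<in> orth S'" by (simp add: algebra_simps)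
  qed
  ultimately show ?thesis by (simp add: y_def)
qed

lemma M_split: "x \<in> M \<Longrightarrow> x = P1 x + P2 x"
  using proj_split proj_on_fixes[OF M] by metis

lemma P_simps [simp]:
  "cblinfun_apply P1 x \<in> S" "cblinfun_apply P2 x \<in> S'" "cblinfun_apply P2 x \<in> M"
  "cblinfun_apply P2 x \<in> orth S" "s \<in> S \<Longrightarrow> cblinfun_apply P1 s = s" "t \<in> S' \<Longrightarrow> cblinfun_apply P2 t = t"
  "s \<in> S \<Longrightarrow> cblinfun_apply P2 s = 0" "t \<in> S' \<Longrightarrow> cblinfun_apply P1 t = 0"
proof -
  show "cblinfun_apply P1 x \<in> S" "cblinfun_apply P2 x \<in> S'" "cblinfun_apply P2 x \<in> M"
    "cblinfun_apply P2 x \<in> orth S" "s \<in> S \<Longrightarrow> cblinfun_apply P1 s = s" "t \<in> S' \<Longrightarrow> cblinfun_apply P2 t = t"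
    using proj_on_mem[OF S] proj_on_mem[OF S'] proj_on_fixes[OF S] proj_on_fixes[OF S'] by auto
  show "cblinfun_apply P2 s = 0" if "s \<in> S"
    using that by (intro proj_on_orth[OF S']) (auto simp: orth_def[of S'] intro: cinner_S_S')
  show "cblinfun_apply P1 t = 0" if "t \<in> S'"
    using that by (intro proj_on_orth[OF S]) auto
qed

definition Z22 :: "('x \<Rightarrow>\<^sub>C\<^sub>L 'x) \<Rightarrow> ('x \<Rightarrow>\<^sub>C\<^sub>L 'x)"
  where "Z22 Z = P2 o\<^sub>C Z o\<^sub>C P2"

definition schur :: "('x \<Rightarrow>\<^sub>C\<^sub>L 'x) \<Rightarrow> ('x \<Rightarrow>\<^sub>C\<^sub>L 'x)"
  where "schur Z = P1 o\<^sub>C Z o\<^sub>C P1 - P1 o\<^sub>C Z o\<^sub>C P2 o\<^sub>C inverse_on S' (Z22 Z) o\<^sub>C (P2 o\<^sub>C Z o\<^sub>C P1)"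

lemma is_schur_iff:
  "is_schur M S Z A \<longleftrightarrow> invertible_on S' (Z22 Z) \<and> A = schur Z \<or>
    positive_op Z \<and> A \<in> ops_on S \<and> A\<^sup>\<dagger> = A \<and> A \<le>\<^sub>L Z \<and>
    (\<forall>B. B \<in> ops_on S \<and> B\<^sup>\<dagger> = B \<and> B \<le>\<^sub>L Z \<longrightarrow> B \<le>\<^sub>L A)"
  unfolding is_schur_def Z22_def schur_def Let_def ..

lemma Z22_ops_on: "Z22 Z \<in> ops_on S'"
  by (simp add: Z22_def ops_on_def proj_on_orth[OF S'])

text \<open>Compression does not change the form on \<open>S'\<close>, so the lower bound is
  inherited.\<close>

lemma coercive_Z22:
  assumes "coercive_on M c Z"
  shows "invertible_on S' (Z22 Z)"
proof (rule coercive_invertible_on[OF S' Z22_ops_on])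
  have "cinner x (Z22 Z x) = cinner x (Z x)" if "x \<in> S'" for x
    using that cinner_proj_on[OF S', of x] by (simp add: Z22_def)
  then show "coercive_on S' c (Z22 Z)"
    using assms by (simp add: coercive_on_def)
qed

text \<open>\<open>schur_point Z s\<close> is the point of \<open>s + S'\<close> at which the form of \<open>Z\<close> is stationary.\<close>

definition schur_point :: "('x \<Rightarrow>\<^sub>C\<^sub>L 'x) \<Rightarrow> 'x \<Rightarrow> 'x"
  where "schur_point Z s = s - inverse_on S' (Z22 Z) (P2 (Z s))"

text \<open>The correction \<open>t\<close> solves \<open>Z22 Z t = P2 (Z s)\<close>, so
  \<open>P2\<close> kills \<open>Z (s - t)\<close>. Only the \<open>S\<close> component is left, and
  it is the Schur complement at \<open>s\<close>.\<close>

lemma schur_point: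
  assumes Z: "Z \<in> ops_on M" and inv: "invertible_on S' (Z22 Z)" and s: "s \<in> S"
  shows "schur_point Z s - s \<in> S'" "cblinfun_apply Z (schur_point Z s) = schur Z s"
    and "cblinfun_apply (schur Z) s \<in> S"
proof -
  note R = inverse_on_props[OF S' inv Z22_ops_on]
  define t where "t = inverse_on S' (Z22 Z) (P2 (Z s))"
  have t: "t \<in> S'" using R(1) by (auto simp: t_def ops_on_def)
  then show "schur_point Z s - s \<in> S'"
    using csubspace_minus[OF S'(2)] by (simp add: schur_point_def t_def)
  have "P2 (Z t) = Z22 Z t" using t by (simp add: Z22_def)
  also have "\<dots> = P2 (Z s)" unfolding t_def by (simp add: R(2))
  finally have "P2 (Z (schur_point Z s)) = 0"
    by (simp add: schur_point_def t_def[symmetric] cblinfun_right_simps)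
  moreover have "Z (schur_point Z s) \<in> M" using Z by (simp add: ops_on_def)
  ultimately have "Z (schur_point Z s) = P1 (Z (schur_point Z s))" using M_split by fastforce
  also have "\<dots> = schur Z s"
    using s t by (simp add: schur_point_def schur_def cblinfun_simps cblinfun_right_simps t_def[symmetric])
  finally show "cblinfun_apply Z (schur_point Z s) = schur Z s" .
  then show "cblinfun_apply (schur Z) s \<in> S" using \<open>Z (schur_point Z s) = P1 (Z (schur_point Z s))\<close>
    by (metis P_simps(1))
qed

lemma schur_ops_on:
  assumes "Z \<in> ops_on M" "invertible_on S' (Z22 Z)"
  shows "schur Z \<in> ops_on S"
proof -
  have *: "cblinfun_apply (schur Z) x = schur Z (P1 x)" for x
    by (simp add: schur_def cblinfun_simps)
  show ?thesis
    unfolding ops_on_def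
  proof (intro CollectI conjI allI ballI)
    show "cblinfun_apply (schur Z) x \<in> S" for x
      by (subst *) (rule schur_point(3)[OF assms P_simps(1)])
    show "cblinfun_apply (schur Z) x = 0" if "x \<in> orth S" for x
      by (subst *) (simp add: proj_on_orth[OF S that])
  qed
qed

text \<open>This is the shorted operator of a positive \<open>Z\<close>, described by values:
  \<open>A\<close> is below \<open>Z\<close>, and its form at \<open>s\<close> is the infimum of the
  form of \<open>Z\<close> over \<open>s + S'\<close>. Unlike maximality, this description supplies
  near minimisers, also where the infimum is not attained.\<close>

definition is_short :: "('x \<Rightarrow>\<^sub>C\<^sub>L 'x) \<Rightarrow> ('x \<Rightarrow>\<^sub>C\<^sub>L 'x) \<Rightarrow> bool"
  where "is_short Z A \<longleftrightarrow> A \<in> ops_on S \<and> A\<^sup>\<dagger> = A \<and> A \<le>\<^sub>L Z \<and>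
    (\<forall>s\<in>S. \<forall>\<epsilon>>0. \<exists>t\<in>S'. Re (cinner (s + t) (cblinfun_apply Z (s + t)))
      \<le> Re (cinner s (cblinfun_apply A s)) + \<epsilon>)"

lemma ops_on_S_form:
  assumes "B \<in> ops_on S" "s \<in> S" "t \<in> S'"
  shows "cinner (s + t) (cblinfun_apply B (s + t)) = cinner s (cblinfun_apply B s)"
proof -
  have "cblinfun_apply B t = 0" "B s \<in> S" using assms by (auto simp: ops_on_def)
  then show ?thesis using assms(3) by (simp add: cblinfun_right_simps cinner_simps cinner_S_S'(2))
qed

lemma is_short_le:
  assumes A: "is_short Z A" and Z: "Z\<^sup>\<dagger> = Z" and s: "s \<in> S" and t: "t \<in> S'"
  shows "Re (cinner s (cblinfun_apply A s)) \<le> Re (cinner (s + t) (cblinfun_apply Z (s + t)))"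
  using A Z ops_on_S_form[of A s t] s t unfolding is_short_def by (metis loewner_le_iff)

text \<open>A competitor \<open>B\<close> has the same value at \<open>s + t\<close> as at
  \<open>s\<close>, so being below \<open>Z\<close> puts it below the infimum over \<open>t\<close>,
  which is the form of \<open>A\<close>.\<close>

lemma is_short_max:
  assumes A: "is_short Z A" and Z: "Z\<^sup>\<dagger> = Z" and B: "B \<in> ops_on S" "B\<^sup>\<dagger> = B" "B \<le>\<^sub>L Z"
  shows "B \<le>\<^sub>L A"
proof -
  have A': "A \<in> ops_on S" "A\<^sup>\<dagger> = A" using A by (auto simp: is_short_def)
  have form: "cinner x (cblinfun_apply C x) = cinner (P1 x) (cblinfun_apply C (P1 x))" if "C \<in> ops_on S" for C x
    using ops_on_proj[OF S that] ops_on_cinner_proj[OF S that] by simp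
  have "Re (cinner s (cblinfun_apply B s)) \<le> Re (cinner s (cblinfun_apply A s))" if s: "s \<in> S" for s
  proof (rule field_le_epsilon)
    fix \<epsilon> :: real assume "0 < \<epsilon>"
    then obtain t where t: "t \<in> S'" "Re (cinner (s + t) (cblinfun_apply Z (s + t)))
      \<le> Re (cinner s (cblinfun_apply A s)) + \<epsilon>" using A s unfolding is_short_def by blast
    have "Re (cinner (s + t) (cblinfun_apply B (s + t))) \<le> Re (cinner (s + t) (cblinfun_apply Z (s + t)))"
      using B(3) loewner_le_iff[OF B(2) Z] by blast
    then show "Re (cinner s (cblinfun_apply B s)) \<le> Re (cinner s (cblinfun_apply A s)) + \<epsilon>"
      using t(2) ops_on_S_form[OF B(1) s t(1)] by simp
  qed
  then show ?thesis
    unfolding loewner_le_iff[OF B(2) A'(2)] using form[OF A'(1)] form[OF B(1)] by (metis P_simps(1))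
qed

lemma ops_on_M_form:
  assumes Z: "Z \<in> ops_on M"
  shows "cinner x (cblinfun_apply Z x) = cinner (proj_on M x) (cblinfun_apply Z (proj_on M x))"
  using ops_on_proj[OF M Z] ops_on_cinner_proj[OF M Z] by simp

text \<open>At the stationary point \<open>x\<close>, \<open>Z x\<close> lies in \<open>S\<close>
  and is orthogonal to \<open>S'\<close>. The cross terms vanish, the form at \<open>x + u\<close>
  is the form at \<open>x\<close> plus the nonnegative form at \<open>u\<close>, and the infimum is
  attained at \<open>x\<close>.\<close>

lemma is_short_schur:
  assumes pos: "positive_op Z" and Z: "Z \<in> ops_on M" and inv: "invertible_on S' (Z22 Z)"
  shows "is_short Z (schur Z)"
proof -
  let ?A = "schur Z"
  note sp = schur_point[OF Z inv]
  have A: "?A \<in> ops_on S" by (rule schur_ops_on[OF Z inv])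
  have Zsa: "Z\<^sup>\<dagger> = Z" using pos by (simp add: positive_op_iff)
  have val: "cinner (schur_point Z s + u) (?A s) = cinner s (?A s)" if s: "s \<in> S" and u: "u \<in> S'" for s u
  proof -
    have "(schur_point Z s - s) + u \<in> S'" using csubspace_add[OF S'(2) sp(1)[OF s] u] .
    then have "cinner ((schur_point Z s - s) + u) (?A s) = 0" using sp(3)[OF s] cinner_S_S'(2) by blast
    then show ?thesis by (simp add: cinner_simps algebra_simps)
  qed
  have zz: "0 \<in> S'" using csubspace_zero[OF S'(2)] .
  have form: "cinner (schur_point Z s) (Z (schur_point Z s)) = cinner s (?A s)" if "s \<in> S" for s
    using val[OF that zz] sp(2)[OF that] by simp
  have real: "Im (cinner s (?A s)) = 0" if "s \<in> S" for s
    using form[OF that] Zsa selfadjoint_iff_real_form by metis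
  have Aform: "cinner x (?A x) = cinner (P1 x) (?A (P1 x))" for x
    using ops_on_proj[OF S A] ops_on_cinner_proj[OF S A] by simp
  have Asa: "?A\<^sup>\<dagger> = ?A"
    unfolding selfadjoint_iff_real_form using real Aform P_simps(1) by metis
  have le: "Re (cinner s (?A s)) \<le> Re (cinner (s + t) (Z (s + t)))" if s: "s \<in> S" and t: "t \<in> S'" for s t
  proof -
    define x where "x = schur_point Z s"
    define u where "u = t - (x - s)"
    have u: "u \<in> S'" using csubspace_diff[OF S'(2) t sp(1)[OF s]] by (simp add: u_def x_def)
    have "s + t = x + u" by (simp add: u_def)
    moreover have "cinner u (Z x) = 0" using sp(2,3)[OF s] u cinner_S_S'(2) by (simp add: x_def)
    moreover have "cinner x (Z u) = 0"
      using \<open>cinner u (Z x) = 0\<close> Zsa by (metis cinner_adj_left cinner_commute complex_cnj_zero)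
    ultimately have "cinner (s + t) (Z (s + t)) = cinner s (?A s) + cinner u (Z u)"
      using form[OF s] by (simp add: cinner_simps cblinfun_right_simps x_def)
    then show ?thesis using pos by (simp add: positive_op_iff)
  qed
  have "?A \<le>\<^sub>L Z"
    unfolding loewner_le_iff[OF Asa Zsa]
  proof
    fix x
    show "Re (cinner x (?A x)) \<le> Re (cinner x (Z x))"
      using le[of "P1 x" "P2 x"] Aform[of x] ops_on_M_form[OF Z, of x] proj_split[of x] by simp
  qed
  moreover have "\<exists>t\<in>S'. Re (cinner (s + t) (Z (s + t))) \<le> Re (cinner s (?A s)) + \<epsilon>"
    if "s \<in> S" "0 < \<epsilon>" for s \<epsilon>
    using sp(1)[OF that(1)] form[OF that(1)] that(2) by (intro bexI[of _ "schur_point Z s - s"]) auto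
  ultimately show ?thesis using A Asa by (simp add: is_short_def)
qed

text \<open>
  The form of \<open>Z + \<delta> P\<^sub>M\<close> is coercive, and its Schur complements decrease as \<open>\<delta>\<close> decreases
  to \<open>0\<close>; by polarization their weak limit exists.
\<close>

lemma is_short_ex:
  assumes pos: "positive_op Z" and Z: "Z \<in> ops_on M"
  shows "\<exists>A. is_short Z A"
proof -
  define d where "d n = 1 / real (Suc n)" for n
  define Zn where "Zn n = Z + d n *\<^sub>R proj_on M" for n
  have d: "0 < d n" "d (Suc n) \<le> d n" for n by (auto simp: d_def field_simps)
  have Zsa: "Z\<^sup>\<dagger> = Z" using pos by (simp add: positive_op_iff)
  have PM: "cinner x (proj_on M x) = complex_of_real ((norm (proj_on M x))\<^sup>2)" for x
    using cinner_proj_on[OF M, of x "proj_on M x"] proj_on_fixes[OF M proj_on_mem[OF M]]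
    by (simp add: cinner_self)
  have Zn_form: "cinner x (Zn n x) = cinner x (Z x) + complex_of_real (d n * (norm (proj_on M x))\<^sup>2)" for x n
    by (simp add: Zn_def cblinfun_simps cinner_simps PM scaleR_conv_of_real)
  have Zn_pos: "positive_op (Zn n)" for n
    using pos d(1)[of n] unfolding positive_op_def Zn_form
    by (simp add: complex_nonneg_Reals_iff)
  have Zn_sa: "(Zn n)\<^sup>\<dagger> = Zn n" for n using Zn_pos by (simp add: positive_op_iff)
  have Zn_M: "Zn n \<in> ops_on M" for n
    using Z proj_on_mem[OF M] proj_on_orth[OF M] csubspace_add[OF M(2)] csubspace_scaleC[OF M(2)]
    by (auto simp: Zn_def ops_on_def cblinfun_simps scaleR_scaleC)
  have "coercive_on M (d n) (Zn n)" for n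
    using d(1)[of n] pos unfolding coercive_on_def Zn_form
    by (simp add: proj_on_fixes[OF M] positive_op_iff)
  then have Zn_inv: "invertible_on S' (Z22 (Zn n))" for n by (rule coercive_Z22)
  define A where "A n = schur (Zn n)" for n
  have An: "is_short (Zn n) (A n)" for n
    unfolding A_def by (rule is_short_schur[OF Zn_pos Zn_M Zn_inv])
  have A_S: "A n \<in> ops_on S" and A_sa: "(A n)\<^sup>\<dagger> = A n" and A_le: "A n \<le>\<^sub>L Zn n" for n
    using An[of n] by (auto simp: is_short_def)
  define a where "a n x = Re (cinner x (A n x))" for n x
  have a_eq: "cinner x (A n x) = complex_of_real (a n x)" for n x
    using A_sa[of n] unfolding selfadjoint_iff_real_form by (simp add: a_def complex_eq_iff)
  have a_dec: "a (Suc n) x \<le> a n x" for n x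
  proof -
    \<comment> \<open>\<open>A (Suc n)\<close> lies below \<open>Zn (Suc n)\<close>, hence below
      \<open>Zn n\<close>, and so competes with \<open>A n\<close>.\<close>
    have "A (Suc n) \<le>\<^sub>L Zn n"
      unfolding loewner_le_iff[OF A_sa Zn_sa]
    proof
      fix x
      have "Re (cinner x (A (Suc n) x)) \<le> Re (cinner x (Zn (Suc n) x))"
        using A_le[of "Suc n"] loewner_le_iff[OF A_sa Zn_sa] by blast
      also have "\<dots> \<le> Re (cinner x (Zn n x))"
        unfolding Zn_form using d(2)[of n] by (simp add: mult_right_mono)
      finally show "Re (cinner x (A (Suc n) x)) \<le> Re (cinner x (Zn n x))" .
    qed
    then have "A (Suc n) \<le>\<^sub>L A n" by (rule is_short_max[OF An Zn_sa A_S A_sa])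
    then show ?thesis using loewner_le_iff[OF A_sa A_sa] unfolding a_def by blast
  qed
  \<comment> \<open>The zero operator is a competitor as well, which bounds the decreasing forms
    from below.\<close>
  have z: "(0 :: 'x \<Rightarrow>\<^sub>C\<^sub>L 'x) \<in> ops_on S" "(0 :: 'x \<Rightarrow>\<^sub>C\<^sub>L 'x)\<^sup>\<dagger> = 0"
    using csubspace_zero[OF S(2)] by (auto simp: ops_on_def cblinfun_simps intro: adj_eqI)
  have a_pos: "0 \<le> a n x" for n x
  proof -
    have "0 \<le>\<^sub>L Zn n" using Zn_pos by (simp add: loewner_le_def)
    then have "0 \<le>\<^sub>L A n" by (rule is_short_max[OF An Zn_sa z])
    then show ?thesis by (simp add: loewner_le_def positive_op_iff a_def)
  qed
  have A_pos: "positive_op (A n)" for n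
    using a_pos A_sa by (simp add: positive_op_iff a_def)
  have a_anti: "decseq (\<lambda>n. a n x)" for x by (rule decseq_SucI) (rule a_dec)
  have "convergent (\<lambda>n. a n x)" for x
    by (rule decseq_convergent[OF a_anti, of 0 x]) (use a_pos in \<open>auto simp: convergent_def\<close>)
  then have conv: "convergent (\<lambda>n. cinner x (A n x))" for x
    unfolding a_eq convergent_def by (metis tendsto_of_real)
  have "\<exists>l. (\<lambda>n. cinner y (A n x)) \<longlonglongrightarrow> l" for x y
  proof -
    have "convergent (\<lambda>n. (1/4) * (4 * cinner y (A n x)))"
      unfolding polarization
      by (intro convergent_mult convergent_add convergent_diff convergent_const conv)
    then show ?thesis by (simp add: convergent_def)
  qed
  then obtain b where b: "\<And>x y. (\<lambda>n. cinner y (A n x)) \<longlonglongrightarrow> b y x" by metis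
  have b_eqI: "b y x = l" if "(\<lambda>n. cinner y (A n x)) \<longlonglongrightarrow> l" for x y l
    using LIMSEQ_unique[OF b that] .
  \<comment> \<open>Uniform in \<open>n\<close>: the forms of the \<open>A n\<close> are dominated
    by that of \<open>A 0\<close>, and Cauchy-Schwarz for \<open>A n\<close> carries this over to
    the off-diagonal values. The limit form is therefore bounded.\<close>
  have bd: "cmod (cinner y (A n x)) \<le> norm (A 0) * norm y * norm x" for n x y
  proof (rule power2_le_imp_le)
    have a0: "a n x \<le> norm (A 0) * (norm x)\<^sup>2" for x
    proof -
      have "a n x \<le> a 0 x" using a_anti by (simp add: decseq_def)
      also have "\<dots> \<le> norm x * norm (A 0 x)"
        unfolding a_def by (rule order_trans[OF complex_Re_le_cmod cinner_Cauchy_Schwarz])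
      also have "\<dots> \<le> norm x * (norm (A 0) * norm x)"
        by (intro mult_left_mono norm_cblinfun) simp
      finally show ?thesis by (simp add: power2_eq_square mult_ac)
    qed
    have "(cmod (cinner y (A n x)))\<^sup>2 \<le> a n y * a n x"
      unfolding a_def by (rule positive_op_Cauchy_Schwarz[OF A_pos])
    also have "\<dots> \<le> (norm (A 0) * (norm y)\<^sup>2) * (norm (A 0) * (norm x)\<^sup>2)"
      by (intro mult_mono a0 a_pos) auto
    finally show "(cmod (cinner y (A n x)))\<^sup>2 \<le> (norm (A 0) * norm y * norm x)\<^sup>2"
      by (simp add: power2_eq_square mult_ac)
  qed simp
  obtain B :: "'x \<Rightarrow>\<^sub>C\<^sub>L 'x" where B: "\<And>x y. cinner y (B x) = b y x"
  proof (rule sesquilinear_operator[OF clinear_ident clinear_ident, of b "norm (A 0)"])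
    show "cmod (b W V) \<le> norm (A 0) * norm W * norm V" for V W
      by (rule LIMSEQ_le_const2[OF tendsto_norm[OF b]]) (use bd in auto)
    show "b (W + W') V = b W V + b W' V" for W W' V
      by (rule b_eqI) (auto simp: cinner_simps intro!: tendsto_intros b)
    show "b W (V + V') = b W V + b W V'" for W V V'
      by (rule b_eqI) (auto simp: cinner_simps cblinfun_right_simps intro!: tendsto_intros b)
    show "b (c *\<^sub>C W) V = cnj c * b W V" for W V c
      by (rule b_eqI) (auto simp: cinner_simps intro!: tendsto_intros b)
    show "b W (c *\<^sub>C V) = c * b W V" for W V c
      by (rule b_eqI) (auto simp: cinner_simps cblinfun_right_simps intro!: tendsto_intros b)
  qed (use that in auto)
  have lim: "(\<lambda>n. cinner y (A n x)) \<longlonglongrightarrow> cinner y (B x)" for x y using b B by simp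
  have alim: "(\<lambda>n. a n x) \<longlonglongrightarrow> Re (cinner x (B x))" for x
    unfolding a_def by (intro tendsto_Re lim)
  have B0: "cinner y (B x) = 0" if "\<And>n. cinner y (A n x) = 0" for x y
    using lim[of y x] that by (simp add: LIMSEQ_const_iff)
  have B_S: "B \<in> ops_on S"
    unfolding ops_on_def
  proof (intro CollectI conjI allI ballI)
    fix x
    have "B x \<in> orth (orth S)"
      using A_S by (auto simp: orth_def[of "orth S"] ops_on_def intro!: B0 orth_left)
    then show "B x \<in> S" by (simp add: orth_orth[OF S])
    assume x: "x \<in> orth S"
    show "B x = 0"
      by (rule cinner_eqI_right) (use A_S x in \<open>auto simp: ops_on_def intro!: B0\<close>)
  qed
  have B_sa: "B\<^sup>\<dagger> = B"
    unfolding selfadjoint_iff_real_form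
  proof
    fix x
    have "(\<lambda>n. Im (cinner x (A n x))) \<longlonglongrightarrow> Im (cinner x (B x))" by (intro tendsto_Im lim)
    then show "Im (cinner x (B x)) = 0" by (simp add: a_eq LIMSEQ_const_iff)
  qed
  have dlim: "(\<lambda>n. d n) \<longlonglongrightarrow> 0"
    unfolding d_def using LIMSEQ_inverse_real_of_nat by (simp add: inverse_eq_divide)
  have "B \<le>\<^sub>L Z"
    unfolding loewner_le_iff[OF B_sa Zsa]
  proof
    fix x
    have "a n x \<le> Re (cinner x (Z x)) + d n * (norm (proj_on M x))\<^sup>2" for n
      using A_le[of n] loewner_le_iff[OF A_sa Zn_sa] Zn_form[of x n] unfolding a_def
      by (metis Re_complex_of_real plus_complex.sel(1))
    moreover have "(\<lambda>n. Re (cinner x (Z x)) + d n * (norm (proj_on M x))\<^sup>2)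
      \<longlonglongrightarrow> Re (cinner x (Z x)) + 0 * (norm (proj_on M x))\<^sup>2"
      by (intro tendsto_intros dlim)
    ultimately show "Re (cinner x (B x)) \<le> Re (cinner x (Z x))"
      using LIMSEQ_le[OF alim] by fastforce
  qed
  moreover have "\<exists>t\<in>S'. Re (cinner (s + t) (Z (s + t))) \<le> Re (cinner s (B s)) + \<epsilon>"
    if s: "s \<in> S" and \<epsilon>: "0 < \<epsilon>" for s \<epsilon>
  proof -
    have "\<forall>\<^sub>F n in sequentially. a n s < Re (cinner s (B s)) + \<epsilon> / 2"
      using order_tendstoD(2)[OF alim] \<epsilon> by simp
    then obtain n where n: "a n s < Re (cinner s (B s)) + \<epsilon> / 2"
      by (auto simp: eventually_sequentially)
    \<comment> \<open>A near minimiser for \<open>Zn n\<close> serves for \<open>Z\<close>, since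
      \<open>Z\<close> lies below \<open>Zn n\<close>. One half of \<epsilon> pays for it, the other
      for replacing \<open>B\<close> by \<open>A n\<close>.\<close>
    obtain t where t: "t \<in> S'" "Re (cinner (s + t) (Zn n (s + t))) \<le> a n s + \<epsilon> / 2"
      using An[of n] s \<epsilon> half_gt_zero[OF \<epsilon>] unfolding is_short_def a_def by blast
    have "Re (cinner (s + t) (Z (s + t))) \<le> Re (cinner (s + t) (Zn n (s + t)))"
      unfolding Zn_form using d(1)[of n] by simp
    then show ?thesis using t n by (intro bexI[of _ t]) auto
  qed
  ultimately have "is_short Z B" using B_S B_sa by (simp add: is_short_def)
  then show ?thesis by blast
qed

lemma is_short_unique:
  assumes "Z\<^sup>\<dagger> = Z" "is_short Z A" "is_short Z B"
  shows "A = B"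
  using is_short_max[OF assms(2,1)] is_short_max[OF assms(3,1)] assms
  by (intro loewner_antisym) (auto simp: is_short_def)

text \<open>Both clauses of \<open>is_schur\<close> lead to the shorted operator: the explicit
  complement attains the infimum, and a largest operator agrees with the shorted one, which exists,
  by maximality in both directions.\<close>

lemma is_schur_positive:
  assumes pos: "positive_op Z" and Z: "Z \<in> ops_on M"
  shows "is_schur M S Z A \<longleftrightarrow> is_short Z A"
proof
  have Zsa: "Z\<^sup>\<dagger> = Z" using pos by (simp add: positive_op_iff)
  show "is_schur M S Z A" if "is_short Z A"
    using that pos is_short_max[OF that Zsa] unfolding is_schur_iff by (auto simp: is_short_def)
  assume "is_schur M S Z A"
  then consider "invertible_on S' (Z22 Z)" "A = schur Z"
    | "A \<in> ops_on S" "A\<^sup>\<dagger> = A" "A \<le>\<^sub>L Z" "\<And>B. B \<in> ops_on S \<Longrightarrow> B\<^sup>\<dagger> = B \<Longrightarrow> B \<le>\<^sub>L Z \<Longrightarrow> B \<le>\<^sub>L A"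
    unfolding is_schur_iff by blast
  then show "is_short Z A"
  proof cases
    case 1
    then show ?thesis using is_short_schur[OF pos Z] by simp
  next
    case 2
    obtain B where B: "is_short Z B" using is_short_ex[OF pos Z] by blast
    have "B \<le>\<^sub>L A" using B by (intro 2) (auto simp: is_short_def)
    moreover have "A \<le>\<^sub>L B" by (rule is_short_max[OF B Zsa 2(1-3)])
    ultimately show ?thesis using B loewner_antisym by blast
  qed
qed

text \<open>If \<open>Z\<close> happens to be positive as well, the second clause of
  \<open>is_schur\<close> also applies, and uniqueness of the shorted operator identifies the two;
  otherwise only the first clause is left.\<close>

lemma is_schur_invertible:
  assumes Z: "Z \<in> ops_on M" and inv: "invertible_on S' (Z22 Z)"
  shows "is_schur M S Z A \<longleftrightarrow> A = schur Z"
proof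
  assume A: "is_schur M S Z A"
  show "A = schur Z"
  proof (cases "positive_op Z")
    case True
    then have "is_short Z A" using A is_schur_positive[OF _ Z] by blast
    then show ?thesis
      using is_short_unique is_short_schur[OF True Z inv] True by (auto simp: positive_op_iff)
  next
    case False
    then show ?thesis using A unfolding is_schur_iff by blast
  qed
qed (use inv in \<open>simp add: is_schur_iff\<close>)

end

section \<open>Analyticity of resolvents of affine pencils\<close>

lemma cblinfun_compose_simps:
  fixes f g :: "'b::complex_normed_vector \<Rightarrow>\<^sub>C\<^sub>L 'c::complex_normed_vector"
    and h k :: "'a::complex_normed_vector \<Rightarrow>\<^sub>C\<^sub>L 'b"
  shows "(f + g) o\<^sub>C h = f o\<^sub>C h + g o\<^sub>C h" "f o\<^sub>C (h + k) = f o\<^sub>C h + f o\<^sub>C k"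
    "(c *\<^sub>C f) o\<^sub>C h = c *\<^sub>C (f o\<^sub>C h)" "f o\<^sub>C (c *\<^sub>C h) = c *\<^sub>C (f o\<^sub>C h)"
    "(- f) o\<^sub>C h = - (f o\<^sub>C h)" "f o\<^sub>C (- h) = - (f o\<^sub>C h)"
    "(f - g) o\<^sub>C h = f o\<^sub>C h - g o\<^sub>C h" "f o\<^sub>C (h - k) = f o\<^sub>C h - f o\<^sub>C k"
  by (rule cblinfun_eqI; simp add: cblinfun_simps cblinfun_right_simps)+

lemma cblinfun_compose_assoc: "(f o\<^sub>C g) o\<^sub>C h = f o\<^sub>C (g o\<^sub>C h)"
  by (rule cblinfun_eqI) simp

lemma cblinfun_compose_id [simp]: "id_cblinfun o\<^sub>C f = f" "f o\<^sub>C id_cblinfun = f"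
  by (rule cblinfun_eqI; simp)+

lemma norm_cblinfun_compose_le: "norm f \<le> a \<Longrightarrow> norm g \<le> b \<Longrightarrow> norm (f o\<^sub>C g) \<le> a * b"
  by (rule order_trans[OF norm_cblinfun_compose])
    (auto intro!: mult_mono order_trans[OF norm_ge_zero])

lemma bounded_linear_compose_both: "bounded_linear (\<lambda>Z. \<beta> o\<^sub>C Z o\<^sub>C \<alpha>)"
proof (rule bounded_linear_intro[where K = "norm \<beta> * norm \<alpha>"])
  show "norm (\<beta> o\<^sub>C Z o\<^sub>C \<alpha>) \<le> norm Z * (norm \<beta> * norm \<alpha>)" for Z
    using norm_cblinfun_compose_le[OF norm_cblinfun_compose_le[OF order_refl order_refl] order_refl, of \<beta> Z \<alpha>]
    by (simp add: mult_ac)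
qed (simp_all add: cblinfun_compose_simps scaleR_scaleC)

text \<open>The polarized terms of the expansion \<open>(P + D h)\<^sup>-\<^sup>1 = (\<Sum>n. R (- D h R)\<^sup>n)\<close> with \<open>R = P\<^sup>-\<^sup>1\<close>.\<close>

primrec neumann_term :: "('u::complex_normed_vector \<Rightarrow>\<^sub>C\<^sub>L 'u) \<Rightarrow> ('a \<Rightarrow> 'u \<Rightarrow>\<^sub>C\<^sub>L 'u) \<Rightarrow> nat
    \<Rightarrow> (nat \<Rightarrow> 'a) \<Rightarrow> 'u \<Rightarrow>\<^sub>C\<^sub>L 'u"
  where
    "neumann_term R D 0 h = R"
  | "neumann_term R D (Suc n) h = - (neumann_term R D n h o\<^sub>C (D (h n) o\<^sub>C R))"

lemma neumann_term_cong: "(\<And>i. i < n \<Longrightarrow> h i = h' i) \<Longrightarrow> neumann_term R D n h = neumann_term R D n h'"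
  by (induction n) auto

lemma neumann_term_upd: "neumann_term R D n (h(n := x)) = neumann_term R D n h"
  by (rule neumann_term_cong) auto

lemma neumann_term_add:
  assumes D: "clinear D" and i: "i < n"
  shows "neumann_term R D n (h(i := x + y)) = neumann_term R D n (h(i := x)) + neumann_term R D n (h(i := y))"
  using i
proof (induction n)
  case (Suc n)
  show ?case
  proof (cases "i = n")
    case True
    then show ?thesis
      by (simp add: neumann_term_upd clinear_add[OF D] cblinfun_compose_simps fun_upd_same del: fun_upd_apply)
  next
    case False
    then show ?thesis using Suc by (simp add: cblinfun_compose_simps)
  qed
qed simp

lemma neumann_term_scaleC:
  assumes D: "clinear D" and i: "i < n"
  shows "neumann_term R D n (h(i := c *\<^sub>C x)) = c *\<^sub>C neumann_term R D n (h(i := x))"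
  using i
proof (induction n)
  case (Suc n)
  show ?case
  proof (cases "i = n")
    case True
    then show ?thesis
      by (simp add: neumann_term_upd clinear_scaleC[OF D] cblinfun_compose_simps scaleC_minus_right
          fun_upd_same del: fun_upd_apply)
  next
    case False
    then show ?thesis using Suc by (simp add: cblinfun_compose_simps scaleC_minus_right)
  qed
qed simp

lemma norm_neumann_term:
  assumes D: "\<And>h. norm (D h) \<le> K * norm h"
  shows "norm (neumann_term R D n h) \<le> norm R * (K * norm R) ^ n * (\<Prod>i<n. norm (h i))"
proof (induction n)
  case (Suc n)
  have "norm (neumann_term R D (Suc n) h)
      \<le> (norm R * (K * norm R) ^ n * (\<Prod>i<n. norm (h i))) * ((K * norm (h n)) * norm R)"
    unfolding neumann_term.simps norm_minus_cancel
    by (intro norm_cblinfun_compose_le Suc D order_refl)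
  then show ?case by (simp add: mult_ac)
qed simp

text \<open>On the diagonal the factors can also be peeled off on the left. In this form
  \<open>P\<close> cancels \<open>R\<close>, as the telescoping sum for \<open>(P + D h)\<close>
  requires.\<close>

lemma neumann_term_const_Suc:
  "neumann_term R D (Suc n) (\<lambda>_. h) = - (R o\<^sub>C (D h o\<^sub>C neumann_term R D n (\<lambda>_. h)))"
proof (induction n)
  case (Suc n)
  show ?case
    by (subst neumann_term.simps(2), subst Suc) (simp add: cblinfun_compose_simps cblinfun_compose_assoc)
qed simp

lemma homogeneous_poly_neumann:
  assumes D: "clinear D" "\<And>h. norm (D h) \<le> K * norm h"
  shows "homogeneous_poly n (\<lambda>h. \<beta> o\<^sub>C neumann_term R D n (\<lambda>_. h) o\<^sub>C \<alpha>)"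
  unfolding homogeneous_poly_def
proof (rule exI[of _ "\<lambda>h. \<beta> o\<^sub>C neumann_term R D n h o\<^sub>C \<alpha>"], intro conjI allI impI)
  show "\<beta> o\<^sub>C neumann_term R D n h o\<^sub>C \<alpha> = \<beta> o\<^sub>C neumann_term R D n h' o\<^sub>C \<alpha>"
    if "\<forall>i<n. h i = h' i" for h h'
    using neumann_term_cong[of n h h' R D] that by simp
  have "norm (\<beta> o\<^sub>C neumann_term R D n h o\<^sub>C \<alpha>)
      \<le> (norm \<beta> * (norm R * (K * norm R) ^ n) * norm \<alpha>) * (\<Prod>i<n. norm (h i))" for h
    using norm_cblinfun_compose_le[OF norm_cblinfun_compose_le[OF order_refl norm_neumann_term[of D K R n h, OF D(2)]] order_refl, of \<beta> \<alpha>]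
    by (simp add: mult_ac)
  then show "\<exists>C. \<forall>h. norm (\<beta> o\<^sub>C neumann_term R D n h o\<^sub>C \<alpha>) \<le> C * (\<Prod>i<n. norm (h i))" by blast
qed (simp_all add: neumann_term_add[OF D(1)] neumann_term_scaleC[OF D(1)] cblinfun_compose_simps)

text \<open>Right inverses are used throughout: \<open>P o\<^sub>C R = id_cblinfun\<close> makes the
  Neumann series a right inverse of \<open>P + D h\<close>, and the value of \<open>f\<close> can be
  read off any such right inverse.\<close>

lemma analytic_at_pencil:
  fixes f :: "'a::complex_normed_vector \<Rightarrow> ('e::complex_normed_vector \<Rightarrow>\<^sub>C\<^sub>L 'd::cbanach)"
    and P R :: "'u::cbanach \<Rightarrow>\<^sub>C\<^sub>L 'u"
  assumes D: "clinear D" "\<And>h. norm (D h) \<le> K * norm h"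
    and PR: "P o\<^sub>C R = id_cblinfun" and r: "0 < r"
    and f: "\<And>h Q. norm h < r \<Longrightarrow> (P + D h) o\<^sub>C Q = id_cblinfun \<Longrightarrow> f (x + h) = \<beta> o\<^sub>C Q o\<^sub>C \<alpha>"
  shows "analytic_at f x"
proof -
  \<comment> \<open>A positive bound for the size of \<open>D h o\<^sub>C R\<close> per unit of
    \<open>h\<close>; the radius \<open>1 / (2 * K')\<close> makes the ratio of the Neumann series
    at most \<open>1 / 2\<close>.\<close>
  define K' where "K' = \<bar>K\<bar> * norm R + 1"
  have K': "0 < K'" by (simp add: K'_def add_nonneg_pos)
  define s where "s = min r (1 / (2 * K'))"
  have s: "0 < s" using r K' by (simp add: s_def)
  define w where "w h n = neumann_term R D n (\<lambda>_. h)" for h n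
  have D': "norm (D h) \<le> \<bar>K\<bar> * norm h" for h
    by (rule order_trans[OF D(2) mult_right_mono]) auto
  have w_bd: "norm (w h n) \<le> norm R * (1/2) ^ n" if h: "norm h < s" for h n
  proof -
    have "norm (w h n) \<le> norm R * (\<bar>K\<bar> * norm R * norm h) ^ n"
      unfolding w_def using norm_neumann_term[of D "\<bar>K\<bar>" R n "\<lambda>_. h", OF D']
      by (simp add: power_mult_distrib mult_ac)
    also have "\<dots> \<le> norm R * (1/2) ^ n"
    proof (intro mult_left_mono power_mono)
      have "\<bar>K\<bar> * norm R * norm h \<le> K' * (1 / (2 * K'))"
        using h by (intro mult_mono) (auto simp: K'_def s_def)
      then show "\<bar>K\<bar> * norm R * norm h \<le> 1 / 2" using K' by simp
    qed auto
    finally show ?thesis .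
  qed
  have geo: "summable (\<lambda>n. C * (1/2::real) ^ n)" for C
    by (intro summable_mult summable_geometric) simp
  have w_sum: "summable (w h)" if "norm h < s" for h
    by (rule summable_comparison_test'[OF geo w_bd[OF that]])
  have inv: "(P + D h) o\<^sub>C suminf (w h) = id_cblinfun" if h: "norm h < s" for h
  proof -
    have wl: "w h \<longlonglongrightarrow> 0" by (rule summable_LIMSEQ_zero[OF w_sum[OF h]])
    have bl: "bounded_linear (\<lambda>Z. B o\<^sub>C Z)" for B :: "'u \<Rightarrow>\<^sub>C\<^sub>L 'u"
      using bounded_linear_compose_both[of B "id_cblinfun"] by simp
    define g where "g n = P o\<^sub>C w h n" for n
    have "g \<longlonglongrightarrow> 0"
      unfolding g_def using bounded_linear.tendsto[OF bl wl, of P] by (simp add: linear_0[OF bounded_linear.linear[OF bl]])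
    \<comment> \<open>The products with \<open>P + D h\<close> telescope from
      \<open>g 0 = P o\<^sub>C R\<close> to the limit \<open>0\<close>.\<close>
    then have "(\<lambda>n. g n - g (Suc n)) sums (g 0 - 0)" by (rule telescope_sums')
    moreover have "g n - g (Suc n) = (P + D h) o\<^sub>C w h n" for n
      unfolding g_def w_def neumann_term_const_Suc
      by (simp add: cblinfun_compose_simps cblinfun_compose_assoc[symmetric] PR)
    moreover have "g 0 = id_cblinfun" by (simp add: g_def w_def PR)
    moreover have "(\<lambda>n. (P + D h) o\<^sub>C w h n) sums ((P + D h) o\<^sub>C suminf (w h))"
      by (rule bounded_linear.sums[OF bl summable_sums[OF w_sum[OF h]]])
    ultimately show ?thesis using sums_unique2 by force
  qed
  have val: "f (x + h) = (\<Sum>n. \<beta> o\<^sub>C w h n o\<^sub>C \<alpha>)" if h: "norm h < s" for h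
  proof -
    have "f (x + h) = \<beta> o\<^sub>C suminf (w h) o\<^sub>C \<alpha>" using h by (intro f inv) (auto simp: s_def)
    also have "\<dots> = (\<Sum>n. \<beta> o\<^sub>C w h n o\<^sub>C \<alpha>)"
      by (rule bounded_linear.suminf[OF bounded_linear_compose_both w_sum[OF h]])
    finally show ?thesis .
  qed
  have "uniform_limit (ball 0 s) (\<lambda>N h. \<Sum>n<N. \<beta> o\<^sub>C w h n o\<^sub>C \<alpha>) (\<lambda>h. \<Sum>n. \<beta> o\<^sub>C w h n o\<^sub>C \<alpha>) sequentially"
  proof (rule Weierstrass_m_test[OF _ geo[of "norm \<beta> * norm R * norm \<alpha>"]])
    fix n h assume "h \<in> ball (0::'a) s"
    then have "norm (w h n) \<le> norm R * (1/2) ^ n" by (intro w_bd) simp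
    from norm_cblinfun_compose_le[OF norm_cblinfun_compose_le[OF order_refl this] order_refl]
    show "norm (\<beta> o\<^sub>C w h n o\<^sub>C \<alpha>) \<le> norm \<beta> * norm R * norm \<alpha> * (1/2) ^ n"
      by (simp add: mult_ac)
  qed
  then have "uniform_limit (ball 0 s) (\<lambda>N h. \<Sum>n<N. \<beta> o\<^sub>C w h n o\<^sub>C \<alpha>) (\<lambda>h. f (x + h)) sequentially"
    by (rule uniform_limit_cong[THEN iffD1, rotated -1]) (auto simp: val)
  then show ?thesis
    unfolding analytic_at_def w_def using s homogeneous_poly_neumann[OF D, of _ \<beta> R \<alpha>]
    by (intro exI[of _ s] conjI exI[of _ "\<lambda>n h. \<beta> o\<^sub>C neumann_term R D n (\<lambda>_. h) o\<^sub>C \<alpha>"]) auto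
qed

section \<open>Maps between tensor products\<close>

lemma cblinfun2_of_bilinear:
  fixes B :: "'a::complex_normed_vector \<Rightarrow> 'b::complex_normed_vector \<Rightarrow> complex"
  assumes l: "\<And>b. clinear (\<lambda>a. B a b)" and r: "\<And>a. clinear (B a)"
    and bd: "\<And>a b. cmod (B a b) \<le> C * norm a * norm b"
  obtains \<psi> :: "'a \<Rightarrow>\<^sub>C\<^sub>L 'b \<Rightarrow>\<^sub>C\<^sub>L complex" where "\<And>a b. cblinfun_apply (cblinfun_apply \<psi> a) b = B a b"
proof -
  have "\<exists>p. \<forall>b. cblinfun_apply p b = B a b" for a
    by (rule cblinfun_of_clinear[OF r[of a] bd[of a]]) blast
  then obtain p where p: "\<And>a b. cblinfun_apply (p a) b = B a b" by metis
  have "clinear p"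
    unfolding clinear_def
    by (intro conjI allI cblinfun_eqI) (simp_all add: p cblinfun_simps clinear_add[OF l] clinear_scaleC[OF l])
  moreover have "norm (p a) \<le> \<bar>C\<bar> * norm a" for a
  proof (rule norm_cblinfun_le)
    have "C * norm a * norm b \<le> \<bar>C\<bar> * norm a * norm b" for b by (intro mult_right_mono) auto
    then show "norm (cblinfun_apply (p a) b) \<le> \<bar>C\<bar> * norm a * norm b" for b
      unfolding p using bd[of a b] order_trans by blast
  qed simp
  ultimately obtain \<psi> where "\<And>a. cblinfun_apply \<psi> a = p a" using cblinfun_of_clinear by blast
  then show ?thesis using that p by metis
qed

lemma pt_summable_map:
  assumes ab: "pt_summable a b" and f: "\<And>x. norm (f x) \<le> K * norm x" and g: "\<And>y. norm (g y) \<le> L * norm y"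
  shows "pt_summable (\<lambda>n. f (a n)) (\<lambda>n. g (b n))"
  unfolding pt_summable_def
proof (rule summable_comparison_test'[of "\<lambda>n. \<bar>K\<bar> * \<bar>L\<bar> * (norm (a n) * norm (b n))" 0])
  show "summable (\<lambda>n. \<bar>K\<bar> * \<bar>L\<bar> * (norm (a n) * norm (b n)))"
    using ab unfolding pt_summable_def by (rule summable_mult)
  fix n
  have "norm (f (a n)) \<le> \<bar>K\<bar> * norm (a n)" "norm (g (b n)) \<le> \<bar>L\<bar> * norm (b n)"
    by (rule order_trans[OF f mult_right_mono], simp_all) (rule order_trans[OF g mult_right_mono], simp_all)
  then have "norm (f (a n)) * norm (g (b n)) \<le> (\<bar>K\<bar> * norm (a n)) * (\<bar>L\<bar> * norm (b n))"
    by (intro mult_mono) auto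
  then show "norm (norm (f (a n)) * norm (g (b n))) \<le> \<bar>K\<bar> * \<bar>L\<bar> * (norm (a n) * norm (b n))"
    by (simp add: mult_ac)
qed

lemma pt_eval_tsum_map:
  assumes f: "\<And>x. norm (f x) \<le> K * norm x" and g: "\<And>y. norm (g y) \<le> L * norm y"
    and c: "bounded_linear (c :: complex \<Rightarrow> complex)" and \<psi>: "\<And>x y. cblinfun_apply (cblinfun_apply \<phi> (f x)) (g y) = c (cblinfun_apply (cblinfun_apply \<psi> x) y)"
    and ab: "pt_summable a b"
  shows "pt_eval (tsum (\<lambda>n. f (a n)) (\<lambda>n. g (b n))) \<phi> = c (pt_eval (tsum a b) \<psi>)"
  unfolding pt_eval_tsum[OF ab] pt_eval_tsum[OF pt_summable_map[OF ab f g]] \<psi>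
  by (rule bounded_linear.suminf[OF c summable_norm_cancel[OF pt_summable_norm(1)[OF ab]], symmetric])

text \<open>A tensor is its family of values on bilinear forms, so the right-hand side is
  independent of the representation as soon as every form \<open>\<phi>\<close> pulls back to a form
  \<open>\<psi>\<close>. The map \<open>c\<close> is the identity for linear pairs and
  \<open>cnj\<close> for conjugate linear ones.\<close>

lemma tensor_map_tsum:
  fixes f :: "'a::cbanach \<Rightarrow> 'c::cbanach" and g :: "'b::cbanach \<Rightarrow> 'd::cbanach"
  assumes f: "\<And>x. norm (f x) \<le> K * norm x" and g: "\<And>y. norm (g y) \<le> L * norm y"
    and c: "bounded_linear (c :: complex \<Rightarrow> complex)"
    and \<psi>: "\<And>\<phi>. \<exists>\<psi>. \<forall>x y. cblinfun_apply (cblinfun_apply \<phi> (f x)) (g y) = c (cblinfun_apply (cblinfun_apply \<psi> x) y)"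
    and ab: "pt_summable a b"
  shows "tensor_map f g (tsum a b) = tsum (\<lambda>n. f (a n)) (\<lambda>n. g (b n))"
  unfolding tensor_map_def
proof (rule the_equality)
  have wd: "tsum (\<lambda>n. f (a' n)) (\<lambda>n. g (b' n)) = tsum (\<lambda>n. f (a n)) (\<lambda>n. g (b n))"
    if "pt_summable a' b'" "tsum a b = tsum a' b'" for a' b'
  proof (rule pt_eqI)
    fix \<phi> :: "'c \<Rightarrow>\<^sub>C\<^sub>L 'd \<Rightarrow>\<^sub>C\<^sub>L complex"
    obtain \<psi> where \<psi>: "\<And>x y. cblinfun_apply (cblinfun_apply \<phi> (f x)) (g y) = c (cblinfun_apply (cblinfun_apply \<psi> x) y)"
      using \<psi> by blast
    show "pt_eval (tsum (\<lambda>n. f (a' n)) (\<lambda>n. g (b' n))) \<phi> = pt_eval (tsum (\<lambda>n. f (a n)) (\<lambda>n. g (b n))) \<phi>"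
      unfolding pt_eval_tsum_map[OF f g c \<psi> ab] pt_eval_tsum_map[OF f g c \<psi> that(1)] that(2) ..
  qed
  then show "\<forall>a' b'. pt_summable a' b' \<and> tsum a b = tsum a' b' \<longrightarrow>
      tsum (\<lambda>n. f (a n)) (\<lambda>n. g (b n)) = tsum (\<lambda>n. f (a' n)) (\<lambda>n. g (b' n))"
    by auto
  show "v = tsum (\<lambda>n. f (a n)) (\<lambda>n. g (b n))"
    if "\<forall>a' b'. pt_summable a' b' \<and> tsum a b = tsum a' b' \<longrightarrow> v = tsum (\<lambda>n. f (a' n)) (\<lambda>n. g (b' n))" for v
    using that ab by blast
qed

text \<open>Since \<open>\<psi>\<close> does not depend on \<open>u\<close>, additivity and
  homogeneity of the induced maps reduce to those of evaluation.\<close>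

lemma pt_eval_tensor_map:
  fixes f :: "'a::cbanach \<Rightarrow> 'c::cbanach" and g :: "'b::cbanach \<Rightarrow> 'd::cbanach"
  assumes f: "\<And>x. norm (f x) \<le> K * norm x" and g: "\<And>y. norm (g y) \<le> L * norm y"
    and c: "bounded_linear (c :: complex \<Rightarrow> complex)"
    and ex: "\<And>\<phi>. \<exists>\<psi>. \<forall>x y. cblinfun_apply (cblinfun_apply \<phi> (f x)) (g y) = c (cblinfun_apply (cblinfun_apply \<psi> x) y)"
  shows "\<exists>\<psi>. \<forall>u. pt_eval (tensor_map f g u) \<phi> = c (pt_eval u \<psi>)"
proof -
  obtain \<psi> where \<psi>: "\<And>x y. cblinfun_apply (cblinfun_apply \<phi> (f x)) (g y) = c (cblinfun_apply (cblinfun_apply \<psi> x) y)"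
    using ex by blast
  have "pt_eval (tensor_map f g u) \<phi> = c (pt_eval u \<psi>)" for u
  proof (rule pt_cases[of u])
    fix a b assume ab: "pt_summable a b" "u = tsum a b"
    show ?thesis
      unfolding ab(2) tensor_map_tsum[OF f g c ex ab(1)] by (rule pt_eval_tsum_map[OF f g c \<psi> ab(1)])
  qed
  then show ?thesis by blast
qed

context
  fixes W V :: "'p::chilbert \<Rightarrow>\<^sub>C\<^sub>L 'r::chilbert"
begin

lemma sandwich_bound: "norm (W\<^sup>\<dagger> o\<^sub>C B o\<^sub>C V) \<le> norm W * norm V * norm B"
  using norm_cblinfun_compose_le[OF norm_cblinfun_compose_le[OF norm_adj[of W] order_refl] order_refl, of B V]
  by (simp add: mult_ac)

lemma sandwich_dual:
  fixes \<phi> :: "'a::cbanach \<Rightarrow>\<^sub>C\<^sub>L ('p \<Rightarrow>\<^sub>C\<^sub>L 'p) \<Rightarrow>\<^sub>C\<^sub>L complex"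
  shows "\<exists>\<psi>. \<forall>x y. cblinfun_apply (cblinfun_apply \<phi> x) (W\<^sup>\<dagger> o\<^sub>C y o\<^sub>C V) = cblinfun_apply (cblinfun_apply \<psi> x) y"
proof -
  have "cmod (cblinfun_apply (cblinfun_apply \<phi> x) (W\<^sup>\<dagger> o\<^sub>C y o\<^sub>C V)) \<le> (norm \<phi> * (norm W * norm V)) * norm x * norm y" for x y
    using order_trans[OF norm_cblinfun2[of \<phi> x "W\<^sup>\<dagger> o\<^sub>C y o\<^sub>C V"] mult_left_mono[OF mult_left_mono[OF sandwich_bound]]]
    by (simp add: mult_ac)
  then obtain \<psi> where "\<And>x y. cblinfun_apply (cblinfun_apply \<psi> x) y = cblinfun_apply (cblinfun_apply \<phi> x) (W\<^sup>\<dagger> o\<^sub>C y o\<^sub>C V)"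
    by (rule cblinfun2_of_bilinear[rotated 2])
      (auto simp: clinear_def cblinfun_right_simps cblinfun_simps cblinfun_compose_simps)
  then show ?thesis by (intro exI[of _ \<psi>]) simp
qed

lemma sandwich_tsum:
  "pt_summable a b \<Longrightarrow> sandwich W V (tsum a b) = tsum a (\<lambda>n. W\<^sup>\<dagger> o\<^sub>C b n o\<^sub>C V)"
  unfolding sandwich_def
  by (rule tensor_map_tsum[of _ 1 _ "norm W * norm V" "\<lambda>x. x"])
    (auto intro: sandwich_bound bounded_linear_ident sandwich_dual)

lemma sandwich_summable: "pt_summable a b \<Longrightarrow> pt_summable a (\<lambda>n. W\<^sup>\<dagger> o\<^sub>C b n o\<^sub>C V)"
  by (rule pt_summable_map[of a b "\<lambda>x. x" 1, OF _ _ sandwich_bound]) auto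

lemma pt_eval_sandwich: "\<exists>\<psi>. \<forall>X. pt_eval (sandwich W V X) \<phi> = pt_eval X \<psi>"
  unfolding sandwich_def
  by (rule pt_eval_tensor_map[of _ 1 _ "norm W * norm V" "\<lambda>x. x"])
    (auto intro: sandwich_bound bounded_linear_ident sandwich_dual)

lemma sandwich_clinear: "clinear (sandwich W V)"
  unfolding clinear_def
proof (intro conjI allI pt_eqI)
  fix X Y c \<phi>
  obtain \<psi> where \<psi>: "\<And>X. pt_eval (sandwich W V X) \<phi> = pt_eval X \<psi>" using pt_eval_sandwich by blast
  show "pt_eval (sandwich W V (X + Y)) \<phi> = pt_eval (sandwich W V X + sandwich W V Y) \<phi>"
    by (simp add: pt_eval_plus \<psi>)
  obtain \<psi> where \<psi>: "\<And>X. pt_eval (sandwich W V X) \<phi> = pt_eval X \<psi>" using pt_eval_sandwich by blast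
  show "pt_eval (sandwich W V (c *\<^sub>C X)) \<phi> = pt_eval (c *\<^sub>C sandwich W V X) \<phi>"
    by (simp add: pt_eval_scaleC \<psi>)
qed

lemma functional_sandwich_sums:
  assumes "pt_summable a b"
  shows "(\<lambda>n. cblinfun_apply (cblinfun_apply \<phi> (a n)) (W\<^sup>\<dagger> o\<^sub>C b n o\<^sub>C V)) sums functional_of \<phi> (sandwich W V (tsum a b))"
  unfolding functional_of_def sandwich_tsum[OF assms] pt_eval_tsum[OF sandwich_summable[OF assms]]
  by (rule summable_sums[OF summable_norm_cancel[OF pt_summable_norm(1)[OF sandwich_summable[OF assms]]]])

end

lemma functional_sandwich_simps:
  "functional_of \<phi> (sandwich (W + W') V X) = functional_of \<phi> (sandwich W V X) + functional_of \<phi> (sandwich W' V X)"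
  "functional_of \<phi> (sandwich W (V + V') X) = functional_of \<phi> (sandwich W V X) + functional_of \<phi> (sandwich W V' X)"
  "functional_of \<phi> (sandwich (c *\<^sub>C W) V X) = cnj c * functional_of \<phi> (sandwich W V X)"
  "functional_of \<phi> (sandwich W (c *\<^sub>C V) X) = c * functional_of \<phi> (sandwich W V X)"
proof -
  obtain a b where ab: "pt_summable a b" and X: "X = tsum a b" by (metis pt_cases)
  note s = functional_sandwich_sums[OF ab, of \<phi>]
  note simps = adj_add adj_scaleC cblinfun_compose_simps cblinfun_right_simps
  show "functional_of \<phi> (sandwich (W + W') V X) = functional_of \<phi> (sandwich W V X) + functional_of \<phi> (sandwich W' V X)"
    unfolding X by (rule sums_unique2[OF s]) (use sums_add[OF s[of W V] s[of W' V]] in \<open>simp add: simps\<close>)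
  show "functional_of \<phi> (sandwich W (V + V') X) = functional_of \<phi> (sandwich W V X) + functional_of \<phi> (sandwich W V' X)"
    unfolding X by (rule sums_unique2[OF s]) (use sums_add[OF s[of W V] s[of W V']] in \<open>simp add: simps\<close>)
  show "functional_of \<phi> (sandwich (c *\<^sub>C W) V X) = cnj c * functional_of \<phi> (sandwich W V X)"
    unfolding X by (rule sums_unique2[OF s])
      (use sums_mult[OF s[of W V], of "cnj c"] in \<open>simp add: simps scaleC_complex_def\<close>)
  show "functional_of \<phi> (sandwich W (c *\<^sub>C V) X) = c * functional_of \<phi> (sandwich W V X)"
    unfolding X by (rule sums_unique2[OF s])
      (use sums_mult[OF s[of W V], of c] in \<open>simp add: simps scaleC_complex_def\<close>)
qed

lemma sandwich_sandwich: "sandwich W V (sandwich U U' X) = sandwich (U o\<^sub>C W) (U' o\<^sub>C V) X"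
proof -
  obtain a b where ab: "pt_summable a b" and X: "X = tsum a b" by (metis pt_cases)
  show ?thesis
    unfolding X sandwich_tsum[OF ab] sandwich_tsum[OF sandwich_summable[OF ab]]
    by (simp add: adj_compose cblinfun_compose_assoc)
qed

section \<open>The involution on tensors\<close>

context
  fixes star :: "'a::cbanach \<Rightarrow> 'a"
  assumes star: "banach_involution star"
begin

text \<open>\<open>star\<close> and the adjoint are both conjugate linear, so conjugating the pulled
  back form makes it bilinear again.\<close>

lemma tensor_star_dual:
  fixes \<phi> :: "'a \<Rightarrow>\<^sub>C\<^sub>L ('e::chilbert \<Rightarrow>\<^sub>C\<^sub>L 'e) \<Rightarrow>\<^sub>C\<^sub>L complex"
  shows "\<exists>\<psi>. \<forall>x y. cblinfun_apply (cblinfun_apply \<phi> (star x)) (y\<^sup>\<dagger>) = cnj (cblinfun_apply (cblinfun_apply \<psi> x) y)"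
proof -
  obtain K where K: "\<And>a. norm (star a) \<le> K * norm a" using star by (auto simp: banach_involution_def)
  have "cmod (cnj (cblinfun_apply (cblinfun_apply \<phi> (star x)) (y\<^sup>\<dagger>))) \<le> (norm \<phi> * \<bar>K\<bar>) * norm x * norm y" for x y
  proof -
    have "norm (star x) \<le> \<bar>K\<bar> * norm x" by (rule order_trans[OF K mult_right_mono]) auto
    then have "norm (star x) * norm (y\<^sup>\<dagger>) \<le> (\<bar>K\<bar> * norm x) * norm y"
      by (intro mult_mono norm_adj) auto
    then have "norm \<phi> * (norm (star x) * norm (y\<^sup>\<dagger>)) \<le> norm \<phi> * ((\<bar>K\<bar> * norm x) * norm y)"
      by (rule mult_left_mono) simp
    then show ?thesis using norm_cblinfun2[of \<phi> "star x" "y\<^sup>\<dagger>"] by (simp add: mult_ac)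
  qed
  then obtain \<psi> where "\<And>x y. cblinfun_apply (cblinfun_apply \<psi> x) y = cnj (cblinfun_apply (cblinfun_apply \<phi> (star x)) (y\<^sup>\<dagger>))"
    by (rule cblinfun2_of_bilinear[rotated 2])
      (use star in \<open>auto simp: clinear_def banach_involution_def cblinfun_right_simps cblinfun_simps
        adj_add adj_scaleC scaleC_complex_def\<close>)
  then show ?thesis by (intro exI[of _ \<psi>]) simp
qed

lemma tensor_star_tsum:
  "pt_summable a b \<Longrightarrow> tensor_star star (tsum a b) = tsum (\<lambda>n. star (a n)) (\<lambda>n. (b n)\<^sup>\<dagger>)"
  "pt_summable a b \<Longrightarrow> pt_summable (\<lambda>n. star (a n)) (\<lambda>n. (b n)\<^sup>\<dagger>)"
proof -
  obtain K where K: "\<And>a. norm (star a) \<le> K * norm a" using star by (auto simp: banach_involution_def)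
  have L: "norm (y\<^sup>\<dagger>) \<le> 1 * norm y" for y by (simp add: norm_adj)
  show "pt_summable a b \<Longrightarrow> tensor_star star (tsum a b) = tsum (\<lambda>n. star (a n)) (\<lambda>n. (b n)\<^sup>\<dagger>)"
    unfolding tensor_star_def by (rule tensor_map_tsum[OF K L bounded_linear_cnj tensor_star_dual])
  show "pt_summable a b \<Longrightarrow> pt_summable (\<lambda>n. star (a n)) (\<lambda>n. (b n)\<^sup>\<dagger>)"
    by (rule pt_summable_map[OF _ K L])
qed

lemma tensor_star_add:
  fixes X Y :: "('a, 'e::chilbert \<Rightarrow>\<^sub>C\<^sub>L 'e) ptensor"
  shows "tensor_star star (X + Y) = tensor_star star X + tensor_star star Y"
proof (rule pt_eqI)
  fix \<phi> :: "'a \<Rightarrow>\<^sub>C\<^sub>L ('e \<Rightarrow>\<^sub>C\<^sub>L 'e) \<Rightarrow>\<^sub>C\<^sub>L complex"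
  obtain K where K: "\<And>a. norm (star a) \<le> K * norm a" using star by (auto simp: banach_involution_def)
  have L: "norm (y\<^sup>\<dagger>) \<le> 1 * norm y" for y by (simp add: norm_adj)
  obtain \<psi> where "\<And>X :: ('a, 'e \<Rightarrow>\<^sub>C\<^sub>L 'e) ptensor. pt_eval (tensor_star star X) \<phi> = cnj (pt_eval X \<psi>)"
    using pt_eval_tensor_map[OF K L bounded_linear_cnj tensor_star_dual, of \<phi>] unfolding tensor_star_def by blast
  then show "pt_eval (tensor_star star (X + Y)) \<phi> = pt_eval (tensor_star star X + tensor_star star Y) \<phi>"
    by (simp add: pt_eval_plus)
qed

lemma tensor_star_sandwich: "tensor_star star (sandwich W V X) = sandwich V W (tensor_star star X)"
proof -
  obtain a b where ab: "pt_summable a b" and X: "X = tsum a b" by (metis pt_cases)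
  show ?thesis
    unfolding X sandwich_tsum[OF ab] tensor_star_tsum[OF ab] tensor_star_tsum(1)[OF sandwich_summable[OF ab]]
      sandwich_tsum[OF tensor_star_tsum(2)[OF ab]]
    by (simp add: adj_compose cblinfun_compose_assoc)
qed

lemma functional_sandwich_star:
  assumes "selfadjoint_functional star \<Lambda>"
  shows "functional_of \<Lambda> (sandwich W V (tensor_star star X)) = cnj (functional_of \<Lambda> (sandwich V W X))"
  using assms unfolding selfadjoint_functional_def tensor_star_sandwich[symmetric] by blast

text \<open>The involution exchanges \<open>W\<close> and \<open>V\<close>, so the real part of a
  tensor becomes the Hermitian part of its form.\<close>

lemma functional_sandwich_re_part:
  assumes "selfadjoint_functional star \<Lambda>"
  shows "functional_of \<Lambda> (sandwich W V (re_part star X))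
    = (functional_of \<Lambda> (sandwich W V X) + cnj (functional_of \<Lambda> (sandwich V W X))) / 2"
  unfolding re_part_def clinear_scaleR[OF sandwich_clinear] clinear_add[OF sandwich_clinear]
  using functional_sandwich_star[OF assms]
  by (simp add: functional_of_def pt_eval_plus scaleR_scaleC pt_eval_scaleC scaleC_complex_def)

end

section \<open>Direct sums of tensors\<close>

lift_definition fst_cblinfun :: "('e::complex_normed_vector \<times> 'k::complex_normed_vector) \<Rightarrow>\<^sub>C\<^sub>L 'e" is fst
  by (simp add: bounded_clinear_def bounded_linear_fst scaleC_prod_def)

lift_definition snd_cblinfun :: "('e::complex_normed_vector \<times> 'k::complex_normed_vector) \<Rightarrow>\<^sub>C\<^sub>L 'k" is snd
  by (simp add: bounded_clinear_def bounded_linear_snd scaleC_prod_def)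

lift_definition inl_cblinfun :: "'e::complex_normed_vector \<Rightarrow>\<^sub>C\<^sub>L ('e \<times> 'k::complex_normed_vector)" is "\<lambda>x. (x, 0)"
  by (auto simp: bounded_clinear_def scaleC_prod_def intro!: bounded_linear_Pair bounded_linear_ident bounded_linear_zero)

lift_definition inr_cblinfun :: "'k::complex_normed_vector \<Rightarrow>\<^sub>C\<^sub>L ('e::complex_normed_vector \<times> 'k)" is "\<lambda>x. (0, x)"
  by (auto simp: bounded_clinear_def scaleC_prod_def intro!: bounded_linear_Pair bounded_linear_ident bounded_linear_zero)

lemmas prod_cblinfun_apply [simp] = fst_cblinfun.rep_eq snd_cblinfun.rep_eq inl_cblinfun.rep_eq inr_cblinfun.rep_eq

lemma adj_fst: "fst_cblinfun\<^sup>\<dagger> = inl_cblinfun"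
  by (rule adj_eqI) (simp add: cinner_prod_def)

lemma adj_snd: "snd_cblinfun\<^sup>\<dagger> = inr_cblinfun"
  by (rule adj_eqI) (simp add: cinner_prod_def)

text \<open>The adjoints of the coordinate projections are the inclusions, so the extension of an
  operator by zero is a sandwich, and direct sums fall under the calculus of sandwiches.\<close>

lemma tensor_dsum_eq:
  fixes X :: "('a::cbanach, 'e::chilbert \<Rightarrow>\<^sub>C\<^sub>L 'e) ptensor" and Y :: "('a, 'k::chilbert \<Rightarrow>\<^sub>C\<^sub>L 'k) ptensor"
  shows "X \<oplus>\<^sub>t Y = sandwich fst_cblinfun fst_cblinfun X + sandwich snd_cblinfun snd_cblinfun Y"
proof -
  have "(\<lambda>B :: 'e \<Rightarrow>\<^sub>C\<^sub>L 'e. B \<oplus>\<^sub>o\<^sub>p (0 :: 'k \<Rightarrow>\<^sub>C\<^sub>L 'k)) = (\<lambda>B. fst_cblinfun\<^sup>\<dagger> o\<^sub>C B o\<^sub>C fst_cblinfun)"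
    "(\<lambda>C :: 'k \<Rightarrow>\<^sub>C\<^sub>L 'k. (0 :: 'e \<Rightarrow>\<^sub>C\<^sub>L 'e) \<oplus>\<^sub>o\<^sub>p C) = (\<lambda>C. snd_cblinfun\<^sup>\<dagger> o\<^sub>C C o\<^sub>C snd_cblinfun)"
    unfolding adj_fst adj_snd
    by (rule ext, rule cblinfun_eqI, simp add: op_dsum_apply cblinfun_simps)+
  then show ?thesis by (simp only: tensor_dsum_def sandwich_def)
qed

lemma functional_sandwich_dsum:
  "functional_of \<phi> (sandwich W V (X \<oplus>\<^sub>t Y))
    = functional_of \<phi> (sandwich (fst_cblinfun o\<^sub>C W) (fst_cblinfun o\<^sub>C V) X)
    + functional_of \<phi> (sandwich (snd_cblinfun o\<^sub>C W) (snd_cblinfun o\<^sub>C V) Y)"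
  unfolding tensor_dsum_eq clinear_add[OF sandwich_clinear] sandwich_sandwich
  by (simp add: functional_of_def pt_eval_plus)

lemma tensor_star_dsum:
  assumes "banach_involution star"
  shows "tensor_star star (X \<oplus>\<^sub>t Y) = tensor_star star X \<oplus>\<^sub>t tensor_star star Y"
  unfolding tensor_dsum_eq tensor_star_add[OF assms] tensor_star_sandwich[OF assms] ..

section \<open>The operators \<open>L(X)\<close> and their Schur complements\<close>

lemma adj_rank1: "(rank1 w e)\<^sup>\<dagger> = rank1 e w"
  by (rule adj_eqI) (simp add: rank1.rep_eq cinner_simps cinner_commute[of _ w] mult.commute cinner_commute[of _ e])

lemma rank1_clinear: "clinear (\<lambda>w. rank1 w e)"
  unfolding clinear_def
  by (intro conjI allI cblinfun_eqI) (simp_all add: rank1.rep_eq cblinfun_simps scaleC_add_right scaleC_scaleC mult.commute)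

lemma compose_rank1: "U o\<^sub>C rank1 w e = rank1 (cblinfun_apply U w) e"
  by (rule cblinfun_eqI) (simp add: rank1.rep_eq cblinfun_right_simps)

lemma rank1_compose_rank1: "rank1 e v o\<^sub>C rank1 w e = cinner v w *\<^sub>C rank1 e e"
  by (rule cblinfun_eqI) (simp add: rank1.rep_eq cblinfun_simps cblinfun_right_simps scaleC_scaleC cinner_simps mult.commute)

text \<open>With \<open>R\<close> the inverse of \<open>Z\<close>, the pairing of \<open>R x\<close>
  with \<open>Z x\<close> is \<open>(norm x)\<^sup>2\<close>, so Cauchy-Schwarz for the form of
  \<open>Z\<close> bounds \<open>norm x ^ 4\<close> by \<open>norm R * (norm x)\<^sup>2\<close>
  times the form at \<open>x\<close>. The constant \<open>1 / (norm R + 1)\<close> is positive even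
  if \<open>R = 0\<close>.\<close>

lemma positive_invertible_coercive:
  fixes M :: "'x::chilbert set"
  assumes M: "closed M" "csubspace M" and Z: "Z \<in> ops_on M" and pos: "positive_op Z"
    and inv: "invertible_on M Z"
  shows "\<exists>c. coercive_on M c Z"
proof -
  define R where "R = inverse_on M Z"
  have "(norm x)\<^sup>2 \<le> (norm R + 1) * Re (cinner x (Z x))" if x: "x \<in> M" for x
  proof (cases "x = 0")
    case False
    let ?a = "Re (cinner x (Z x))"
    have ZR: "Z (R x) = x" using inverse_on_props(2)[OF M inv Z] proj_on_fixes[OF M x] by (simp add: R_def)
    have "cinner (R x) (Z x) = cinner (Z (R x)) x"
      using pos by (metis cinner_adj_left positive_op_iff)
    then have "cinner (R x) (Z x) = complex_of_real ((norm x)\<^sup>2)" by (simp add: ZR cinner_self)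
    then have "((norm x)\<^sup>2)\<^sup>2 \<le> Re (cinner (R x) (Z (R x))) * ?a"
      using positive_op_Cauchy_Schwarz[OF pos, of "R x" x] by (simp add: norm_power)
    also have "Re (cinner (R x) (Z (R x))) \<le> norm (R x) * norm x"
      unfolding ZR by (rule order_trans[OF complex_Re_le_cmod cinner_Cauchy_Schwarz])
    also have "norm (R x) * norm x \<le> norm R * norm x * norm x"
      by (intro mult_right_mono norm_cblinfun) simp
    finally have "((norm x)\<^sup>2)\<^sup>2 \<le> norm R * norm x * norm x * ?a"
      using pos by (simp add: positive_op_iff mult_right_mono)
    then have "(norm x)\<^sup>2 * (norm x)\<^sup>2 \<le> (norm x)\<^sup>2 * (norm R * ?a)"
      by (simp add: power2_eq_square mult_ac)
    then have "(norm x)\<^sup>2 \<le> norm R * ?a" by (rule mult_left_le_imp_le) (use False in simp)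
    also have "\<dots> \<le> (norm R + 1) * ?a" using pos by (intro mult_right_mono) (auto simp: positive_op_iff)
    finally show ?thesis .
  qed simp
  moreover have "0 < norm R + 1" by (simp add: add_nonneg_pos)
  ultimately have "coercive_on M (1 / (norm R + 1)) Z"
    by (simp add: coercive_on_def field_simps)
  then show ?thesis by blast
qed

section \<open>The Schur complement as a corner of an inverse pencil\<close>

context subspace_pair
begin

text \<open>
  \<open>pencil Z (x, r) = (s, 0)\<close> says that \<open>x\<close> is the stationary point of the form of \<open>Z\<close> on \<open>s + S'\<close>
  and that \<open>r\<close> is the \<open>S\<close>-component of \<open>Z x\<close>; storing \<open>r\<close> as an unknown keeps the pencil affine in \<open>Z\<close>.
\<close>

definition pencil :: "('x \<Rightarrow>\<^sub>C\<^sub>L 'x) \<Rightarrow> ('x \<times> 'x) \<Rightarrow>\<^sub>C\<^sub>L ('x \<times> 'x)"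
  where "pencil Z = inl_cblinfun o\<^sub>C (P1 + P2 o\<^sub>C Z + (id_cblinfun - proj_on M)) o\<^sub>C fst_cblinfun
    + inr_cblinfun o\<^sub>C (snd_cblinfun - P1 o\<^sub>C Z o\<^sub>C fst_cblinfun)"

lemma pencil_apply:
  "cblinfun_apply (pencil Z) (x, r) = (P1 x + P2 (Z x) + (x - proj_on M x), r - P1 (Z x))"
  by (simp add: pencil_def cblinfun_simps)

lemma P_compl: "P1 (x - proj_on M x) = 0" "P2 (x - proj_on M x) = 0"
  by (simp_all add: proj_split cblinfun_right_simps)

text \<open>Projecting the first row to \<open>S\<close> and \<open>S'\<close> gives
  \<open>P1 x = s\<close> and \<open>P2 (Z x) = 0\<close>, and then nothing is left outside
  \<open>M\<close>. So \<open>x\<close> is the stationary point, where \<open>Z x\<close> equals the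
  Schur complement at \<open>s\<close>.\<close>

lemma pencil_solution:
  assumes Z: "Z \<in> ops_on M" and inv: "invertible_on S' (Z22 Z)" and s: "s \<in> S"
    and eq: "cblinfun_apply (pencil Z) p = (s, 0)"
  shows "snd p = schur Z s"
proof -
  note R = inverse_on_props[OF S' inv Z22_ops_on]
  obtain x r where p: "p = (x, r)" by (cases p)
  have e1: "P1 x + P2 (Z x) + (x - proj_on M x) = s" and e2: "r = P1 (Z x)"
    using eq by (simp_all add: p pencil_apply)
  have "P1 (P1 x + P2 (Z x) + (x - proj_on M x)) = P1 x"
    unfolding cblinfun_add_right P_compl by simp
  then have x1: "P1 x = s" using e1 s by simp
  have "P2 (P1 x + P2 (Z x) + (x - proj_on M x)) = P2 (Z x)"
    unfolding cblinfun_add_right P_compl by simp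
  then have x2: "P2 (Z x) = 0" using e1 s by simp
  have x: "x = s + P2 x" using e1 x1 x2 proj_split[of x] by (simp add: algebra_simps)
  have "Z22 Z x = P2 (Z (x - s))" using x by (simp add: Z22_def) (metis add_diff_cancel_left')
  also have "\<dots> = - P2 (Z s)" by (simp add: cblinfun_right_simps x2)
  finally have "inverse_on S' (Z22 Z) (Z22 Z x) = - inverse_on S' (Z22 Z) (P2 (Z s))"
    by (simp add: cblinfun_right_simps)
  then have "x = schur_point Z s" using x unfolding R(3) schur_point_def by simp
  then have "Z x = schur Z s" "schur Z s \<in> S" using schur_point[OF Z inv s] by auto
  then show ?thesis using e2 by (simp add: p)
qed

text \<open>The pencil is block triangular: its first row determines \<open>x\<close>, and
  \<open>r\<close> is then read off the second. The summand \<open>x - proj_on M x\<close> takes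
  care of the part of the ambient space outside \<open>M\<close>.\<close>

lemma pencil_right_inverse:
  assumes inv: "invertible_on S' (Z22 Z)"
  shows "\<exists>R. pencil Z o\<^sub>C R = id_cblinfun"
proof -
  note R = inverse_on_props[OF S' inv Z22_ops_on]
  define R0 where "R0 = inverse_on S' (Z22 Z)"
  have R0: "R0 x \<in> S'" for x using R(1) by (auto simp: R0_def ops_on_def)
  \<comment> \<open>Solution of the first row: \<open>P1 a\<close> and the part of \<open>a\<close>
    outside \<open>M\<close> are kept, and the \<open>S'\<close> component solves
    \<open>P2 (Z x) = P2 a\<close> through the inverse \<open>R0\<close> of
    \<open>Z22 Z\<close>.\<close>
  define K where "K = P1 + R0 - R0 o\<^sub>C Z o\<^sub>C (P1 + (id_cblinfun - proj_on M)) + (id_cblinfun - proj_on M)"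
  define R' where "R' = inl_cblinfun o\<^sub>C K o\<^sub>C fst_cblinfun
    + inr_cblinfun o\<^sub>C (snd_cblinfun + P1 o\<^sub>C Z o\<^sub>C K o\<^sub>C fst_cblinfun)"
  have P2ZR: "P2 (Z (R0 y)) = P2 y" for y
  proof -
    have "P2 (Z (R0 y)) = Z22 Z (R0 y)" using R0[of y] by (simp add: Z22_def)
    then show ?thesis by (simp add: R0_def R(2))
  qed
  have "pencil Z (R' (a, b)) = (a, b)" for a b
  proof -
    define u where "u = a - proj_on M a"
    have u: "P1 u = 0" "P2 u = 0" by (simp_all add: u_def P_compl)
    have Ka: "K a = P1 a + R0 a - R0 (Z (P1 a + u)) + u"
      by (simp add: K_def cblinfun_simps u_def)
    have r0: "P1 (R0 y) = 0" "P2 (R0 y) = R0 y" for y using R0[of y] by auto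
    have 1: "P1 (K a) = P1 a" by (simp add: Ka cblinfun_right_simps r0 u)
    have 2: "P2 (Z (K a)) = P2 a" by (simp add: Ka cblinfun_right_simps P2ZR)
    have 3: "K a - proj_on M (K a) = u"
      unfolding proj_split by (simp add: Ka cblinfun_right_simps r0 u)
    have "P1 a + P2 a + u = a" unfolding u_def proj_split by simp
    then show ?thesis
      by (simp add: R'_def cblinfun_simps pencil_apply 1 2 3)
  qed
  then have "pencil Z o\<^sub>C R' = id_cblinfun"
    by (intro cblinfun_eqI) (simp add: split_paired_all)
  then show ?thesis by blast
qed

lemma pencil_add: "pencil (Z + N) = pencil Z + (inl_cblinfun o\<^sub>C P2 - inr_cblinfun o\<^sub>C P1) o\<^sub>C N o\<^sub>C fst_cblinfun"
  by (rule cblinfun_eqI) (simp add: split_paired_all pencil_apply cblinfun_simps cblinfun_right_simps)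

text \<open>If \<open>norm (N h) \<le> c / 2\<close>, the form of \<open>Z + N h\<close> keeps the
  lower bound \<open>c / 2\<close>, so the formula for \<open>f\<close> is available on a whole
  ball. There the pencil differs from \<open>pencil Z\<close> by a term linear in \<open>h\<close>,
  and its solutions carry the Schur complement in the second coordinate.\<close>

lemma analytic_schur:
  fixes f :: "'a::complex_normed_vector \<Rightarrow> ('e::chilbert \<Rightarrow>\<^sub>C\<^sub>L 'e)" and J :: "'e \<Rightarrow>\<^sub>C\<^sub>L 'x"
  assumes Z: "Z \<in> ops_on M" and co: "coercive_on M c Z" and J: "\<And>v. cblinfun_apply J v \<in> S"
    and N: "clinear N" "\<And>h. norm (N h) \<le> K * norm h" "\<And>h. N h \<in> ops_on M"
    and f: "\<And>h. invertible_on S' (Z22 (Z + N h)) \<Longrightarrow> f (x + h) = J\<^sup>\<dagger> o\<^sub>C schur (Z + N h) o\<^sub>C J"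
  shows "analytic_at f x"
proof -
  let ?B = "inl_cblinfun o\<^sub>C P2 - inr_cblinfun o\<^sub>C P1"
  let ?f = "fst_cblinfun :: ('x \<times> 'x) \<Rightarrow>\<^sub>C\<^sub>L 'x"
  obtain R where R: "pencil Z o\<^sub>C R = id_cblinfun"
    using pencil_right_inverse[OF coercive_Z22[OF co]] by blast
  \<comment> \<open>The summand \<open>1\<close> keeps the radius \<open>c / (2 * K')\<close>
    positive when \<open>K = 0\<close>; below this radius
    \<open>norm (N h) \<le> c / 2\<close>.\<close>
  define K' where "K' = \<bar>K\<bar> + 1"
  have K': "0 < K'" by (simp add: K'_def)
  have c: "0 < c" using co by (simp add: coercive_on_def)
  show ?thesis
  proof (rule analytic_at_pencil[where D = "\<lambda>h. ?B o\<^sub>C N h o\<^sub>C ?f" and P = "pencil Z" and R = R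
        and r = "c / (2 * K')" and \<beta> = "J\<^sup>\<dagger> o\<^sub>C snd_cblinfun" and \<alpha> = "inl_cblinfun o\<^sub>C J"
        and K = "norm ?B * K * norm ?f", OF _ _ R])
    show "clinear (\<lambda>h. ?B o\<^sub>C N h o\<^sub>C ?f)"
      by (simp add: clinear_def clinear_add[OF N(1)] clinear_scaleC[OF N(1)] cblinfun_compose_simps scaleC_diff_right)
    show "norm (?B o\<^sub>C N h o\<^sub>C ?f) \<le> norm ?B * K * norm ?f * norm h" for h
      using norm_cblinfun_compose_le[OF norm_cblinfun_compose_le[OF order_refl N(2)] order_refl, of ?B h ?f]
      by (simp add: mult_ac)
    show "0 < c / (2 * K')" using c K' by simp
    fix h Q assume h: "norm h < c / (2 * K')" and Q: "(pencil Z + ?B o\<^sub>C N h o\<^sub>C ?f) o\<^sub>C Q = id_cblinfun"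
    have Nh: "norm (N h) \<le> c / 2"
    proof -
      have "norm (N h) \<le> K' * norm h"
        by (rule order_trans[OF N(2) mult_right_mono]) (auto simp: K'_def)
      also have "\<dots> \<le> K' * (c / (2 * K'))" using h K' by (intro mult_left_mono) auto
      also have "\<dots> = c / 2" using K' by simp
      finally show ?thesis .
    qed
    have co': "coercive_on M (c / 2) (Z + N h)"
      unfolding coercive_on_def
    proof (intro conjI ballI)
      fix x assume x: "x \<in> M"
      have "\<bar>Re (cinner x (N h x))\<bar> \<le> norm x * norm (N h x)"
        by (rule order_trans[OF abs_Re_le_cmod cinner_Cauchy_Schwarz])
      also have "\<dots> \<le> norm x * (c / 2 * norm x)"
        by (intro mult_left_mono order_trans[OF norm_cblinfun mult_right_mono[OF Nh]]) auto
      finally have "\<bar>Re (cinner x (N h x))\<bar> \<le> c / 2 * (norm x)\<^sup>2" by (simp add: power2_eq_square mult_ac)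
      moreover have "c * (norm x)\<^sup>2 \<le> Re (cinner x (Z x))" using co x by (simp add: coercive_on_def)
      ultimately show "c / 2 * (norm x)\<^sup>2 \<le> Re (cinner x ((Z + N h) x))"
        by (simp add: cblinfun_simps cinner_simps)
    qed (use c in simp)
    have inv: "invertible_on S' (Z22 (Z + N h))" by (rule coercive_Z22[OF co'])
    have ZN: "Z + N h \<in> ops_on M"
      using Z N(3)[of h] csubspace_add[OF M(2)] by (simp add: ops_on_def cblinfun_simps)
    show "f (x + h) = J\<^sup>\<dagger> o\<^sub>C snd_cblinfun o\<^sub>C Q o\<^sub>C (inl_cblinfun o\<^sub>C J)"
      unfolding f[OF inv]
    proof (rule cblinfun_eqI)
      fix v
      have "pencil (Z + N h) (Q (J v, 0)) = (J v, 0)"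
        using arg_cong[OF Q, of "\<lambda>A. cblinfun_apply A (J v, 0)"] by (simp add: pencil_add)
      then show "(J\<^sup>\<dagger> o\<^sub>C schur (Z + N h) o\<^sub>C J) v = (J\<^sup>\<dagger> o\<^sub>C snd_cblinfun o\<^sub>C Q o\<^sub>C (inl_cblinfun o\<^sub>C J)) v"
        using pencil_solution[OF ZN inv J] by simp
    qed
  qed
qed

end

section \<open>Realisations of the completion and the operators on them\<close>

lemma realises_completion_clinear: "realises_completion T q \<Longrightarrow> clinear q"
  by (simp add: realises_completion_def clinear_def)

lemma realises_completion_cinner: "realises_completion T q \<Longrightarrow> cinner (q W) (q V) = cblinfun_apply T (W\<^sup>\<dagger> o\<^sub>C V)"
  by (simp add: realises_completion_def)

text \<open>The inner product of \<open>v e\<^sup>*\<close> and \<open>w e\<^sup>*\<close> is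
  \<open>cinner v w * \<tau>\<close>, so the embedding is a multiple of an isometry. Its image is
  complete if \<open>\<tau> \<noteq> 0\<close> and \<open>{0}\<close> otherwise, hence closed in
  either case.\<close>

lemma rank1_embedding:
  fixes q :: "('h::chilbert \<Rightarrow>\<^sub>C\<^sub>L 'e::chilbert) \<Rightarrow> 'x::chilbert"
  assumes q: "realises_completion T q"
  obtains J :: "'e \<Rightarrow>\<^sub>C\<^sub>L 'x" where "\<And>w. cblinfun_apply J w = q (rank1 w e)" "closed (range (cblinfun_apply J))"
proof -
  define \<tau> where "\<tau> = cblinfun_apply T (rank1 e e)"
  have ip: "cinner (q (rank1 v e)) (q (rank1 w e)) = cinner v w * \<tau>" for v w
    unfolding realises_completion_cinner[OF q] adj_rank1 rank1_compose_rank1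
    by (simp add: cblinfun_scaleC_right scaleC_complex_def \<tau>_def)
  have nrm: "norm (q (rank1 w e)) = sqrt (cmod \<tau>) * norm w" for w
  proof -
    have "cmod (cinner (q (rank1 w e)) (q (rank1 w e))) = (norm w)\<^sup>2 * cmod \<tau>"
      unfolding ip by (simp add: cinner_self norm_mult norm_power)
    then have "(norm (q (rank1 w e)))\<^sup>2 = (norm w)\<^sup>2 * cmod \<tau>" by (simp add: cinner_self norm_power)
    then have "sqrt ((norm (q (rank1 w e)))\<^sup>2) = sqrt ((norm w)\<^sup>2 * cmod \<tau>)" by simp
    then show ?thesis by (simp add: real_sqrt_mult mult.commute)
  qed
  have "clinear (\<lambda>w. q (rank1 w e))"
    unfolding clinear_def
    by (simp add: clinear_add[OF rank1_clinear] clinear_scaleC[OF rank1_clinear]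
        clinear_add[OF realises_completion_clinear[OF q]] clinear_scaleC[OF realises_completion_clinear[OF q]])
  then obtain J where J: "\<And>w. cblinfun_apply J w = q (rank1 w e)"
    using cblinfun_of_clinear[of "\<lambda>w. q (rank1 w e)"] nrm by (metis order_refl)
  have "closed (range (cblinfun_apply J))"
  proof (cases "\<tau> = 0")
    case True
    then have "cblinfun_apply J w = 0" for w using nrm[of w] by (simp add: J)
    then have "range (cblinfun_apply J) = {0}" by auto
    then show ?thesis by simp
  next
    case False
    have "complete (cblinfun_apply J ` UNIV)"
      by (rule complete_isometric_image[of "sqrt (cmod \<tau>)"])
        (use False in \<open>auto simp: J nrm bounded_linear_cblinfun complete_UNIV\<close>)
    then show ?thesis by (rule complete_imp_closed)
  qed
  then show ?thesis using that J by blast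
qed

text \<open>Treats one Hilbert space \<open>E\<close> at a time; statements that compare several
  spaces combine several interpretations.\<close>

locale completion =
  fixes T :: "('h::chilbert \<Rightarrow>\<^sub>C\<^sub>L 'h) \<Rightarrow>\<^sub>C\<^sub>L complex"
    and \<Lambda> :: "'a::cbanach \<Rightarrow>\<^sub>C\<^sub>L ('h \<Rightarrow>\<^sub>C\<^sub>L 'h) \<Rightarrow>\<^sub>C\<^sub>L complex"
    and q :: "('h \<Rightarrow>\<^sub>C\<^sub>L 'e::chilbert) \<Rightarrow> 'x::chilbert" and e :: 'h
  assumes q: "realises_completion T q" and cb: "cb_abs_cont T \<Lambda> TYPE('e)"
begin

abbreviation "M \<equiv> T_completion q"
abbreviation "S \<equiv> rank1_space q e"
abbreviation "lam W V X \<equiv> functional_of \<Lambda> (sandwich W V X)"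
abbreviation "L \<equiv> L_op T \<Lambda> q"

lemmas q_linear = realises_completion_clinear[OF q]
lemmas q_cinner = realises_completion_cinner[OF q]

lemma T_commute:
  fixes V W :: "'h \<Rightarrow>\<^sub>C\<^sub>L 'e"
  shows "cblinfun_apply T (W\<^sup>\<dagger> o\<^sub>C V) = cnj (cblinfun_apply T (V\<^sup>\<dagger> o\<^sub>C W))"
  unfolding q_cinner[symmetric] by (rule cinner_commute)

text \<open>\<open>J\<close> is \<open>e\<^sup>* \<otimes> I_E\<close>, so
  \<open>J\<^sup>\<dagger> o\<^sub>C A o\<^sub>C J\<close> is the compression of \<open>A\<close> in
  the definition of \<open>F\<close>.\<close>

definition J :: "'e \<Rightarrow>\<^sub>C\<^sub>L 'x"
  where "J = (SOME J. \<forall>w. cblinfun_apply J w = q (rank1 w e))"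

lemma J: "cblinfun_apply J w = q (rank1 w e)"
proof -
  have "\<exists>J. \<forall>w. cblinfun_apply J w = q (rank1 w e)" by (rule rank1_embedding[OF q, of e]) blast
  from someI_ex[OF this] show ?thesis unfolding J_def by blast
qed

lemma S_eq: "S = range (cblinfun_apply J)"
  by (simp add: rank1_space_def J)

lemma closed_S: "closed S"
proof (rule rank1_embedding[OF q, of e])
  fix J' assume "\<And>w. cblinfun_apply J' w = q (rank1 w e)" "closed (range (cblinfun_apply J'))"
  then show "closed S" by (simp add: rank1_space_def)
qed

sublocale subspace_pair M S
proof
  show "closed M" "csubspace M"
    unfolding T_completion_def by (simp_all add: csubspace_closure csubspace_range q_linear)
  show "closed S" by (rule closed_S)
  show "csubspace S" unfolding S_eq by (rule csubspace_range[OF clinear_cblinfun])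
  show "S \<subseteq> M" unfolding S_eq T_completion_def by (auto simp: J intro: closure_subset[THEN subsetD])
qed

lemma q_mem: "q V \<in> M"
  unfolding T_completion_def by (auto intro: closure_subset[THEN subsetD])

lemma J_mem: "cblinfun_apply J w \<in> S"
  by (simp add: S_eq)

lemma M_induct:
  assumes "x \<in> M" "closed {x. P x}" "\<And>V. P (q V)"
  shows "P x"
proof -
  have "closure (range q) \<subseteq> {x. P x}" by (rule closure_minimal) (use assms in auto)
  then show ?thesis using assms(1) unfolding T_completion_def by blast
qed

text \<open>By density of the classes, the matrix entries at \<open>q W\<close> and
  \<open>q V\<close> determine an operator on the completion. This is the uniqueness behind
  \<open>L_op\<close> and behind the linearity of \<open>\<Lambda>_op\<close>.\<close>

lemma ops_on_M_eqI:
  assumes A: "A \<in> ops_on M" and B: "B \<in> ops_on M"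
    and eq: "\<And>V W. cinner (q W) (cblinfun_apply A (q V)) = cinner (q W) (cblinfun_apply B (q V))"
  shows "A = B"
proof (rule ops_on_eqI[OF M A B])
  fix x assume "x \<in> M"
  then show "cblinfun_apply A x = cblinfun_apply B x"
  proof (rule M_induct)
    show "closed {x. cblinfun_apply A x = cblinfun_apply B x}"
      by (intro closed_Collect_eq linear_continuous_on bounded_linear_cblinfun)
    show "cblinfun_apply A (q V) = cblinfun_apply B (q V)" for V
    proof (rule closure_eqI[OF csubspace_range[OF q_linear]])
      show "cblinfun_apply A (q V) \<in> closure (range q)" "cblinfun_apply B (q V) \<in> closure (range q)"
        using A B unfolding T_completion_def by (auto simp: ops_on_def)
    qed (auto simp: eq)
  qed
qed

text \<open>Since \<open>T (V\<^sup>\<dagger> o\<^sub>C V)\<close> is the squared norm of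
  \<open>q V\<close>, complete absolute continuity is boundedness of the form of
  \<open>\<lambda>\<close> on classes. One constant serves every \<open>X\<close>, as the pencil
  expansion requires.\<close>

lemma \<Lambda>_op_ex:
  "\<exists>c N. 0 \<le> c \<and> (\<forall>X. N X \<in> ops_on M \<and> norm (N X) \<le> c * norm X
    \<and> (\<forall>V W. cinner (q W) (cblinfun_apply (N X) (q V)) = lam W V X))"
proof -
  obtain c where c: "\<And>(X :: ('a, 'e \<Rightarrow>\<^sub>C\<^sub>L 'e) ptensor) V W. cmod (lam W V X)
      \<le> c * norm X * sqrt (Re (T (W\<^sup>\<dagger> o\<^sub>C W))) * sqrt (Re (T (V\<^sup>\<dagger> o\<^sub>C V)))"
    using cb unfolding cb_abs_cont_def by blast
  have bd: "cmod (lam W V X) \<le> \<bar>c\<bar> * norm X * norm (q W) * norm (q V)" for X V W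
  proof -
    have "sqrt (Re (T (V\<^sup>\<dagger> o\<^sub>C V))) = norm (q V)" for V
      by (simp add: q_cinner[symmetric] cinner_self del: of_real_power)
    then have "cmod (lam W V X) \<le> c * norm X * norm (q W) * norm (q V)" using c[of W V X] by simp
    also have "\<dots> \<le> \<bar>c\<bar> * norm X * norm (q W) * norm (q V)" by (intro mult_right_mono) auto
    finally show ?thesis .
  qed
  have "\<exists>N. N \<in> ops_on M \<and> norm N \<le> \<bar>c\<bar> * norm X
    \<and> (\<forall>V W. cinner (q W) (cblinfun_apply N (q V)) = lam W V X)" for X
  proof (rule sesquilinear_operator[OF q_linear q_linear, of "\<lambda>W V. lam W V X" "\<bar>c\<bar> * norm X"])
    fix N :: "'x \<Rightarrow>\<^sub>C\<^sub>L 'x"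
    assume N: "\<And>x. cblinfun_apply N x \<in> closure (range q)" "\<And>x. x \<in> orth (range q) \<Longrightarrow> cblinfun_apply N x = 0"
      "\<And>V W. cinner (q W) (cblinfun_apply N (q V)) = lam W V X" "norm N \<le> \<bar>c\<bar> * norm X"
    then have "N \<in> ops_on M" by (simp add: ops_on_def T_completion_def orth_closure)
    then show ?thesis using N by blast
  qed (use bd in \<open>auto simp: functional_sandwich_simps\<close>)
  then show ?thesis by (intro exI[of _ "\<bar>c\<bar>"]) (metis abs_ge_zero)
qed

definition \<Lambda>_op :: "('a, 'e \<Rightarrow>\<^sub>C\<^sub>L 'e) ptensor \<Rightarrow> ('x \<Rightarrow>\<^sub>C\<^sub>L 'x)"
  where "\<Lambda>_op X = (SOME N. N \<in> ops_on M \<and> (\<forall>V W. cinner (q W) (cblinfun_apply N (q V)) = lam W V X))"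

lemma \<Lambda>_op: "\<Lambda>_op X \<in> ops_on M" "cinner (q W) (cblinfun_apply (\<Lambda>_op X) (q V)) = lam W V X"
proof -
  have "\<exists>N. N \<in> ops_on M \<and> (\<forall>V W. cinner (q W) (cblinfun_apply N (q V)) = lam W V X)"
    using \<Lambda>_op_ex by blast
  from someI_ex[OF this]
  show "\<Lambda>_op X \<in> ops_on M" "cinner (q W) (cblinfun_apply (\<Lambda>_op X) (q V)) = lam W V X"
    unfolding \<Lambda>_op_def by blast+
qed

lemma ops_on_M_add: "A \<in> ops_on M \<Longrightarrow> B \<in> ops_on M \<Longrightarrow> A + B \<in> ops_on M"
  using csubspace_add[OF M(2)] by (simp add: ops_on_def cblinfun_simps)

lemma ops_on_M_scaleC: "A \<in> ops_on M \<Longrightarrow> c *\<^sub>C A \<in> ops_on M"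
  using csubspace_scaleC[OF M(2)] by (simp add: ops_on_def cblinfun_simps)

lemma \<Lambda>_op_clinear: "clinear \<Lambda>_op"
  unfolding clinear_def
proof (intro conjI allI)
  fix X Y c
  show "\<Lambda>_op (X + Y) = \<Lambda>_op X + \<Lambda>_op Y"
    by (rule ops_on_M_eqI)
      (simp_all add: \<Lambda>_op ops_on_M_add cblinfun_simps cinner_simps clinear_add[OF sandwich_clinear]
        functional_of_def pt_eval_plus)
  show "\<Lambda>_op (c *\<^sub>C X) = c *\<^sub>C \<Lambda>_op X"
    by (rule ops_on_M_eqI)
      (simp_all add: \<Lambda>_op ops_on_M_scaleC cblinfun_simps cinner_simps clinear_scaleC[OF sandwich_clinear]
        functional_of_def pt_eval_scaleC)
qed

lemma \<Lambda>_op_bound: "\<exists>c. \<forall>X. norm (\<Lambda>_op X) \<le> c * norm X"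
proof -
  obtain c N where N: "\<And>X. N X \<in> ops_on M" "\<And>X. norm (N X) \<le> c * norm X"
    "\<And>X V W. cinner (q W) (cblinfun_apply (N X) (q V)) = lam W V X"
    using \<Lambda>_op_ex by blast
  have "\<Lambda>_op X = N X" for X by (rule ops_on_M_eqI) (simp_all add: N \<Lambda>_op)
  then show ?thesis using N(2) by auto
qed

text \<open>The \<open>T\<close> part of the form is the inner product of the completion, so its
  operator is the identity of \<open>M\<close>, encoded as \<open>proj_on M\<close>. This exhibits
  \<open>L\<close> as affine in \<open>X\<close>.\<close>

lemma L_eq: "L X = proj_on M + \<Lambda>_op X"
  unfolding L_op_def
proof (rule the_equality)
  have P: "proj_on M \<in> ops_on M" using proj_on_props[OF M] by blast
  show *: "proj_on M + \<Lambda>_op X \<in> ops_on M \<and> (\<forall>V W. cinner (q W) (cblinfun_apply (proj_on M + \<Lambda>_op X) (q V))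
      = T (W\<^sup>\<dagger> o\<^sub>C V) + lam W V X)"
    by (simp add: ops_on_M_add P \<Lambda>_op cblinfun_simps cinner_simps proj_on_fixes[OF M q_mem] q_cinner)
  show "Z = proj_on M + \<Lambda>_op X" if "Z \<in> ops_on M \<and> (\<forall>V W. cinner (q W) (cblinfun_apply Z (q V))
      = T (W\<^sup>\<dagger> o\<^sub>C V) + lam W V X)" for Z
    by (rule ops_on_M_eqI) (use that * in auto)
qed

lemma L_ops_on: "L X \<in> ops_on M"
  unfolding L_eq using proj_on_props[OF M] by (intro ops_on_M_add \<Lambda>_op) blast

lemma L_form: "cinner (q W) (cblinfun_apply (L X) (q V)) = T (W\<^sup>\<dagger> o\<^sub>C V) + lam W V X"
  unfolding L_eq by (simp add: \<Lambda>_op cblinfun_simps cinner_simps proj_on_fixes[OF M q_mem] q_cinner)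

lemma L_add: "L (X + Y) = L X + \<Lambda>_op Y"
  by (simp add: L_eq clinear_add[OF \<Lambda>_op_clinear] add.assoc)

text \<open>Nonnegativity on classes passes to limits. The resulting condition does not mention the
  completion, so it can be transferred between different Hilbert spaces.\<close>

lemma positive_L_iff: "positive_op (L X) \<longleftrightarrow> (\<forall>V. T (V\<^sup>\<dagger> o\<^sub>C V) + lam V V X \<in> \<real>\<^sub>\<ge>\<^sub>0)"
proof
  show "\<forall>V. T (V\<^sup>\<dagger> o\<^sub>C V) + lam V V X \<in> \<real>\<^sub>\<ge>\<^sub>0" if "positive_op (L X)"
    using that unfolding positive_op_def L_form[symmetric] by blast
  assume *: "\<forall>V. T (V\<^sup>\<dagger> o\<^sub>C V) + lam V V X \<in> \<real>\<^sub>\<ge>\<^sub>0"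
  show "positive_op (L X)"
    unfolding positive_op_def
  proof
    fix x
    have "cinner y (L X y) \<in> \<real>\<^sub>\<ge>\<^sub>0" if "y \<in> M" for y
      using that
    proof (rule M_induct)
      have "continuous_on UNIV (\<lambda>y. cinner y (L X y))"
        by (intro bounded_bilinear.continuous_on[OF bounded_bilinear_cinner]
            linear_continuous_on bounded_linear_cblinfun continuous_on_id)
      from continuous_closed_vimage[OF closed_nonneg_Reals_complex, of "\<lambda>y. cinner y (L X y)"] this
      show "closed {y. cinner y (L X y) \<in> \<real>\<^sub>\<ge>\<^sub>0}"
        by (simp add: vimage_def continuous_on_eq_continuous_at)
    qed (use * in \<open>simp add: L_form\<close>)
    then show "cinner x (L X x) \<in> \<real>\<^sub>\<ge>\<^sub>0"
      using ops_on_M_form[OF L_ops_on, of x X] proj_on_mem[OF M] by simp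
  qed
qed

section \<open>The function \<open>F\<close>\<close>

lemma is_F_iff: "is_F T \<Lambda> q e X G \<longleftrightarrow> (\<exists>A. is_schur M S (L X) A \<and> G = J\<^sup>\<dagger> o\<^sub>C A o\<^sub>C J)"
proof -
  have "(\<forall>v w. cinner w (cblinfun_apply G v) = cinner (q (rank1 w e)) (cblinfun_apply A (q (rank1 v e))))
      \<longleftrightarrow> G = J\<^sup>\<dagger> o\<^sub>C A o\<^sub>C J" for A
  proof
    assume *: "\<forall>v w. cinner w (cblinfun_apply G v) = cinner (q (rank1 w e)) (cblinfun_apply A (q (rank1 v e)))"
    show "G = J\<^sup>\<dagger> o\<^sub>C A o\<^sub>C J"
      by (rule cblinfun_eqI, rule cinner_eqI_right) (simp add: * cinner_adj_right J)
  qed (simp add: cinner_adj_right J)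
  then show ?thesis unfolding is_F_def by metis
qed

lemma F_invertible:
  assumes "invertible_on S' (Z22 (L X))"
  shows "\<exists>!G. is_F T \<Lambda> q e X G" "F_fun T \<Lambda> q e X = J\<^sup>\<dagger> o\<^sub>C schur (L X) o\<^sub>C J"
proof -
  have *: "is_F T \<Lambda> q e X G \<longleftrightarrow> G = J\<^sup>\<dagger> o\<^sub>C schur (L X) o\<^sub>C J" for G
    unfolding is_F_iff is_schur_invertible[OF L_ops_on assms] by blast
  show "\<exists>!G. is_F T \<Lambda> q e X G" by (simp add: *)
  show "F_fun T \<Lambda> q e X = J\<^sup>\<dagger> o\<^sub>C schur (L X) o\<^sub>C J" unfolding F_fun_def * by simp
qed

lemma F_positive:
  assumes pos: "positive_op (L X)"
  shows "\<exists>!G. is_F T \<Lambda> q e X G" "\<exists>A. is_short (L X) A \<and> F_fun T \<Lambda> q e X = J\<^sup>\<dagger> o\<^sub>C A o\<^sub>C J"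
proof -
  obtain A where A: "is_short (L X) A" using is_short_ex[OF pos L_ops_on] by blast
  have *: "is_F T \<Lambda> q e X G \<longleftrightarrow> G = J\<^sup>\<dagger> o\<^sub>C A o\<^sub>C J" for G
    unfolding is_F_iff is_schur_positive[OF pos L_ops_on]
    using A is_short_unique pos by (metis positive_op_iff)
  show "\<exists>!G. is_F T \<Lambda> q e X G" by (simp add: *)
  show "\<exists>A. is_short (L X) A \<and> F_fun T \<Lambda> q e X = J\<^sup>\<dagger> o\<^sub>C A o\<^sub>C J"
    using A unfolding F_fun_def * by auto
qed

text \<open>\<open>L\<close> of the real part of \<open>X\<close> is the real part of the operator
  \<open>L X\<close>, so both have the same real form. Coercivity of the former, which is positive
  and invertible, is coercivity of \<open>L X\<close>.\<close>

lemma L_pos_domain_coercive: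
  assumes star: "banach_involution star" and sa: "selfadjoint_functional star \<Lambda>"
    and X: "X \<in> L_pos_domain star T \<Lambda> q"
  shows "\<exists>c. coercive_on M c (L X)"
proof -
  have X': "positive_op (L (re_part star X))" "invertible_on M (L (re_part star X))"
    using X by (auto simp: L_pos_domain_def)
  have "L (re_part star X) = (1/2) *\<^sub>C (L X + (L X)\<^sup>\<dagger>)"
  proof (rule ops_on_M_eqI[OF L_ops_on])
    show "(1/2) *\<^sub>C (L X + (L X)\<^sup>\<dagger>) \<in> ops_on M"
      by (intro ops_on_M_scaleC ops_on_M_add L_ops_on adj_ops_on[OF M])
    fix V W
    have "cinner (q W) (cblinfun_apply ((L X)\<^sup>\<dagger>) (q V)) = cnj (cinner (q V) (L X (q W)))"
      unfolding cinner_adj_right by (rule cinner_commute)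
    also have "\<dots> = T (W\<^sup>\<dagger> o\<^sub>C V) + cnj (lam V W X)"
      unfolding L_form by (simp add: T_commute[of W V])
    finally show "cinner (q W) (L (re_part star X) (q V)) = cinner (q W) (((1/2) *\<^sub>C (L X + (L X)\<^sup>\<dagger>)) (q V))"
      by (simp add: L_form cblinfun_simps cinner_simps functional_sandwich_re_part[OF star sa] field_simps)
  qed
  then have re: "Re (cinner x (L (re_part star X) x)) = Re (cinner x (L X x))" for x
    by (simp add: cblinfun_simps cinner_simps cinner_adj_right cinner_commute_Re[of "cblinfun_apply (L X) x"])
  show ?thesis
    using positive_invertible_coercive[OF M L_ops_on X'] unfolding coercive_on_def re .
qed

lemma F_L_pos_domain:
  assumes star: "banach_involution star" and sa: "selfadjoint_functional star \<Lambda>"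
    and X: "X \<in> L_pos_domain star T \<Lambda> q"
  shows "\<exists>!G. is_F T \<Lambda> q e X G" "analytic_at (F_fun T \<Lambda> q e) X"
proof -
  obtain c where co: "coercive_on M c (L X)" using L_pos_domain_coercive[OF assms] by blast
  show "\<exists>!G. is_F T \<Lambda> q e X G" by (rule F_invertible(1)[OF coercive_Z22[OF co]])
  obtain K where K: "\<And>X. norm (\<Lambda>_op X) \<le> K * norm X" using \<Lambda>_op_bound by blast
  show "analytic_at (F_fun T \<Lambda> q e) X"
    by (rule analytic_schur[OF L_ops_on co J_mem \<Lambda>_op_clinear K \<Lambda>_op(1)])
      (simp add: F_invertible(2) L_add[symmetric])
qed

text \<open>
  For positive \<open>L(X)\<close>, the form of \<open>F(X)\<close> at \<open>w\<close> is the infimum of \<open>T (V\<^sup>* V) + \<lambda> (V\<^sup>* X V)\<close> over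
  \<open>V \<in> w e\<^sup>* + null_ops\<close>; this does not involve the completion.
\<close>

definition null_ops :: "('h \<Rightarrow>\<^sub>C\<^sub>L 'e) set"
  where "null_ops = {V. \<forall>v. T ((rank1 v e)\<^sup>\<dagger> o\<^sub>C V) = 0}"

definition form :: "('a, 'e \<Rightarrow>\<^sub>C\<^sub>L 'e) ptensor \<Rightarrow> ('h \<Rightarrow>\<^sub>C\<^sub>L 'e) \<Rightarrow> real"
  where "form X V = Re (T (V\<^sup>\<dagger> o\<^sub>C V) + lam V V X)"

lemma null_ops_iff: "V \<in> null_ops \<longleftrightarrow> q V \<in> S'"
  by (auto simp: null_ops_def q_mem orth_def S_eq J q_cinner)

lemma form_eq: "form X (rank1 w e + V) = Re (cinner (J w + q V) (L X (J w + q V)))"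
  by (simp add: form_def L_form[symmetric] clinear_add[OF q_linear] J)

context
  fixes X :: "('a, 'e \<Rightarrow>\<^sub>C\<^sub>L 'e) ptensor"
  assumes pos: "positive_op (L X)"
begin

lemma F_selfadjoint: "(F_fun T \<Lambda> q e X)\<^sup>\<dagger> = F_fun T \<Lambda> q e X"
  using F_positive(2)[OF pos] by (auto simp: is_short_def adj_compose cblinfun_compose_assoc)

lemma F_form_le:
  assumes "V \<in> null_ops"
  shows "Re (cinner w (F_fun T \<Lambda> q e X w)) \<le> form X (rank1 w e + V)"
proof -
  obtain A where A: "is_short (L X) A" "F_fun T \<Lambda> q e X = J\<^sup>\<dagger> o\<^sub>C A o\<^sub>C J" using F_positive(2)[OF pos] by blast
  have "Re (cinner (J w) (A (J w))) \<le> Re (cinner (J w + q V) (L X (J w + q V)))"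
    by (rule is_short_le[OF A(1)]) (use pos J_mem assms in \<open>simp_all add: positive_op_iff null_ops_iff\<close>)
  then show ?thesis by (simp add: form_eq A(2) cinner_adj_right)
qed

text \<open>A near minimiser \<open>t\<close> in the completion is approximated by classes, and
  subtracting their projections to \<open>S\<close> restores orthogonality. The difference is again
  a class, since \<open>S\<close> consists of the classes \<open>q (rank1 v e)\<close>, and the form
  is continuous.\<close>

lemma F_form_approx:
  assumes \<epsilon>: "0 < \<epsilon>"
  shows "\<exists>V\<in>null_ops. form X (rank1 w e + V) \<le> Re (cinner w (F_fun T \<Lambda> q e X w)) + \<epsilon>"
proof -
  obtain A where A: "is_short (L X) A" "F_fun T \<Lambda> q e X = J\<^sup>\<dagger> o\<^sub>C A o\<^sub>C J" using F_positive(2)[OF pos] by blast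
  obtain t where t: "t \<in> S'" "Re (cinner (J w + t) (L X (J w + t))) \<le> Re (cinner (J w) (A (J w))) + \<epsilon> / 2"
    using A(1) J_mem half_gt_zero[OF \<epsilon>] unfolding is_short_def by blast
  have "t \<in> closure (range q)" using t(1) by (simp add: T_completion_def)
  then obtain x where x: "\<And>n. x n \<in> range q" "x \<longlonglongrightarrow> t" by (auto simp: closure_sequential)
  define y where "y n = x n - P1 (x n)" for n
  have "\<exists>V. V \<in> null_ops \<and> y n = q V" for n
  proof -
    obtain V where V: "x n = q V" using x(1) by blast
    obtain v where v: "P1 (x n) = q (rank1 v e)" using P_simps(1)[of "x n"] unfolding S_eq J by blast
    have yq: "y n = q (V - rank1 v e)" using V v by (simp add: y_def clinear_diff[OF q_linear])
    have "y n \<in> orth S" unfolding y_def by (rule diff_proj_on[OF S])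
    then have "q (V - rank1 v e) \<in> S'" using q_mem yq by simp
    then show ?thesis using yq null_ops_iff by blast
  qed
  then obtain V where V: "\<And>n. V n \<in> null_ops" "\<And>n. y n = q (V n)" by metis
  \<comment> \<open>\<open>P1 t = 0\<close>, so the correction does not change the limit.\<close>
  have "y \<longlonglongrightarrow> t - P1 t"
    unfolding y_def by (intro tendsto_diff x bounded_linear.tendsto[OF bounded_linear_cblinfun])
  then have y: "y \<longlonglongrightarrow> t" using t(1) by simp
  have "(\<lambda>n. Re (cinner (J w + y n) (L X (J w + y n)))) \<longlonglongrightarrow> Re (cinner (J w + t) (L X (J w + t)))"
    by (intro tendsto_Re tendsto_cinner tendsto_add tendsto_const y bounded_linear.tendsto[OF bounded_linear_cblinfun])
  then have "\<forall>\<^sub>F n in sequentially. Re (cinner (J w + y n) (L X (J w + y n))) < Re (cinner (J w) (A (J w))) + \<epsilon>"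
    by (rule order_tendstoD(2)) (use t(2) \<epsilon> in linarith)
  then obtain n where "Re (cinner (J w + y n) (L X (J w + y n))) < Re (cinner (J w) (A (J w))) + \<epsilon>"
    by (auto simp: eventually_sequentially)
  then show ?thesis using V(1)[of n]
    by (intro bexI[of _ "V n"]) (simp_all add: form_eq A(2) cinner_adj_right V(2)[symmetric])
qed

end

end

section \<open>Isometries and direct sums\<close>

lemma D_set_iff: "X \<in> D_set star T \<Lambda> q \<longleftrightarrow> tensor_star star X = X \<and> positive_op (L_op T \<Lambda> q X)"
  by (simp add: D_set_def)

lemma rank1_zero: "rank1 0 e = 0"
  by (rule clinear_zero[OF rank1_clinear])

lemma adj_zero_compose: "0\<^sup>\<dagger> o\<^sub>C V = 0"
  by (rule cblinfun_eqI, rule cinner_eqI_right) (simp add: cinner_adj_right cblinfun_simps)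

lemma compose_prod:
  fixes V W :: "'h::chilbert \<Rightarrow>\<^sub>C\<^sub>L ('e::chilbert \<times> 'k::chilbert)"
  shows "W\<^sup>\<dagger> o\<^sub>C V = (fst_cblinfun o\<^sub>C W)\<^sup>\<dagger> o\<^sub>C (fst_cblinfun o\<^sub>C V) + (snd_cblinfun o\<^sub>C W)\<^sup>\<dagger> o\<^sub>C (snd_cblinfun o\<^sub>C V)"
  by (rule cblinfun_eqI, rule cinner_eqI_right)
    (simp add: cinner_adj_right cblinfun_simps cinner_simps cinner_prod_def)

lemma adj_op_dsum: "(A \<oplus>\<^sub>o\<^sub>p B)\<^sup>\<dagger> = A\<^sup>\<dagger> \<oplus>\<^sub>o\<^sub>p B\<^sup>\<dagger>"
  by (rule adj_eqI) (simp add: op_dsum_apply cinner_prod_def cinner_adj_right)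

lemma isometry_adj_compose:
  assumes "\<And>v. norm (cblinfun_apply W v) = norm v"
  shows "W\<^sup>\<dagger> o\<^sub>C W = id_cblinfun"
  by (rule cblinfun_eq_of_form) (simp add: cinner_adj_right cinner_self assms)

lemma sandwich_isometry:
  fixes W :: "'e::chilbert \<Rightarrow>\<^sub>C\<^sub>L 'k::chilbert" and qE :: "('h::chilbert \<Rightarrow>\<^sub>C\<^sub>L 'e) \<Rightarrow> 'x::chilbert"
    and qK :: "('h \<Rightarrow>\<^sub>C\<^sub>L 'k) \<Rightarrow> 'y::chilbert" and T e and \<Lambda> :: "'a::cbanach \<Rightarrow>\<^sub>C\<^sub>L ('h \<Rightarrow>\<^sub>C\<^sub>L 'h) \<Rightarrow>\<^sub>C\<^sub>L complex"
  assumes E: "completion T \<Lambda> qE" and K: "completion T \<Lambda> qK"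
    and W: "\<And>v. norm (cblinfun_apply W v) = norm v"
    and posK: "positive_op (L_op T \<Lambda> qK X)" and posE: "positive_op (L_op T \<Lambda> qE (sandwich W W X))"
  shows "W\<^sup>\<dagger> o\<^sub>C F_fun T \<Lambda> qK e X o\<^sub>C W \<le>\<^sub>L F_fun T \<Lambda> qE e (sandwich W W X)"
proof -
  interpret E: completion T \<Lambda> qE e by (rule E)
  interpret K: completion T \<Lambda> qK e by (rule K)
  let ?FK = "F_fun T \<Lambda> qK e X" and ?FE = "F_fun T \<Lambda> qE e (sandwich W W X)"
  note W1 = isometry_adj_compose[OF W]
  \<comment> \<open>The isometry preserves the \<open>T\<close> part of the form; the
    \<open>\<lambda>\<close> part transfers by \<open>sandwich_sandwich\<close>.\<close>
  have WV: "(W o\<^sub>C V)\<^sup>\<dagger> o\<^sub>C (W o\<^sub>C V) = V\<^sup>\<dagger> o\<^sub>C V" for V :: "'h \<Rightarrow>\<^sub>C\<^sub>L 'e"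
    unfolding adj_compose cblinfun_compose_assoc by (simp add: cblinfun_compose_assoc[symmetric] W1)
  have sa: "(W\<^sup>\<dagger> o\<^sub>C ?FK o\<^sub>C W)\<^sup>\<dagger> = W\<^sup>\<dagger> o\<^sub>C ?FK o\<^sub>C W"
    by (simp add: adj_compose cblinfun_compose_assoc K.F_selfadjoint[OF posK])
  \<comment> \<open>Pairing \<open>W o\<^sub>C V\<close> with \<open>v e\<^sup>*\<close> is pairing
    \<open>V\<close> with the rank one operator of \<open>W\<^sup>\<dagger> v\<close>.\<close>
  have null: "W o\<^sub>C V \<in> K.null_ops" if "V \<in> E.null_ops" for V
  proof -
    have "(rank1 v e)\<^sup>\<dagger> o\<^sub>C (W o\<^sub>C V) = (rank1 (cblinfun_apply (W\<^sup>\<dagger>) v) e)\<^sup>\<dagger> o\<^sub>C V" for v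
      by (simp add: compose_rank1[symmetric] adj_compose cblinfun_compose_assoc)
    then show ?thesis using that by (simp add: K.null_ops_def E.null_ops_def)
  qed
  have form: "K.form X (W o\<^sub>C V) = E.form (sandwich W W X) V" for V
    by (simp add: K.form_def E.form_def WV sandwich_sandwich)
  have "Re (cinner v ((W\<^sup>\<dagger> o\<^sub>C ?FK o\<^sub>C W) v)) \<le> Re (cinner v (?FE v))" for v
  proof (rule field_le_epsilon)
    fix \<epsilon> :: real assume "0 < \<epsilon>"
    then obtain V where V: "V \<in> E.null_ops" "E.form (sandwich W W X) (rank1 v e + V) \<le> Re (cinner v (?FE v)) + \<epsilon>"
      using E.F_form_approx[OF posE] by blast
    have "Re (cinner v ((W\<^sup>\<dagger> o\<^sub>C ?FK o\<^sub>C W) v)) = Re (cinner (W v) (?FK (W v)))"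
      by (simp add: cinner_adj_right)
    also have "\<dots> \<le> K.form X (rank1 (W v) e + W o\<^sub>C V)"
      by (rule K.F_form_le[OF posK null[OF V(1)]])
    also have "\<dots> = E.form (sandwich W W X) (rank1 v e + V)"
      by (simp add: form[symmetric] cblinfun_compose_simps compose_rank1)
    finally show "Re (cinner v ((W\<^sup>\<dagger> o\<^sub>C ?FK o\<^sub>C W) v)) \<le> Re (cinner v (?FE v)) + \<epsilon>" using V(2) by linarith
  qed
  then show ?thesis using loewner_le_iff[OF sa E.F_selfadjoint[OF posE]] by blast
qed

text \<open>An operator into \<open>E \<times> K\<close> is a pair of coordinates, and both the form
  and the orthogonality condition split along it. Assembling near minimisers from coordinates gives
  one inequality between the values of \<open>F\<close>, cutting them into coordinates the
  other.\<close>

lemma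
  fixes qE :: "('h::chilbert \<Rightarrow>\<^sub>C\<^sub>L 'e::chilbert) \<Rightarrow> 'x::chilbert"
    and qK :: "('h \<Rightarrow>\<^sub>C\<^sub>L 'k::chilbert) \<Rightarrow> 'y::chilbert"
    and qEK :: "('h \<Rightarrow>\<^sub>C\<^sub>L ('e \<times> 'k)) \<Rightarrow> 'z::chilbert"
    and T e and \<Lambda> :: "'a::cbanach \<Rightarrow>\<^sub>C\<^sub>L ('h \<Rightarrow>\<^sub>C\<^sub>L 'h) \<Rightarrow>\<^sub>C\<^sub>L complex"
  assumes E: "completion T \<Lambda> qE" and K: "completion T \<Lambda> qK" and EK: "completion T \<Lambda> qEK"
    and posE: "positive_op (L_op T \<Lambda> qE X)" and posK: "positive_op (L_op T \<Lambda> qK Y)"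
  shows positive_L_dsum: "positive_op (L_op T \<Lambda> qEK (X \<oplus>\<^sub>t Y))"
    and F_fun_dsum: "F_fun T \<Lambda> qEK e (X \<oplus>\<^sub>t Y) = F_fun T \<Lambda> qE e X \<oplus>\<^sub>o\<^sub>p F_fun T \<Lambda> qK e Y"
proof -
  interpret E: completion T \<Lambda> qE e by (rule E)
  interpret K: completion T \<Lambda> qK e by (rule K)
  interpret EK: completion T \<Lambda> qEK e by (rule EK)
  have split: "T (V\<^sup>\<dagger> o\<^sub>C V) + functional_of \<Lambda> (sandwich V V (X \<oplus>\<^sub>t Y))
    = (T ((fst_cblinfun o\<^sub>C V)\<^sup>\<dagger> o\<^sub>C (fst_cblinfun o\<^sub>C V)) + functional_of \<Lambda> (sandwich (fst_cblinfun o\<^sub>C V) (fst_cblinfun o\<^sub>C V) X))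
    + (T ((snd_cblinfun o\<^sub>C V)\<^sup>\<dagger> o\<^sub>C (snd_cblinfun o\<^sub>C V)) + functional_of \<Lambda> (sandwich (snd_cblinfun o\<^sub>C V) (snd_cblinfun o\<^sub>C V) Y))"
    for V :: "'h \<Rightarrow>\<^sub>C\<^sub>L ('e \<times> 'k)"
    unfolding functional_sandwich_dsum by (subst compose_prod) (simp add: cblinfun_right_simps)
  show pos: "positive_op (L_op T \<Lambda> qEK (X \<oplus>\<^sub>t Y))"
    unfolding EK.positive_L_iff split
    using posE posK unfolding E.positive_L_iff K.positive_L_iff by (blast intro: nonneg_Reals_add_I)
  have form: "EK.form (X \<oplus>\<^sub>t Y) V = E.form X (fst_cblinfun o\<^sub>C V) + K.form Y (snd_cblinfun o\<^sub>C V)" for V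
    unfolding EK.form_def E.form_def K.form_def split by simp
  have null_split: "T ((rank1 v e)\<^sup>\<dagger> o\<^sub>C V) = T ((rank1 (fst v) e)\<^sup>\<dagger> o\<^sub>C (fst_cblinfun o\<^sub>C V))
      + T ((rank1 (snd v) e)\<^sup>\<dagger> o\<^sub>C (snd_cblinfun o\<^sub>C V))" for v and V :: "'h \<Rightarrow>\<^sub>C\<^sub>L ('e \<times> 'k)"
    by (subst compose_prod) (simp add: compose_rank1 cblinfun_right_simps)
  have null: "V \<in> EK.null_ops \<longleftrightarrow> fst_cblinfun o\<^sub>C V \<in> E.null_ops \<and> snd_cblinfun o\<^sub>C V \<in> K.null_ops" for V
  proof
    assume V: "V \<in> EK.null_ops"
    \<comment> \<open>Testing against \<open>(v, 0)\<close>, and below against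
      \<open>(0, v)\<close>, separates the coordinates.\<close>
    have "T ((rank1 v e)\<^sup>\<dagger> o\<^sub>C (fst_cblinfun o\<^sub>C V)) = 0" for v
      using V null_split[of "(v, 0)" V] by (simp add: EK.null_ops_def rank1_zero adj_zero_compose)
    moreover have "T ((rank1 v e)\<^sup>\<dagger> o\<^sub>C (snd_cblinfun o\<^sub>C V)) = 0" for v
      using V null_split[of "(0, v)" V] by (simp add: EK.null_ops_def rank1_zero adj_zero_compose)
    ultimately show "fst_cblinfun o\<^sub>C V \<in> E.null_ops \<and> snd_cblinfun o\<^sub>C V \<in> K.null_ops"
      by (simp add: E.null_ops_def K.null_ops_def)
  qed (simp add: EK.null_ops_def E.null_ops_def K.null_ops_def null_split)
  let ?F = "F_fun T \<Lambda> qEK e (X \<oplus>\<^sub>t Y)" and ?E = "F_fun T \<Lambda> qE e X" and ?K = "F_fun T \<Lambda> qK e Y"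
  have sa: "(?E \<oplus>\<^sub>o\<^sub>p ?K)\<^sup>\<dagger> = ?E \<oplus>\<^sub>o\<^sub>p ?K"
    by (simp add: adj_op_dsum E.F_selfadjoint[OF posE] K.F_selfadjoint[OF posK])
  note saF = EK.F_selfadjoint[OF pos]
  have sum: "Re (cinner w ((?E \<oplus>\<^sub>o\<^sub>p ?K) w)) = Re (cinner (fst w) (?E (fst w))) + Re (cinner (snd w) (?K (snd w)))" for w
    by (simp add: op_dsum_apply cinner_prod_def)
  have "Re (cinner w (?F w)) \<le> Re (cinner w ((?E \<oplus>\<^sub>o\<^sub>p ?K) w))" for w
  proof (rule field_le_epsilon)
    fix \<epsilon> :: real assume "0 < \<epsilon>"
    then have \<epsilon>: "0 < \<epsilon> / 2" by simp
    obtain V1 where V1: "V1 \<in> E.null_ops" "E.form X (rank1 (fst w) e + V1) \<le> Re (cinner (fst w) (?E (fst w))) + \<epsilon> / 2"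
      using E.F_form_approx[OF posE \<epsilon>] by blast
    obtain V2 where V2: "V2 \<in> K.null_ops" "K.form Y (rank1 (snd w) e + V2) \<le> Re (cinner (snd w) (?K (snd w))) + \<epsilon> / 2"
      using K.F_form_approx[OF posK \<epsilon>] by blast
    \<comment> \<open>The pair of near minimisers is admissible for the direct sum, which bounds
      \<open>F\<close> of the direct sum from above.\<close>
    define V where "V = inl_cblinfun o\<^sub>C V1 + inr_cblinfun o\<^sub>C V2"
    have V: "fst_cblinfun o\<^sub>C V = V1" "snd_cblinfun o\<^sub>C V = V2"
      unfolding V_def by (rule cblinfun_eqI, simp add: cblinfun_simps)+
    have "Re (cinner w (?F w)) \<le> EK.form (X \<oplus>\<^sub>t Y) (rank1 w e + V)"
      by (rule EK.F_form_le[OF pos]) (simp add: null V V1 V2)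
    then show "Re (cinner w (?F w)) \<le> Re (cinner w ((?E \<oplus>\<^sub>o\<^sub>p ?K) w)) + \<epsilon>"
      using V1(2) V2(2) by (simp add: form sum cblinfun_compose_simps compose_rank1 V)
  qed
  then have 1: "?F \<le>\<^sub>L ?E \<oplus>\<^sub>o\<^sub>p ?K" using loewner_le_iff[OF saF sa] by blast
  have "Re (cinner w ((?E \<oplus>\<^sub>o\<^sub>p ?K) w)) \<le> Re (cinner w (?F w))" for w
  proof (rule field_le_epsilon)
    fix \<epsilon> :: real assume "0 < \<epsilon>"
    then obtain V where V: "V \<in> EK.null_ops" "EK.form (X \<oplus>\<^sub>t Y) (rank1 w e + V) \<le> Re (cinner w (?F w)) + \<epsilon>"
      using EK.F_form_approx[OF pos] by blast
    \<comment> \<open>Conversely, the coordinates of an admissible operator are admissible, so its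
      value dominates the sum of the two infima.\<close>
    have "Re (cinner (fst w) (?E (fst w))) \<le> E.form X (rank1 (fst w) e + fst_cblinfun o\<^sub>C V)"
      by (rule E.F_form_le[OF posE]) (use V null in simp)
    moreover have "Re (cinner (snd w) (?K (snd w))) \<le> K.form Y (rank1 (snd w) e + snd_cblinfun o\<^sub>C V)"
      by (rule K.F_form_le[OF posK]) (use V null in simp)
    ultimately show "Re (cinner w ((?E \<oplus>\<^sub>o\<^sub>p ?K) w)) \<le> Re (cinner w (?F w)) + \<epsilon>"
      using V(2) by (simp add: form sum cblinfun_compose_simps compose_rank1)
  qed
  then have "?E \<oplus>\<^sub>o\<^sub>p ?K \<le>\<^sub>L ?F" using loewner_le_iff[OF sa saF] by blast
  with 1 show "?F = ?E \<oplus>\<^sub>o\<^sub>p ?K" by (rule loewner_antisym)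
qed

theorem theorem3p10:
  fixes star :: "'a::cbanach \<Rightarrow> 'a"
    and T :: "('h::chilbert \<Rightarrow>\<^sub>C\<^sub>L 'h) \<Rightarrow>\<^sub>C\<^sub>L complex"
    and \<Lambda> :: "'a \<Rightarrow>\<^sub>C\<^sub>L ('h \<Rightarrow>\<^sub>C\<^sub>L 'h) \<Rightarrow>\<^sub>C\<^sub>L complex"
    and e :: 'h
    and qE :: "('h \<Rightarrow>\<^sub>C\<^sub>L 'e::chilbert) \<Rightarrow> 'x::chilbert"
    and qK :: "('h \<Rightarrow>\<^sub>C\<^sub>L 'k::chilbert) \<Rightarrow> 'y::chilbert"
    and qEK :: "('h \<Rightarrow>\<^sub>C\<^sub>L ('e \<times> 'k)) \<Rightarrow> 'z::chilbert"
  assumes "banach_involution star"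
    and "norm e = 1"
    and "positive_functional T"
    and "selfadjoint_functional star \<Lambda>"
    and "cb_abs_cont T \<Lambda> TYPE('e)"
    and "cb_abs_cont T \<Lambda> TYPE('k)"
    and "cb_abs_cont T \<Lambda> TYPE('e \<times> 'k)"
    and "realises_completion T qE"
    and "realises_completion T qK"
    and "realises_completion T qEK"
  shows "(\<forall>X \<in> L_pos_domain star T \<Lambda> qE.
            (\<exists>!G. is_F T \<Lambda> qE e X G) \<and> analytic_at (F_fun T \<Lambda> qE e) X)
       \<and> (\<forall>X \<in> D_set star T \<Lambda> qE. \<exists>!G. is_F T \<Lambda> qE e X G)
       \<and> (\<forall>X \<in> D_set star T \<Lambda> qE. \<forall>Y \<in> D_set star T \<Lambda> qK.
            X \<oplus>\<^sub>t Y \<in> D_set star T \<Lambda> qEK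
          \<and> F_fun T \<Lambda> qEK e (X \<oplus>\<^sub>t Y) = F_fun T \<Lambda> qE e X \<oplus>\<^sub>o\<^sub>p F_fun T \<Lambda> qK e Y)
       \<and> (\<forall>(W :: 'e \<Rightarrow>\<^sub>C\<^sub>L 'k) X.
            (\<forall>v. norm (cblinfun_apply W v) = norm v) \<and> X \<in> D_set star T \<Lambda> qK
            \<and> sandwich W W X \<in> D_set star T \<Lambda> qE
            \<longrightarrow> W\<^sup>\<dagger> o\<^sub>C F_fun T \<Lambda> qK e X o\<^sub>C W \<le>\<^sub>L F_fun T \<Lambda> qE e (sandwich W W X))"
proof -
  have E: "completion T \<Lambda> qE" and K: "completion T \<Lambda> qK" and EK: "completion T \<Lambda> qEK"
    using assms by (simp_all add: completion_def)
  interpret E: completion T \<Lambda> qE e by (rule E)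
  show ?thesis
    using E.F_L_pos_domain[OF assms(1,4)] E.F_positive(1) positive_L_dsum[OF E K EK] F_fun_dsum[OF E K EK]
      sandwich_isometry[OF E K]
    by (auto simp: D_set_iff tensor_star_dsum[OF assms(1)])
qed

end
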